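(* Let $\mu=(\mu_1,\dots,\mu_m)\vdash n$ be any partition. Let $\rho_0:\mathsf Q^\mu\mathsf P\to\mathsf P\mathsf Q^\mu$ and $\iota_0:\mathsf P\mathsf Q^\mu\to\mathsf Q^\mu\mathsf P$ be the morphisms of $\mathcal H$ given by applying $e_\mu$ to the $n$ downward strands and then crossing the upward strand past all of them. For each partition $\mu(s^-)=\mu-\square$, let $\rho_s:\mathsf Q^\mu\mathsf P\to\mathsf Q^{\mu(s^-)}$ be the morphism: apply $e_\mu$, then the symmetrizer on the $\mu_s$ strands of row $s$, move the last strand of row $s$ to the right of all the other downward strands and cap it off with the upward strand $\mathsf P$, then apply $e_{\mu(s^-)}$ to the remaining $n-1$ downward strands. Let $\iota_s:\mathsf Q^{\mu(s^-)}\to\mathsf Q^\mu\mathsf P$ be the morphism: apply $e_{\mu(s^-)}$, then the symmetrizer on the $\mu_s-1$ strands of row $s$, create a cup $\mathsf 1\to\mathsf Q\mathsf P$ to the right of the $n-1$ downward strands, move its downward strand to the last position of row $s$, and apply $e_\mu$ to the resulting $n$ downward strands. These morphisms satisfy the relations $$\rho_s\circ\iota_r=\delta_{s,r}\,\mathsf 1_{\mu(s^-)}\qquad\text{and}\qquad\mathsf 1_{\mathsf Q^\mu\mathsf P}=\sum_{s}\iota_s\circ\rho_s,$$ where $s,r$ range over $0$ and all indices for which $\mu(s^-)=\mu-\square$ is a partition, and $\mathsf 1_{\mu(s^-)}$ is the identity of $\mathsf Q^{\mu(s^-)}$ for $s\ge1$ and the identity of $\mathsf P\mathsf Q^\mu$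 for $s=0$. Consequently, the following isomorphism holds in $\mathcal H$: $$\mathsf Q^\mu\mathsf P\cong\mathsf P\mathsf Q^\mu\oplus\bigoplus_{\lambda=\mu-\square}\mathsf Q^\lambda.$$
   Context: Let $k$ be a field of characteristic zero. Khovanov's Heisenberg category: $\mathcal H'$ is the additive $k$-linear monoidal category generated by two objects $Q_+,Q_-$. Its morphisms are $k$-linear combinations of oriented planar string diagrams up to isotopy rel boundary (read bottom to top; $Q_+$ is an upward strand, $Q_-$ a downward strand), generated by the crossing of two upward strands and the four oriented cups and caps, modulo: (i) the double crossing of two upward strands is the identity; (ii) the braid relation for three upward strands; (iii) the double crossing $Q_+Q_-\to Q_-Q_+\to Q_+Q_-$ is the identity; (iv) the double crossing $Q_-Q_+\to Q_+Q_-\to Q_-Q_+$ is the identity minus the composite of the cap $Q_-Q_+\to\mathsf 1$ followed by the cup $\mathsf 1\to Q_-Q_+$; (v) a counterclockwise circle equals $1$; (vi) an upward strand with a curl on its left is zero. $\mathcal H$ is the Karoubi envelope of $\mathcal H'$. Write $\mathsf P=Q_+$, $\mathsf Q=Q_-$, juxtaposition for $\otimes$, $\mathsf 1$ for the unit object. Relations (i),(ii) (which also hold for downward strands) give an algebra map $k[S_r]\to\mathrm{End}(\mathsf Q^{\otimes r})$. For $\lambda\vdash r$ let $e_\lambda\in k[S_r]$ be the Young idempotent of the row-ordered standard tableau of shape $\lambda$: $e_\lambda=\alpha_\lambda\cdot(\text{row symmetrizer})\cdot(\text{column antisymmetrizer})$ with $\alpha_\lambda$ the scalar making it idempotent (strands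 labelled $1,\dots,r$ from left to right, so the strands of row $s$ are the $s$-th consecutive block, of size $\lambda_s$); $\mathsf Q^\lambda$ is its image in $\mathsf Q^{\otimes r}$. Symmetrizers are normalized to be idempotent. $\mu(s^-)$ denotes the result of removing the last box of row $s$ of $\mu$ (when this is a partition), and $\lambda=\mu-\square$ means that $\lambda$ is obtained from $\mu$ by removing one box. $\delta_{s,r}$ is the Kronecker delta.
   Formalization: For s≥1 the morphism ι_s is multiplied by the scalar (coefficient of id in e_{μ(s^-)})/(coefficient of id in e_μ); with idempotent normalization the unscaled relations fail (for μ=(2), ρ_1ι_1=½·1). The isomorphism is unchanged. *)

theory Defs
  imports "Jordan_Normal_Form.Matrix" "HOL-Combinatorics.Permutations"
begin

section \<open>Linear combinations of oriented string diagrams\<close>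

text \<open>\<open>Up\<close> is the object Q_+ (written P below), \<open>Dn\<close> is Q_- (written Q).  A tensor product of
  generating objects is a word, the unit object is the empty word.\<close>

datatype strand = Up | Dn

type_synonym word = "strand list"

fun dual :: "strand \<Rightarrow> strand" where
  "dual Up = Dn"
| "dual Dn = Up"

text \<open>In \<open>Comp f g\<close> the diagram \<open>f\<close> is stacked on top of \<open>g\<close>; in \<open>Tens f g\<close> the diagram \<open>f\<close> is to
  the left of \<open>g\<close>.  \<open>Cup x\<close> is the cup from the unit object to \<open>x (dual x)\<close>, \<open>Cap x\<close> the cap from
  \<open>x (dual x)\<close> to the unit object.\<close>

datatype 'k dgm =
    Idt word
  | Cross
  | Cup strand
  | Cap strand
  | Zero
  | Add "'k dgm" "'k dgm"
  | Scale 'k "'k dgm"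
  | Comp "'k dgm" "'k dgm"
  | Tens "'k dgm" "'k dgm"

inductive typed :: "'k dgm \<Rightarrow> word \<Rightarrow> word \<Rightarrow> bool" where
  typed_Idt: "typed (Idt a) a a"
| typed_Cross: "typed Cross [Up, Up] [Up, Up]"
| typed_Cup: "typed (Cup x) [] [x, dual x]"
| typed_Cap: "typed (Cap x) [x, dual x] []"
| typed_Zero: "typed Zero a b"
| typed_Add: "typed f a b \<Longrightarrow> typed g a b \<Longrightarrow> typed (Add f g) a b"
| typed_Scale: "typed f a b \<Longrightarrow> typed (Scale c f) a b"
| typed_Comp: "typed g a b \<Longrightarrow> typed f b c \<Longrightarrow> typed (Comp f g) a c"
| typed_Tens: "typed f a b \<Longrightarrow> typed g c d \<Longrightarrow> typed (Tens f g) (a @ c) (b @ d)"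

text \<open>The other crossings are rotations of the crossing of two upward strands: \<open>crossPQ\<close> goes from
  PQ to QP, \<open>crossQP\<close> from QP to PQ, and \<open>crossQQ_l\<close>, \<open>crossQQ_r\<close> are the two rotations by a half
  turn.\<close>

definition crossPQ :: "'k dgm" where
  "crossPQ = Comp (Tens (Idt [Dn, Up]) (Cap Up))
     (Comp (Tens (Idt [Dn]) (Tens Cross (Idt [Dn]))) (Tens (Cup Dn) (Idt [Up, Dn])))"

definition crossQP :: "'k dgm" where
  "crossQP = Comp (Tens (Cap Dn) (Idt [Up, Dn]))
     (Comp (Tens (Idt [Dn]) (Tens Cross (Idt [Dn]))) (Tens (Idt [Dn, Up]) (Cup Up)))"

text \<open>Two nested cups, from the unit object to \<open>x x (dual x) (dual x)\<close>, and two nested caps on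
  this object.\<close>

definition cups2 :: "strand \<Rightarrow> 'k dgm" where
  "cups2 x = Comp (Tens (Idt [x]) (Tens (Cup x) (Idt [dual x]))) (Cup x)"

definition caps2 :: "strand \<Rightarrow> 'k dgm" where
  "caps2 x = Comp (Cap x) (Tens (Idt [x]) (Tens (Cap x) (Idt [dual x])))"

definition crossQQ_l :: "'k dgm" where
  "crossQQ_l = Comp (Tens (caps2 Dn) (Idt [Dn, Dn]))
     (Comp (Tens (Idt [Dn, Dn]) (Tens Cross (Idt [Dn, Dn]))) (Tens (Idt [Dn, Dn]) (cups2 Up)))"

definition crossQQ_r :: "'k dgm" where
  "crossQQ_r = Comp (Tens (Idt [Dn, Dn]) (caps2 Up))
     (Comp (Tens (Idt [Dn, Dn]) (Tens Cross (Idt [Dn, Dn]))) (Tens (cups2 Dn) (Idt [Dn, Dn])))"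

text \<open>The defining congruence.  A small k-linear category with object set O is encoded as the
  (non-unital) algebra that is the direct sum of all its Hom spaces: the identities \<open>Idt a\<close> become
  orthogonal idempotents, composition of non-composable morphisms is zero, and the Hom space from
  \<open>a\<close> to \<open>b\<close> is recovered as \<open>Idt b * A * Idt a\<close>.  This makes addition and composition total.
  The interchange law is imposed for composable pairs only, since the tensor products of two
  non-composable pairs can be composable.

  Isotopy rel boundary is imposed through the zigzag identities for all cups and caps, together
  with the equality of the two half-turn rotations of the crossing (strict pivotality).\<close>

inductive heq :: "'k::field_char_0 dgm \<Rightarrow> 'k dgm \<Rightarrow> bool" (infix \<open>\<approx>\<close> 50) where
  heq_refl: "f \<approx> f"
| heq_sym: "f \<approx> g \<Longrightarrow> g \<approx> f"
| heq_trans: "f \<approx> g \<Longrightarrow> g \<approx> h \<Longrightarrow> f \<approx> h"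
| cong_Add: "f \<approx> f' \<Longrightarrow> g \<approx> g' \<Longrightarrow> Add f g \<approx> Add f' g'"
| cong_Scale: "f \<approx> f' \<Longrightarrow> Scale c f \<approx> Scale c f'"
| cong_Comp: "f \<approx> f' \<Longrightarrow> g \<approx> g' \<Longrightarrow> Comp f g \<approx> Comp f' g'"
| cong_Tens: "f \<approx> f' \<Longrightarrow> g \<approx> g' \<Longrightarrow> Tens f g \<approx> Tens f' g'"
  \<comment> \<open>vector space structure\<close>
| Add_assoc: "Add (Add f g) h \<approx> Add f (Add g h)"
| Add_comm: "Add f g \<approx> Add g f"
| Add_Zero: "Add Zero f \<approx> f"
| Add_inv: "Add f (Scale (- 1) f) \<approx> Zero"
| Scale_one: "Scale 1 f \<approx> f"
| Scale_Scale: "Scale c (Scale d f) \<approx> Scale (c * d) f"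
| Scale_add: "Scale (c + d) f \<approx> Add (Scale c f) (Scale d f)"
| Scale_Add: "Scale c (Add f g) \<approx> Add (Scale c f) (Scale c g)"
  \<comment> \<open>linear category\<close>
| Comp_assoc: "Comp (Comp f g) h \<approx> Comp f (Comp g h)"
| Comp_Add_left: "Comp (Add f g) h \<approx> Add (Comp f h) (Comp g h)"
| Comp_Add_right: "Comp f (Add g h) \<approx> Add (Comp f g) (Comp f h)"
| Comp_Scale_left: "Comp (Scale c f) g \<approx> Scale c (Comp f g)"
| Comp_Scale_right: "Comp f (Scale c g) \<approx> Scale c (Comp f g)"
| Idt_left: "typed f a b \<Longrightarrow> Comp (Idt b) f \<approx> f"
| Idt_right: "typed f a b \<Longrightarrow> Comp f (Idt a) \<approx> f"
| Idt_orth: "a \<noteq> b \<Longrightarrow> Comp (Idt a) (Idt b) \<approx> Zero"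
  \<comment> \<open>strict monoidal structure\<close>
| Tens_assoc: "Tens (Tens f g) h \<approx> Tens f (Tens g h)"
| Tens_unit_left: "Tens (Idt []) f \<approx> f"
| Tens_unit_right: "Tens f (Idt []) \<approx> f"
| Tens_Idt: "Tens (Idt a) (Idt b) \<approx> Idt (a @ b)"
| Tens_Add_left: "Tens (Add f g) h \<approx> Add (Tens f h) (Tens g h)"
| Tens_Add_right: "Tens f (Add g h) \<approx> Add (Tens f g) (Tens f h)"
| Tens_Scale_left: "Tens (Scale c f) g \<approx> Scale c (Tens f g)"
| Tens_Scale_right: "Tens f (Scale c g) \<approx> Scale c (Tens f g)"
| interchange: "typed f' a b \<Longrightarrow> typed f b c \<Longrightarrow> typed g' a' b' \<Longrightarrow> typed g b' c' \<Longrightarrow>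
    Comp (Tens f g) (Tens f' g') \<approx> Tens (Comp f f') (Comp g g')"
  \<comment> \<open>isotopy\<close>
| zigzag1: "Comp (Tens (Cap x) (Idt [x])) (Tens (Idt [x]) (Cup (dual x))) \<approx> Idt [x]"
| zigzag2: "Comp (Tens (Idt [x]) (Cap (dual x))) (Tens (Cup x) (Idt [x])) \<approx> Idt [x]"
| rotation: "crossQQ_l \<approx> crossQQ_r"
  \<comment> \<open>local relations; the left-hand side of \<open>circle\<close> is the counterclockwise circle\<close>
| upup: "Comp Cross Cross \<approx> Idt [Up, Up]"
| braid: "Comp (Tens Cross (Idt [Up])) (Comp (Tens (Idt [Up]) Cross) (Tens Cross (Idt [Up])))
    \<approx> Comp (Tens (Idt [Up]) Cross) (Comp (Tens Cross (Idt [Up])) (Tens (Idt [Up]) Cross))"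
| updown: "Comp crossQP crossPQ \<approx> Idt [Up, Dn]"
| downup: "Comp crossPQ crossQP \<approx> Add (Idt [Dn, Up]) (Scale (- 1) (Comp (Cup Dn) (Cap Dn)))"
| circle: "Comp (Cap Dn) (Cup Dn) \<approx> Idt []"
| left_curl: "Comp (Tens (Cap Dn) (Idt [Up]))
    (Comp (Tens (Idt [Dn]) Cross) (Tens (Cup Dn) (Idt [Up]))) \<approx> Zero"

quotient_type (overloaded) 'k hmor = "'k::field_char_0 dgm" / heq
  by (intro equivpI reflpI sympI transpI) (blast intro: heq_refl heq_sym heq_trans)+

text \<open>Multiplication is composition: \<open>f * g\<close> is \<open>f\<close> after \<open>g\<close>.\<close>

instantiation hmor :: (field_char_0) ring
begin

lift_definition zero_hmor :: "'a hmor" is Zero .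
lift_definition plus_hmor :: "'a hmor \<Rightarrow> 'a hmor \<Rightarrow> 'a hmor" is Add by (rule cong_Add)
lift_definition uminus_hmor :: "'a hmor \<Rightarrow> 'a hmor" is "Scale (- 1)" by (rule cong_Scale)
lift_definition minus_hmor :: "'a hmor \<Rightarrow> 'a hmor \<Rightarrow> 'a hmor" is "\<lambda>f g. Add f (Scale (- 1) g)"
  by (intro cong_Add cong_Scale)
lift_definition times_hmor :: "'a hmor \<Rightarrow> 'a hmor \<Rightarrow> 'a hmor" is Comp by (rule cong_Comp)

instance
proof
  fix a b c :: "'a hmor"
  show "a * b * c = a * (b * c)" by transfer (rule Comp_assoc)
  show "a + b + c = a + (b + c)" by transfer (rule Add_assoc)
  show "a + b = b + a" by transfer (rule Add_comm)
  show "0 + a = a" by transfer (rule Add_Zero)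
  show "- a + a = 0" by transfer (meson Add_comm Add_inv heq_trans)
  show "a - b = a + - b" by transfer (rule heq_refl)
  show "(a + b) * c = a * c + b * c" by transfer (rule Comp_Add_left)
  show "a * (b + c) = a * b + a * c" by transfer (rule Comp_Add_right)
qed

end

lift_definition scal :: "'k::field_char_0 \<Rightarrow> 'k hmor \<Rightarrow> 'k hmor" is Scale by (rule cong_Scale)
lift_definition tens :: "'k::field_char_0 hmor \<Rightarrow> 'k hmor \<Rightarrow> 'k hmor" (infixr \<open>\<boxtimes>\<close> 75)
  is Tens by (rule cong_Tens)
lift_definition idn :: "word \<Rightarrow> 'k::field_char_0 hmor" is Idt .
lift_definition cupQP :: "'k::field_char_0 hmor" is "Cup Dn" .
lift_definition capQP :: "'k::field_char_0 hmor" is "Cap Dn" .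
lift_definition XPQ :: "'k::field_char_0 hmor" is crossPQ .
lift_definition XQP :: "'k::field_char_0 hmor" is crossQP .
lift_definition XQQ :: "'k::field_char_0 hmor" is crossQQ_l .

definition hom :: "word \<Rightarrow> word \<Rightarrow> 'k::field_char_0 hmor set" where
  "hom a b = {f. idn b * f * idn a = f}"


section \<open>The additive category H' and its Karoubi envelope H\<close>

text \<open>Objects of H' are finite formal direct sums of words, morphisms are matrices (rows indexed by
  the summands of the target), composition is matrix multiplication.  An object of H is an
  idempotent \<open>E\<close> on an object \<open>A\<close> of H'; a morphism from \<open>(A, E)\<close> to \<open>(B, F)\<close> is a morphism \<open>M\<close> of
  H' with \<open>F * M * E = M\<close>, and the identity of \<open>(A, E)\<close> is \<open>E\<close>.\<close>

definition add_hom :: "word list \<Rightarrow> word list \<Rightarrow> 'k::field_char_0 hmor mat set" where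
  "add_hom A B = {M \<in> carrier_mat (length B) (length A).
     \<forall>i<length B. \<forall>j<length A. M $$ (i, j) \<in> hom (A ! j) (B ! i)}"

type_synonym 'k hobj = "word list \<times> 'k hmor mat"

definition H_obj :: "'k::field_char_0 hobj set" where
  "H_obj = {(A, E). E \<in> add_hom A A \<and> E * E = E}"

definition H_hom :: "'k::field_char_0 hobj \<Rightarrow> 'k hobj \<Rightarrow> 'k hmor mat set" where
  "H_hom X Y = {M \<in> add_hom (fst X) (fst Y). snd Y * M * snd X = M}"

definition H_id :: "'k::field_char_0 hobj \<Rightarrow> 'k hmor mat" where
  "H_id X = snd X"

definition H_zero :: "'k::field_char_0 hobj \<Rightarrow> 'k hobj \<Rightarrow> 'k hmor mat" where
  "H_zero X Y = 0\<^sub>m (length (fst Y)) (length (fst X))"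

definition H_scal :: "'k::field_char_0 \<Rightarrow> 'k hmor mat \<Rightarrow> 'k hmor mat" where
  "H_scal c M = map_mat (scal c) M"

text \<open>The sum of a finite family of morphisms from \<open>X\<close> to \<open>Y\<close>.\<close>

definition H_sum :: "'k::field_char_0 hobj \<Rightarrow> 'k hobj \<Rightarrow> ('i \<Rightarrow> 'k hmor mat) \<Rightarrow> 'i set \<Rightarrow> 'k hmor mat"
  where "H_sum X Y F I = mat (length (fst Y)) (length (fst X)) (\<lambda>ij. \<Sum>s\<in>I. F s $$ ij)"

definition H_iso :: "'k::field_char_0 hobj \<Rightarrow> 'k hobj \<Rightarrow> bool" where
  "H_iso X Y \<longleftrightarrow> X \<in> H_obj \<and> Y \<in> H_obj \<and>
     (\<exists>M\<in>H_hom X Y. \<exists>N\<in>H_hom Y X. N * M = H_id X \<and> M * N = H_id Y)"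

definition H_dsum :: "'k::field_char_0 hobj list \<Rightarrow> 'k hobj" where
  "H_dsum Xs = (concat (map fst Xs), diag_block_mat (map snd Xs))"

text \<open>Tensor products of formal direct sums are ordered lexicographically, so that the tensor
  product of matrices is the Kronecker product.\<close>

definition kron :: "'k::field_char_0 hmor mat \<Rightarrow> 'k hmor mat \<Rightarrow> 'k hmor mat" where
  "kron M N = mat (dim_row M * dim_row N) (dim_col M * dim_col N)
     (\<lambda>(i, j). M $$ (i div dim_row N, j div dim_col N) \<boxtimes> N $$ (i mod dim_row N, j mod dim_col N))"

definition H_tens :: "'k::field_char_0 hobj \<Rightarrow> 'k hobj \<Rightarrow> 'k hobj" where
  "H_tens X Y = (concat (map (\<lambda>a. map (\<lambda>b. a @ b) (fst Y)) (fst X)), kron (snd X) (snd Y))"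

text \<open>A morphism between words as a morphism of H'.\<close>

definition emb :: "'k::field_char_0 hmor \<Rightarrow> 'k hmor mat" where
  "emb f = mat 1 1 (\<lambda>_. f)"


section \<open>Symmetric groups acting on powers of Q\<close>

definition Qpow :: "nat \<Rightarrow> word" where
  "Qpow r = replicate r Dn"

text \<open>Strands are numbered from 0, from left to right; so are rows and columns in \<open>row_of\<close> and
  \<open>col_of\<close>.\<close>

definition sigma :: "nat \<Rightarrow> nat \<Rightarrow> 'k::field_char_0 hmor" where
  "sigma r i = idn (Qpow i) \<boxtimes> XQQ \<boxtimes> idn (Qpow (r - 2 - i))"

definition word_dgm :: "nat \<Rightarrow> nat list \<Rightarrow> 'k::field_char_0 hmor" where
  "word_dgm r w = foldr (\<lambda>i f. sigma r i * f) w (idn (Qpow r))"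

definition word_perm :: "nat list \<Rightarrow> nat \<Rightarrow> nat" where
  "word_perm w = foldr (\<lambda>i p. Transposition.transpose i (Suc i) \<circ> p) w id"

text \<open>The choice of the word is immaterial because the crossings of downward strands satisfy the
  Coxeter relations.\<close>

definition perm_dgm :: "nat \<Rightarrow> (nat \<Rightarrow> nat) \<Rightarrow> 'k::field_char_0 hmor" where
  "perm_dgm r p = word_dgm r (SOME w. set w \<subseteq> {..<r - 1} \<and> word_perm w = p)"

text \<open>Elements of \<open>k[S_r]\<close> are functions on permutations, vanishing off \<open>{p. p permutes {..<r}}\<close>;
  \<open>conv\<close> is the product for which a product of permutations is their composite, and \<open>act\<close> is the
  algebra map to the endomorphisms of the r-th power of Q.\<close>

type_synonym 'k galg = "(nat \<Rightarrow> nat) \<Rightarrow> 'k"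

definition conv :: "nat \<Rightarrow> 'k::field_char_0 galg \<Rightarrow> 'k galg \<Rightarrow> 'k galg" where
  "conv r x y = (\<lambda>p. \<Sum>q | q permutes {..<r}. x q * y (inv_into UNIV q \<circ> p))"

definition act :: "nat \<Rightarrow> 'k::field_char_0 galg \<Rightarrow> 'k hmor" where
  "act r x = (\<Sum>p | p permutes {..<r}. scal (x p) (perm_dgm r p))"

definition symmetrizer :: "(nat \<Rightarrow> nat) set \<Rightarrow> 'k::field_char_0 galg" where
  "symmetrizer G = (\<lambda>p. if p \<in> G then 1 / of_nat (card G) else 0)"

definition antisymmetrizer :: "(nat \<Rightarrow> nat) set \<Rightarrow> 'k::field_char_0 galg" where
  "antisymmetrizer G = (\<lambda>p. if p \<in> G then of_int (sign p) / of_nat (card G) else 0)"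


section \<open>Partitions and Young idempotents\<close>

definition is_partition :: "nat list \<Rightarrow> nat \<Rightarrow> bool" where
  "is_partition l r \<longleftrightarrow> sorted_wrt (\<ge>) l \<and> (\<forall>x\<in>set l. 0 < x) \<and> sum_list l = r"

text \<open>The row and the column of strand \<open>i\<close> in the row-ordered standard tableau.\<close>

fun row_of :: "nat list \<Rightarrow> nat \<Rightarrow> nat" where
  "row_of [] i = 0"
| "row_of (x # xs) i = (if i < x then 0 else Suc (row_of xs (i - x)))"

fun col_of :: "nat list \<Rightarrow> nat \<Rightarrow> nat" where
  "col_of [] i = 0"
| "col_of (x # xs) i = (if i < x then i else col_of xs (i - x))"

definition row_group :: "nat list \<Rightarrow> (nat \<Rightarrow> nat) set" where
  "row_group l = {p. p permutes {..<sum_list l} \<and> (\<forall>i<sum_list l. row_of l (p i) = row_of l i)}"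

definition col_group :: "nat list \<Rightarrow> (nat \<Rightarrow> nat) set" where
  "col_group l = {p. p permutes {..<sum_list l} \<and> (\<forall>i<sum_list l. col_of l (p i) = col_of l i)}"

definition young_pre :: "nat list \<Rightarrow> 'k::field_char_0 galg" where
  "young_pre l = conv (sum_list l) (symmetrizer (row_group l)) (antisymmetrizer (col_group l))"

definition young_scalar :: "nat list \<Rightarrow> 'k::field_char_0" where
  "young_scalar l = (THE c. c \<noteq> 0 \<and>
     conv (sum_list l) (\<lambda>p. c * young_pre l p) (\<lambda>p. c * young_pre l p) = (\<lambda>p. c * young_pre l p))"

definition young :: "nat list \<Rightarrow> 'k::field_char_0 galg" where
  "young l = (\<lambda>p. young_scalar l * young_pre l p)"

definition e_mor :: "nat list \<Rightarrow> 'k::field_char_0 hmor" where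
  "e_mor l = act (sum_list l) (young l)"

definition Q_obj :: "nat list \<Rightarrow> 'k::field_char_0 hobj" where
  "Q_obj l = ([Qpow (sum_list l)], emb (e_mor l))"

definition P_obj :: "'k::field_char_0 hobj" where
  "P_obj = ([[Up]], emb (idn [Up]))"

text \<open>Below, \<open>s\<close> is a row number counted from 1.  The list in \<open>removable\<close> may end with 0, but must be
  weakly decreasing before the zero entry is dropped.\<close>

definition removable :: "nat list \<Rightarrow> nat \<Rightarrow> bool" where
  "removable m s \<longleftrightarrow> 1 \<le> s \<and> s \<le> length m \<and> sorted_wrt (\<ge>) (m[s - 1 := m ! (s - 1) - 1])"

definition remove_box :: "nat list \<Rightarrow> nat \<Rightarrow> nat list" where
  "remove_box m s = filter (\<lambda>x. 0 < x) (m[s - 1 := m ! (s - 1) - 1])"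

text \<open>The normalized symmetrizer on the strands of row \<open>s\<close> of \<open>l\<close> (the identity if there are none).\<close>

definition row_sym :: "nat list \<Rightarrow> nat \<Rightarrow> 'k::field_char_0 hmor" where
  "row_sym l s = act (sum_list l) (symmetrizer {p. p permutes {i. i < sum_list l \<and> row_of l i = s - 1}})"


section \<open>The morphisms\<close>

text \<open>An upward strand crossing \<open>n\<close> downward strands, from right to left and from left to right.\<close>

primrec cross_left :: "nat \<Rightarrow> 'k::field_char_0 hmor" where
  "cross_left 0 = idn [Up]"
| "cross_left (Suc n) = (cross_left n \<boxtimes> idn [Dn]) * (idn (Qpow n) \<boxtimes> XQP)"

primrec cross_right :: "nat \<Rightarrow> 'k::field_char_0 hmor" where
  "cross_right 0 = idn [Up]"
| "cross_right (Suc n) = (idn (Qpow n) \<boxtimes> XPQ) * (cross_right n \<boxtimes> idn [Dn])"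

text \<open>The last strand of row \<open>s\<close>, its move to the far right past all other downward strands, and the
  inverse move.\<close>

definition row_end :: "nat list \<Rightarrow> nat \<Rightarrow> nat" where
  "row_end m s = sum_list (take s m) - 1"

definition move_out :: "nat list \<Rightarrow> nat \<Rightarrow> 'k::field_char_0 hmor" where
  "move_out m s = word_dgm (sum_list m) (rev [row_end m s..<sum_list m - 1])"

definition move_in :: "nat list \<Rightarrow> nat \<Rightarrow> 'k::field_char_0 hmor" where
  "move_in m s = word_dgm (sum_list m) [row_end m s..<sum_list m - 1]"

definition rho :: "nat list \<Rightarrow> nat \<Rightarrow> 'k::field_char_0 hmor mat" where
  "rho m s = emb (
     if s = 0 then cross_left (sum_list m) * (e_mor m \<boxtimes> idn [Up])
     else e_mor (remove_box m s) * (idn (Qpow (sum_list m - 1)) \<boxtimes> capQP) *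
            ((move_out m s * row_sym m s * e_mor m) \<boxtimes> idn [Up]))"

definition iota :: "nat list \<Rightarrow> nat \<Rightarrow> 'k::field_char_0 hmor mat" where
  "iota m s = emb (
     if s = 0 then cross_right (sum_list m) * (idn [Up] \<boxtimes> e_mor m)
     else ((e_mor m * move_in m s) \<boxtimes> idn [Up]) * (idn (Qpow (sum_list m - 1)) \<boxtimes> cupQP) *
            row_sym (remove_box m s) s * e_mor (remove_box m s))"

text \<open>The target of \<open>rho m s\<close>, which is the source of \<open>iota m s\<close>.\<close>

definition summand :: "nat list \<Rightarrow> nat \<Rightarrow> 'k::field_char_0 hobj" where
  "summand m s = (if s = 0 then H_tens P_obj (Q_obj m) else Q_obj (remove_box m s))"

text \<open>With all idempotents normalized, the composite \<open>rho m s * iota m s\<close> for \<open>s \<ge> 1\<close> is not the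
  identity but its multiple by the quotient of the coefficients of the identity permutation in the
  Young idempotents of \<open>m\<close> and of \<open>remove_box m s\<close> (equivalently, by the hook product of
  \<open>remove_box m s\<close> divided by that of \<open>m\<close>).  For example, for \<open>m = [2]\<close> and \<open>s = 1\<close> the half
  of the symmetrizer coming from the identity contributes a counterclockwise circle, and the other
  half a curl, which vanishes, so the composite is \<open>1/2\<close>.  The factor \<open>norm_factor m s\<close> by which
  \<open>iota m s\<close> has to be multiplied is the inverse of that quotient.\<close>

definition norm_factor :: "nat list \<Rightarrow> nat \<Rightarrow> 'k::field_char_0" where
  "norm_factor m s = (if s = 0 then 1 else young (remove_box m s) id / young m id)"

end

theory Submission
  imports Defs "HOL-Library.Poly_Mapping"
begin

text \<open>Closing the rightmost of \<open>N + 1\<close> downward strands by a cup and a cap with \<open>Up\<close> is the projection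
  of \<open>k[S\<^sub>N\<^sub>+\<^sub>1]\<close> onto \<open>k[S\<^sub>N]\<close> which kills the permutations moving the last point, and the identity of
  \<open>Q\<^sup>n P\<close> is the product of the two crossings plus a sum over the cosets of \<open>S\<^sub>N\<close>. Composing with
  the idempotent \<open>e\<close> of \<open>\<mu>\<close>, the proposition becomes a branching rule in the group algebra: \<open>e x\<close> is a
  sum over the corners \<open>p\<close> of \<open>nf p g\<^sub>p E(g'\<^sub>p x)\<close>, where \<open>E\<close> is the projection and \<open>g\<^sub>p\<close>, \<open>g'\<^sub>p\<close> connect
  \<open>e\<close> with the idempotent of \<open>\<mu> - p\<close>.

  Let \<open>T x\<close> be the difference of the two sides. By the exchange relation the elements
  \<open>e m\<^sub>p a\<close> with \<open>a \<in> S\<^sub>N\<close> and \<open>p\<close> a corner span the right ideal of \<open>e\<close>, and the Jucys-Murphy element is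
  triangular on them with the contents of the corners as diagonal entries. The contents are
  distinct and \<open>T\<close> commutes with the Jucys-Murphy element, so \<open>T (e m\<^sub>p)\<close> is an eigenvector orthogonal,
  with respect to the trace form, to all the dual generators except those of \<open>p\<close>; it is orthogonal to
  these too because \<open>T g\<^sub>p = 0\<close>. The trace form is non-degenerate, hence \<open>T = 0\<close>.\<close>

section \<open>Finitary permutations and their group algebra\<close>

text \<open>The field is arbitrary of characteristic zero, so neither an order nor complex
  characters are at hand. The trace form replaces them: its cyclicity and non-degeneracy stand in
  for semisimplicity, and positivity is used only for rational coefficients, to see that a Young
  symmetrizer does not square to zero. The constant \<open>nf p\<close> is forced. With
  \<open>f p\<close> the idempotent of \<mu> - p, primitivity makes the projection of
  \<open>g' p * g p\<close> a multiple of \<open>f p\<close>, and traces identify the multiple as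
  \<open>inverse (nf p)\<close>. The elements \<open>g p\<close> and \<open>g' p\<close> are exact
  eigenvectors of the Jucys-Murphy element, although the generators are so only up to error terms:
  these come from corners on one side of p, and multiplication by \<open>f p\<close> kills them.
  Arguments about right ideals are also needed on the left. The inversion \<open>star\<close> turns
  rows times columns into columns times rows, the same product for the transposed tableau with the
  two characters exchanged; hence the Boolean in the signs. The braid relation is given for upward
  strands; the one for downward strands comes from rotating one strand at a time.\<close>

text \<open>Composition is written additively so that the convolution product of \<open>fperm \<Rightarrow>\<^sub>0 'k\<close> is the
  product of the group algebra. All symmetric groups live inside one type.\<close>

typedef fperm = "{p :: nat \<Rightarrow> nat. permutation p}" morphisms ap Fp
  by (rule exI[of _ id]) simp

lemma permutation_ap [simp]: "permutation (ap g)"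
  using ap by blast

lemma ap_Fp: "permutation p \<Longrightarrow> ap (Fp p) = p"
  by (simp add: Fp_inverse)

lemma fperm_eqI: "(\<And>x. ap g x = ap h x) \<Longrightarrow> g = h"
  by (metis ap_inject ext)

instantiation fperm :: group_add
begin

definition "0 = Fp id"
definition "g + h = Fp (ap g \<circ> ap h)"
definition "- g = Fp (inv_into UNIV (ap g))"
definition "g - h = g + - (h :: fperm)"

lemma ap_plus_fun: "ap (g + h) = ap g \<circ> ap h"
  by (simp add: plus_fperm_def ap_Fp permutation_compose)

lemma ap_uminus_fun: "ap (- g) = inv_into UNIV (ap g)"
  by (simp add: uminus_fperm_def ap_Fp permutation_inverse)

lemma ap_zero_fun: "ap 0 = id"
  by (simp add: zero_fperm_def ap_Fp)

instance
proof
  fix a b c :: fperm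
  show "a + b + c = a + (b + c)" by (rule fperm_eqI) (simp add: ap_plus_fun)
  show "0 + a = a" by (rule fperm_eqI) (simp add: ap_plus_fun ap_zero_fun)
  show "a + 0 = a" by (rule fperm_eqI) (simp add: ap_plus_fun ap_zero_fun)
  have "inv_into UNIV (ap a) (ap a x) = x" for x
    using permutation_bijective[OF permutation_ap[of a]] by (simp add: bij_is_inj)
  then show "- a + a = 0" by (intro fperm_eqI) (simp add: ap_plus_fun ap_zero_fun ap_uminus_fun)
  show "a + - b = a - b" by (simp add: minus_fperm_def)
qed

end

lemma ap_plus [simp]: "ap (g + h) x = ap g (ap h x)"
  by (simp add: ap_plus_fun)

lemma ap_zero [simp]: "ap 0 x = x"
  by (simp add: ap_zero_fun)

lemma ap_minus_ap [simp]: "ap (- g) (ap g x) = x" "ap g (ap (- g) x) = x"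
  by (metis ap_plus ap_zero left_minus, metis ap_plus ap_zero right_minus)

lemma ap_eq_iff [simp]: "ap g x = ap g y \<longleftrightarrow> x = y"
  by (metis ap_minus_ap(1))

definition tra :: "nat \<Rightarrow> nat \<Rightarrow> fperm" where
  "tra a b = Fp (Transposition.transpose a b)"

lemma ap_tra_fun: "ap (tra a b) = Transposition.transpose a b"
  by (simp add: tra_def ap_Fp permutation_swap_id)

lemma ap_tra [simp]: "ap (tra a b) x = (if x = a then b else if x = b then a else x)"
  by (simp add: ap_tra_fun Transposition.transpose_def)

lemma tra_commute: "tra a b = tra b a"
  by (rule fperm_eqI) auto

lemma uminus_tra [simp]: "- tra a b = tra a b"
proof -
  have "tra a b + tra a b = 0" by (rule fperm_eqI) auto
  then show ?thesis using minus_unique by blast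
qed

lemma tra_conj: "g + tra a b = tra (ap g a) (ap g b) + g"
  by (rule fperm_eqI) auto

definition symg :: "nat \<Rightarrow> fperm set" where
  "symg n = {g. \<forall>x\<ge>n. ap g x = x}"

lemma symgD: "g \<in> symg n \<Longrightarrow> n \<le> x \<Longrightarrow> ap g x = x"
  by (simp add: symg_def)

lemma symg_zero [simp]: "0 \<in> symg n"
  by (simp add: symg_def)

lemma symg_plus [intro]: "g \<in> symg n \<Longrightarrow> h \<in> symg n \<Longrightarrow> g + h \<in> symg n"
  by (simp add: symg_def)

lemma symg_uminus [intro]: "g \<in> symg n \<Longrightarrow> - g \<in> symg n"
  by (simp add: symg_def) (metis ap_minus_ap(1))

lemma symg_uminus_iff [simp]: "- g \<in> symg n \<longleftrightarrow> g \<in> symg n"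
  using symg_uminus by (metis minus_minus)

lemma symg_lt: "g \<in> symg n \<Longrightarrow> ap g x < n \<longleftrightarrow> x < n"
  by (metis ap_eq_iff not_le symgD)

lemma symg_tra [intro]: "a < n \<Longrightarrow> b < n \<Longrightarrow> tra a b \<in> symg n"
  by (auto simp: symg_def)

lemma symg_mono: "m \<le> n \<Longrightarrow> g \<in> symg m \<Longrightarrow> g \<in> symg n"
  by (simp add: symg_def)

lemma symg_permutes:
  assumes "g \<in> symg n"
  shows "ap g permutes {..<n}"
  unfolding permutes_def
proof (intro conjI allI impI)
  fix y show "\<exists>!x. ap g x = y" by (metis ap_eq_iff ap_minus_ap(2))
qed (use assms in \<open>simp add: symg_def\<close>)

lemma permutes_symg: "p permutes {..<n} \<Longrightarrow> Fp p \<in> symg n \<and> ap (Fp p) = p"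
proof -
  assume p: "p permutes {..<n}"
  then have "permutation p" using permutes_imp_permutation by blast
  with p show ?thesis by (simp add: symg_def ap_Fp permutes_def)
qed

lemma bij_betw_ap_symg: "bij_betw ap (symg n) {p. p permutes {..<n}}"
proof (intro bij_betw_imageI inj_onI)
  show "ap ` symg n = {p. p permutes {..<n}}"
    using symg_permutes permutes_symg by (auto simp: image_iff) metis
qed (simp add: ap_inject)

lemma finite_symg [simp]: "finite (symg n)"
  using bij_betw_finite[OF bij_betw_ap_symg] finite_permutations[of "{..<n}"] by simp

lemma symg_plus_left_iff: "g \<in> symg n \<Longrightarrow> g + h \<in> symg n \<longleftrightarrow> h \<in> symg n"
  by (metis add.assoc add.left_neutral left_minus symg_plus symg_uminus)

lemma symg_plus_right_iff: "h \<in> symg n \<Longrightarrow> g + h \<in> symg n \<longleftrightarrow> g \<in> symg n"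
  by (metis add.assoc add.right_neutral right_minus symg_plus symg_uminus)

lemma symg_pred: "g \<in> symg (Suc N) \<Longrightarrow> g \<in> symg N \<longleftrightarrow> ap g N = N"
  by (auto simp: symg_def) (metis Suc_leI order_le_less)

lemma ap_image_lt: "g \<in> symg n \<Longrightarrow> bij_betw (ap g) {..<n} {..<n}"
  using symg_permutes permutes_imp_bij by blast

text \<open>The Boolean switches between the trivial character and the sign, so that symmetrizers
  and antisymmetrizers share all lemmas and \<open>\<not> e\<close> yields the transposed
  statement.\<close>

definition chi :: "bool \<Rightarrow> fperm \<Rightarrow> 'k::field_char_0" where
  "chi e g = (if e then of_int (sign (ap g)) else 1)"

lemma chi_plus: "chi e (g + h) = chi e g * chi e h"
  by (simp add: chi_def ap_plus_fun sign_compose)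

lemma chi_zero [simp]: "chi e 0 = 1"
  by (simp add: chi_def ap_zero_fun)

lemma chi_uminus [simp]: "chi e (- g) = chi e g"
  by (simp add: chi_def ap_uminus_fun sign_inverse)

lemma chi_sq [simp]: "chi e g * chi e g = 1"
  by (simp add: chi_def flip: of_int_mult)

lemma chi_nz [simp]: "chi e g \<noteq> 0"
  by (simp add: chi_def)

lemma chi_tra: "a \<noteq> b \<Longrightarrow> chi e (tra a b) = (if e then - 1 else 1)"
  by (simp add: chi_def ap_tra_fun sign_swap_id)

section \<open>The group algebra of the finitary permutations\<close>

type_synonym 'k ga = "fperm \<Rightarrow>\<^sub>0 'k"

abbreviation coef :: "'k::zero ga \<Rightarrow> fperm \<Rightarrow> 'k" where
  "coef \<equiv> Poly_Mapping.lookup"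

definition gb :: "fperm \<Rightarrow> 'k::field_char_0 ga" where
  "gb g = Poly_Mapping.single g 1"

text \<open>Scalars act through multiples of the unit. These are central although the group is not
  commutative, which is \<open>sm_mult_right\<close>.\<close>

definition sm :: "'k::field_char_0 \<Rightarrow> 'k ga \<Rightarrow> 'k ga" where
  "sm c x = Poly_Mapping.single 0 c * x"

lemma gb_plus: "gb (g + h) = gb g * gb h"
  by (simp add: gb_def mult_single)

lemma gb_zero [simp]: "gb 0 = 1"
  by (simp add: gb_def)

lemma gb_uminus_cancel [simp]: "gb (- g) * gb g = 1" "gb g * gb (- g) = 1"
  by (simp_all flip: gb_plus)

lemma gb_uminus_cancel' [simp]: "gb (- g) * (gb g * x) = x" "gb g * (gb (- g) * x) = x"
  by (simp_all flip: mult.assoc)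

lemma sm_simps [simp]: "sm 0 x = 0" "sm 1 x = x" "sm c 0 = 0"
  by (simp_all add: sm_def)

lemma sm_add_left: "sm (c + d) x = sm c x + sm d x"
  by (simp add: sm_def single_add distrib_right)

lemma sm_add: "sm c (x + y) = sm c x + sm c y"
  by (simp add: sm_def distrib_left)

lemma sm_uminus_left: "sm (- c) x = - sm c x"
  by (simp add: sm_def single_uminus)

lemma sm_diff: "sm c (x - y) = sm c x - sm c y"
  by (simp add: sm_def right_diff_distrib)

lemma sm_sum: "sm c (\<Sum>i\<in>I. f i) = (\<Sum>i\<in>I. sm c (f i))"
  by (simp add: sm_def sum_distrib_left)

lemma sm_sum_left: "sm (\<Sum>i\<in>I. c i) x = (\<Sum>i\<in>I. sm (c i) x)"
  by (induction I rule: infinite_finite_induct) (simp_all add: sm_add_left)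

lemma sm_sm [simp]: "sm c (sm d x) = sm (c * d) x"
  by (simp add: sm_def mult_single flip: mult.assoc)

lemma sm_mult_left [simp]: "sm c x * y = sm c (x * y)"
  by (simp add: sm_def mult.assoc)

lemma sm_gb: "sm c (gb g) = Poly_Mapping.single g c"
  by (simp add: sm_def gb_def mult_single)

lemma coef_gb: "coef (gb g) h = (if g = h then 1 else 0)"
  by (simp add: gb_def lookup_single when_def)

lemma coef_sm_gb: "coef (sm c (gb g)) h = (if g = h then c else 0)"
  by (simp add: sm_gb lookup_single when_def)

lemma ga_expand: "x = (\<Sum>g\<in>Poly_Mapping.keys x. sm (coef x g) (gb g))"
  by (rule poly_mapping_eqI)
    (auto simp: lookup_sum coef_sm_gb if_distrib in_keys_iff cong: if_cong)

lemma ga_induct [case_names zero add]: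
  assumes "P 0" "\<And>x c g. P x \<Longrightarrow> P (sm c (gb g) + x)"
  shows "P x"
proof -
  have "P (\<Sum>g\<in>G. sm (c g) (gb g))" if "finite G" for G and c
    using that by induction (use assms in auto)
  from this[of "Poly_Mapping.keys x" "coef x"] show ?thesis
    using ga_expand[of x] by simp
qed

lemma sm_mult_right [simp]: "x * sm c y = sm c (x * y)"
proof (induction x rule: ga_induct)
  case (add x d g)
  have "gb g * sm c y = sm c (gb g * y)"
    by (simp add: sm_def gb_def mult_single flip: mult.assoc)
  with add show ?case by (simp add: algebra_simps sm_add)
qed simp

lemma coef_sm [simp]: "coef (sm c x) g = c * coef x g"
  by (induction x rule: ga_induct)
    (simp_all add: sm_add lookup_add coef_sm_gb algebra_simps if_distrib)

lemma coef_gb_left: "coef (gb g * x) h = coef x (- g + h)"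
proof (induction x rule: ga_induct)
  case (add x c k)
  have "g + k = h \<longleftrightarrow> k = - g + h"
    by (metis add.assoc add.left_neutral left_minus right_minus)
  then show ?case using add by (simp add: distrib_left lookup_add coef_gb flip: gb_plus)
qed simp

lemma coef_gb_right: "coef (x * gb g) h = coef x (h - g)"
proof (induction x rule: ga_induct)
  case (add x c k)
  have "k + g = h \<longleftrightarrow> k = h - g"
    by (metis add_diff_cancel diff_add_cancel)
  then show ?case using add by (simp add: distrib_right lookup_add coef_gb flip: gb_plus)
qed simp

lemma sm_cancel: "sm c x = 0 \<Longrightarrow> c \<noteq> 0 \<Longrightarrow> x = 0"
  by (metis sm_sm sm_simps(2,3) left_inverse)

lemma ga_neg_self: "(x :: 'k::field_char_0 ga) = - x \<Longrightarrow> x = 0"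
proof (rule poly_mapping_eqI)
  fix g assume "x = - x"
  then have "coef x g = - coef x g" by (metis lookup_uminus)
  then show "coef x g = coef 0 g" by (simp add: eq_neg_iff_add_eq_0 flip: mult_2)
qed

text \<open>\<open>k[S_n]\<close> as a subset of one algebra, so that \<open>k[S_N]\<close> is
  literally contained in it and products across levels need no embedding.\<close>

definition GA :: "nat \<Rightarrow> 'k::field_char_0 ga set" where
  "GA n = {x. \<forall>g. g \<notin> symg n \<longrightarrow> coef x g = 0}"

lemma GA_expand: "x \<in> GA n \<Longrightarrow> x = (\<Sum>g\<in>symg n. sm (coef x g) (gb g))"
  by (rule poly_mapping_eqI)
    (auto simp: lookup_sum GA_def coef_gb if_distrib cong: if_cong)

lemma GA_gb [intro]: "g \<in> symg n \<Longrightarrow> gb g \<in> GA n"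
  by (auto simp: GA_def coef_gb)

lemma GA_zero [intro]: "0 \<in> GA n"
  by (simp add: GA_def)

lemma GA_one [intro]: "1 \<in> GA n"
  using GA_gb[OF symg_zero] by simp

lemma GA_plus [intro]: "x \<in> GA n \<Longrightarrow> y \<in> GA n \<Longrightarrow> x + y \<in> GA n"
  by (simp add: GA_def lookup_add)

lemma GA_minus [intro]: "x \<in> GA n \<Longrightarrow> y \<in> GA n \<Longrightarrow> x - y \<in> GA n"
  by (simp add: GA_def lookup_minus)

lemma GA_sum [intro]: "(\<And>i. i \<in> I \<Longrightarrow> f i \<in> GA n) \<Longrightarrow> (\<Sum>i\<in>I. f i) \<in> GA n"
  by (induction I rule: infinite_finite_induct) auto

lemma GA_sm [intro]: "x \<in> GA n \<Longrightarrow> sm c x \<in> GA n"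
  by (simp add: GA_def)

lemma GA_mult [intro]:
  assumes "x \<in> GA n" "y \<in> GA n"
  shows "x * y \<in> GA n"
proof -
  have "gb g * y \<in> GA n" if "g \<in> symg n" for g
    using that assms(2) by (simp add: GA_def coef_gb_left symg_plus_left_iff)
  then show ?thesis
    by (subst GA_expand[OF assms(1)]) (auto simp: sum_distrib_right mult.assoc)
qed

lemma GA_mono: "m \<le> n \<Longrightarrow> x \<in> GA m \<Longrightarrow> x \<in> GA n"
  using symg_mono by (fastforce simp: GA_def)

section \<open>The inversion anti-automorphism and the trace form\<close>

definition star :: "'k::field_char_0 ga \<Rightarrow> 'k ga" where
  "star x = Poly_Mapping.map_key uminus x"

lemma coef_star [simp]: "coef (star x) g = coef x (- g)"
  by (simp add: star_def map_key.rep_eq)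

lemma star_add: "star (x + y) = star x + star y"
  by (rule poly_mapping_eqI) (simp add: lookup_add)

lemma star_uminus: "star (- x) = - star x"
  by (rule poly_mapping_eqI) simp

lemma star_zero [simp]: "star 0 = 0"
  by (rule poly_mapping_eqI) simp

lemma star_sum: "star (\<Sum>i\<in>I. f i) = (\<Sum>i\<in>I. star (f i))"
  by (induction I rule: infinite_finite_induct) (simp_all add: star_add)

lemma star_star [simp]: "star (star x) = x"
  by (rule poly_mapping_eqI) simp

lemma star_gb [simp]: "star (gb g) = gb (- g)"
  by (rule poly_mapping_eqI) (auto simp: coef_gb)

lemma star_sm: "star (sm c x) = sm c (star x)"
  by (rule poly_mapping_eqI) simp

lemma star_mult: "star (x * y) = star y * star x"
proof (induction x rule: ga_induct)
  case (add x c g)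
  have "star (gb g * y) = star y * gb (- g)"
    by (rule poly_mapping_eqI) (simp add: coef_gb_left coef_gb_right diff_conv_add_uminus minus_add
        del: add_uminus_conv_diff)
  with add show ?case
    by (simp add: distrib_right distrib_left star_add star_sm mult.assoc)
qed simp

lemma star_GA [intro]: "x \<in> GA n \<Longrightarrow> star x \<in> GA n"
  by (simp add: GA_def)

definition tau :: "'k::field_char_0 ga \<Rightarrow> 'k" where
  "tau x = coef x 0"

lemma tau_simps [simp]: "tau 0 = 0" "tau (x + y) = tau x + tau y" "tau (- x) = - tau x"
  "tau (x - y) = tau x - tau y" "tau (sm c x) = c * tau x"
  by (simp_all add: tau_def lookup_add lookup_minus)

lemma tau_sum: "tau (\<Sum>i\<in>I. f i) = (\<Sum>i\<in>I. tau (f i))"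
  by (induction I rule: infinite_finite_induct) simp_all

lemma tau_commute: "tau (x * y) = tau (y * x)"
proof (induction x rule: ga_induct)
  case (add x c g)
  have "tau (gb g * y) = tau (y * gb g)"
    by (simp add: tau_def coef_gb_left coef_gb_right)
  with add show ?case
    by (simp add: distrib_right distrib_left mult.assoc)
qed simp

text \<open>The numbers \<open>tau (x * gb (- g))\<close> are the coefficients of
  \<open>x\<close>.\<close>

lemma tau_nondegenerate:
  assumes "x \<in> GA n" "\<And>g. g \<in> symg n \<Longrightarrow> tau (x * gb (- g)) = 0"
  shows "x = 0"
proof (rule poly_mapping_eqI)
  fix g show "coef x g = coef 0 g"
    using assms by (cases "g \<in> symg n") (auto simp: tau_def coef_gb_right GA_def)
qed

lemma tau_sum_coef: "x \<in> GA n \<Longrightarrow> tau (x * y) = (\<Sum>g\<in>symg n. coef x g * coef y (- g))"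
  by (subst GA_expand, assumption)
    (simp add: sum_distrib_right tau_sum mult.assoc, simp add: tau_def coef_gb_left)

section \<open>Young symmetrizers\<close>

definition is_grp :: "fperm set \<Rightarrow> bool" where
  "is_grp G \<longleftrightarrow> finite G \<and> 0 \<in> G \<and> (\<forall>g\<in>G. \<forall>h\<in>G. g + h \<in> G) \<and> (\<forall>g\<in>G. - g \<in> G)"

lemma is_grp_uminus: "is_grp G \<Longrightarrow> - g \<in> G \<longleftrightarrow> g \<in> G"
  unfolding is_grp_def by (metis minus_minus)

lemma is_grpD:
  assumes "is_grp G"
  shows "finite G" "0 \<in> G" "g \<in> G \<Longrightarrow> h \<in> G \<Longrightarrow> g + h \<in> G" "- g \<in> G \<longleftrightarrow> g \<in> G" "G \<noteq> {}"
  using assms is_grp_uminus[OF assms] by (auto simp: is_grp_def)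

lemma is_grp_plus_iff:
  assumes "is_grp G" "h \<in> G"
  shows "g + h \<in> G \<longleftrightarrow> g \<in> G" "h + g \<in> G \<longleftrightarrow> g \<in> G" "g - h \<in> G \<longleftrightarrow> g \<in> G"
proof -
  have 1: "g + h \<in> G \<longleftrightarrow> g \<in> G" if "h \<in> G" for h g
    using is_grpD[OF assms(1)] that
    by (metis add.assoc add.right_neutral right_minus)
  show "g + h \<in> G \<longleftrightarrow> g \<in> G" using 1 assms(2) by blast
  show "h + g \<in> G \<longleftrightarrow> g \<in> G"
    using is_grpD[OF assms(1)] assms(2) by (metis add.assoc add.left_neutral left_minus)
  show "g - h \<in> G \<longleftrightarrow> g \<in> G"
    using 1[of "- h" g] is_grpD(4)[OF assms(1)] assms(2) by simp
qed

text \<open>For a group \<open>G\<close> this is the idempotent of the linear character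
  \<open>chi e\<close>.\<close>

definition Sy :: "bool \<Rightarrow> fperm set \<Rightarrow> 'k::field_char_0 ga" where
  "Sy e G = (\<Sum>g\<in>G. sm (chi e g / of_nat (card G)) (gb g))"

lemma coef_Sy: "finite G \<Longrightarrow> coef (Sy e G) g = (if g \<in> G then chi e g / of_nat (card G) else 0)"
  by (simp add: Sy_def lookup_sum coef_gb if_distrib cong: if_cong)

lemma Sy_right:
  assumes "is_grp G" "h \<in> G"
  shows "Sy e G * gb h = sm (chi e h) (Sy e G)"
proof (rule poly_mapping_eqI)
  fix g
  have "chi e (g - h) = (chi e h * chi e g :: 'a)"
    using chi_plus[of e g "- h", where 'a = 'a] by (simp add: mult.commute)
  then show "coef (Sy e G * gb h) g = coef (sm (chi e h :: 'a) (Sy e G)) g"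
    using is_grp_plus_iff[OF assms] is_grpD[OF assms(1)] by (simp add: coef_gb_right coef_Sy)
qed

lemma star_Sy [simp]: "is_grp G \<Longrightarrow> star (Sy e G) = Sy e G"
  by (rule poly_mapping_eqI) (simp add: coef_Sy is_grpD)

lemma Sy_left:
  assumes "is_grp G" "h \<in> G"
  shows "gb h * Sy e G = sm (chi e h) (Sy e G)"
proof -
  have "star (gb h * Sy e G) = star (sm (chi e h) (Sy e G :: 'a ga))"
    using Sy_right[OF assms(1), of "- h" e, where 'a = 'a] is_grpD(4)[OF assms(1), of h] assms
    by (simp add: star_mult[of "gb h"] star_sm)
  then show ?thesis by (metis star_star)
qed

lemma mult_Sy_absorb:
  assumes "finite H" "H \<noteq> {}" "\<And>h. h \<in> H \<Longrightarrow> x * gb h = sm (chi e h) x"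
  shows "x * Sy e H = x"
proof -
  have "x * Sy e H = (\<Sum>h\<in>H. sm (1 / of_nat (card H)) x)"
    unfolding Sy_def sum_distrib_left
  proof (rule sum.cong)
    fix h assume "h \<in> H"
    have "x * (sm (chi e h / of_nat (card H)) (gb h)) = sm (chi e h / of_nat (card H)) (x * gb h)"
      by simp
    also have "\<dots> = sm (1 / of_nat (card H)) x"
      by (simp add: assms(3)[OF \<open>h \<in> H\<close>])
    finally show "x * (sm (chi e h / of_nat (card H)) (gb h)) = sm (1 / of_nat (card H)) x" .
  qed simp
  also have "\<dots> = sm (\<Sum>h\<in>H. 1 / of_nat (card H)) x"
    by (simp only: sm_sum_left)
  also have "\<dots> = x" using assms by simp
  finally show ?thesis .
qed

lemma Sy_absorb:
  assumes "is_grp G" "is_grp H" "H \<subseteq> G"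
  shows "Sy e G * Sy e H = Sy e G" "Sy e H * Sy e G = Sy e G"
proof -
  show 1: "Sy e G * Sy e H = Sy e G"
    using assms is_grpD[OF assms(2)] by (intro mult_Sy_absorb Sy_right) auto
  show "Sy e H * Sy e G = Sy e G"
    using arg_cong[OF 1, of star] assms by (simp add: star_mult)
qed

lemma Sy_absorb':
  assumes "is_grp G" "is_grp H" "H \<subseteq> G"
  shows "Sy e G * (Sy e H * x) = Sy e G * x" "Sy e H * (Sy e G * x) = Sy e G * x"
  by (simp_all add: Sy_absorb[OF assms] flip: mult.assoc)

lemmas Sy_idem = Sy_absorb[OF _ _ order.refl] Sy_absorb'[OF _ _ order.refl]

lemma Sy_conj:
  assumes "finite G" "finite G'" "\<And>g. g \<in> G' \<longleftrightarrow> m + g - m \<in> G"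
  shows "gb (- m) * Sy e G * gb m = Sy e G'"
proof -
  have "G = (\<lambda>g. m + g - m) ` G'"
  proof (intro Set.set_eqI iffI)
    fix g assume "g \<in> G"
    then have "- m + g + m \<in> G'"
      unfolding assms(3) by (simp flip: add.assoc)
    moreover have "g = m + (- m + g + m) - m"
      by (simp flip: add.assoc)
    ultimately show "g \<in> (\<lambda>g. m + g - m) ` G'" by blast
  qed (use assms(3) in auto)
  moreover have "inj_on (\<lambda>g. m + g - m) G'"
    by (rule inj_onI) (metis add_left_cancel diff_add_cancel)
  ultimately have c: "card G = card G'" by (metis card_image)
  show ?thesis
  proof (rule poly_mapping_eqI)
    fix g
    have "m + (g - m) = m + g - m" by (simp add: add_diff_eq)
    moreover have "chi e (m + g - m) = (chi e g :: 'a)"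
      using chi_plus[of e "m + g" "- m", where 'a = 'a] by (simp add: chi_plus)
    ultimately show "coef (gb (- m) * Sy e G * gb m) g = coef (Sy e G' :: 'a ga) g"
      using assms c by (simp add: mult.assoc coef_gb_left coef_gb_right coef_Sy)
  qed
qed

lemma Sy_GA [intro]: "G \<subseteq> symg n \<Longrightarrow> Sy e G \<in> GA n"
  unfolding Sy_def by auto

text \<open>A transposition inserted before \<open>Sy (\<not> e) H\<close> is absorbed there and,
  after conjugation by \<open>g\<close>, also by \<open>Sy e G\<close>. The two characters differ in
  sign on it, so the product is its own negative.\<close>

lemma Sy_gb_Sy_zero:
  assumes "is_grp G" "is_grp H" "a \<noteq> b" "tra (ap g a) (ap g b) \<in> G" "tra a b \<in> H"
  shows "Sy e G * gb g * Sy (\<not> e) H = (0 :: 'k::field_char_0 ga)"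
proof (rule ga_neg_self)
  let ?t = "tra a b" and ?t' = "tra (ap g a) (ap g b)"
  have "Sy e G * gb g * Sy (\<not> e) H
      = sm (chi e ?t') (Sy e G * gb ?t') * gb g * (Sy (\<not> e) H :: 'k ga)"
    using assms by (simp add: Sy_right)
  also have "\<dots> = sm (chi e ?t') (Sy e G * (gb ?t' * gb g)) * Sy (\<not> e) H"
    by (simp add: mult.assoc)
  also have "gb ?t' * gb g = (gb g * gb ?t :: 'k ga)"
    by (simp add: tra_conj flip: gb_plus)
  also have "sm (chi e ?t') (Sy e G * (gb g * gb ?t)) * Sy (\<not> e) H
      = sm (chi e ?t') (Sy e G * (gb g * (gb ?t * (Sy (\<not> e) H :: 'k ga))))"
    by (simp add: mult.assoc)
  also have "\<dots> = sm (chi e ?t' * chi (\<not> e) ?t) (Sy e G * gb g * Sy (\<not> e) H)"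
    using assms by (simp add: Sy_left mult.assoc)
  also have "chi e ?t' * chi (\<not> e) ?t = (- 1 :: 'k)"
    using assms by (simp add: chi_tra)
  finally show "Sy e G * gb g * Sy (\<not> e) H = - (Sy e G * gb g * Sy (\<not> e) H :: 'k ga)"
    by (simp add: sm_uminus_left)
qed

section \<open>Young subgroups as stabilizers of a labelling\<close>

definition Grp :: "nat \<Rightarrow> (nat \<Rightarrow> nat) \<Rightarrow> fperm set" where
  "Grp n f = {g \<in> symg n. \<forall>i<n. f (ap g i) = f i}"

lemma Grp_subset: "Grp n f \<subseteq> symg n"
  by (auto simp: Grp_def)

lemma is_grp_Grp [simp]: "is_grp (Grp n f)"
  unfolding is_grp_def
proof (intro conjI ballI)
  fix g assume g: "g \<in> Grp n f"
  have "f (ap (- g) i) = f i" if "i < n" for i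
    using g symg_lt[of "- g" n i] that by (auto simp: Grp_def dest!: spec[of _ "ap (- g) i"])
  with g show "- g \<in> Grp n f" by (simp add: Grp_def)
next
  show "finite (Grp n f)" using finite_subset[OF Grp_subset finite_symg] .
qed (auto simp: Grp_def symg_lt)

lemma tra_Grp: "a < n \<Longrightarrow> b < n \<Longrightarrow> f a = f b \<Longrightarrow> tra a b \<in> Grp n f"
  by (auto simp: Grp_def)

lemma Sy_Grp_conj:
  assumes "m \<in> symg n"
  shows "gb (- m) * Sy e (Grp n f) * gb m = Sy e (Grp n (f \<circ> ap m))"
proof (rule Sy_conj)
  fix g
  have "m + g - m \<in> symg n \<longleftrightarrow> g \<in> symg n"
    using symg_plus_left_iff[OF assms, of "g - m"] symg_plus_right_iff[of "- m" n g] assms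
    by (simp add: add_diff_eq)
  moreover have "(\<forall>i<n. f (ap (m + g - m) i) = f i) \<longleftrightarrow> (\<forall>i<n. f (ap m (ap g i)) = f (ap m i))"
  proof (intro iffI allI impI)
    fix i assume "\<forall>i<n. f (ap (m + g - m) i) = f i" "i < n"
    then show "f (ap m (ap g i)) = f (ap m i)"
      using symg_lt[OF assms, of i] by (auto simp: diff_conv_add_uminus simp del: add_uminus_conv_diff)
  next
    fix i assume *: "\<forall>i<n. f (ap m (ap g i)) = f (ap m i)" "i < n"
    then show "f (ap (m + g - m) i) = f i"
      using symg_lt[of "- m" n i] assms
      by (auto simp: diff_conv_add_uminus simp del: add_uminus_conv_diff)
  qed
  ultimately show "g \<in> Grp n (f \<circ> ap m) \<longleftrightarrow> m + g - m \<in> Grp n f"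
    by (simp add: Grp_def)
qed (auto simp: is_grpD)

lemma down_closed_eq_lessThan:
  assumes "finite (Y :: nat set)" "\<And>y i. y \<in> Y \<Longrightarrow> i \<le> y \<Longrightarrow> i \<in> Y"
  shows "Y = {..<card Y}"
proof (cases "Y = {}")
  case False
  then have "Y = {..Max Y}"
    using assms Max_ge Max_in by blast
  then show ?thesis by (metis card_atMost lessThan_Suc_atMost)
qed simp

text \<open>Induction by removing the maximum, which is at least \<open>card X - 1\<close>. The
  second clause makes the initial segment the only minimizer.\<close>

lemma sum_lessThan_le:
  assumes "finite (X :: nat set)"
  shows "\<Sum>{..<card X} \<le> \<Sum>X \<and> (\<Sum>X = \<Sum>{..<card X} \<longrightarrow> X = {..<card X})"
  using assms
proof (induction "card X" arbitrary: X)
  case (Suc h)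
  define m where "m = Max X"
  have m: "m \<in> X" using Suc m_def by (metis Max_in card.empty nat.distinct(1))
  have c: "card (X - {m}) = h" using Suc m by simp
  have "X \<subseteq> {..m}" using Suc.prems m_def by auto
  from card_mono[OF _ this] have hm: "h \<le> m" using Suc by simp
  have IH: "\<Sum>{..<h} \<le> \<Sum>(X - {m})" "\<Sum>(X - {m}) = \<Sum>{..<h} \<longrightarrow> X - {m} = {..<h}"
    using Suc(1)[of "X - {m}"] Suc.prems c by auto
  have s: "\<Sum>X = m + \<Sum>(X - {m})" using m Suc.prems by (simp add: sum.remove)
  show ?case unfolding Suc(2)[symmetric]
  proof (intro conjI impI)
    show "\<Sum>{..<Suc h} \<le> \<Sum>X" using s IH(1) hm by simp
    assume "\<Sum>X = \<Sum>{..<Suc h}"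
    then have "m = h" "\<Sum>(X - {m}) = \<Sum>{..<h}" using s IH(1) hm by auto
    then show "X = {..<Suc h}" using IH(2) m by (auto simp: lessThan_Suc)
  qed
qed simp

text \<open>Any bijective numbering of the boxes of a Young diagram, not only the row-ordered one,
  since removing a corner transports tableaux along permutations. The axioms are symmetric in
  \<open>row\<close> and \<open>col\<close>, so every result has a transposed version through
  \<open>swap\<close>.\<close>

locale tableau =
  fixes n :: nat and row col :: "nat \<Rightarrow> nat"
  assumes inj: "x < n \<Longrightarrow> y < n \<Longrightarrow> row x = row y \<Longrightarrow> col x = col y \<Longrightarrow> x = y"
    and closed: "x < n \<Longrightarrow> i \<le> row x \<Longrightarrow> j \<le> col x \<Longrightarrow> \<exists>y<n. row y = i \<and> col y = j"
begin

lemma swap: "tableau n col row"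
  by unfold_locales (use inj closed in blast)+

lemma row_image_column: "row ` {y. y < n \<and> col y = c} = {..<card {y. y < n \<and> col y = c}}"
proof -
  let ?B = "{y. y < n \<and> col y = c}"
  have "inj_on row ?B" using inj by (auto intro!: inj_onI)
  moreover have "row ` ?B = {..<card (row ` ?B)}"
  proof (rule down_closed_eq_lessThan)
    fix y i assume "y \<in> row ` ?B" "i \<le> y"
    then obtain x where "x < n" "col x = c" "i \<le> row x" by auto
    then obtain z where "z < n" "row z = i" "col z = c" using closed[of x i c] by auto
    then show "i \<in> row ` ?B" by blast
  qed simp
  ultimately show ?thesis by (simp add: card_image)
qed

text \<open>Among all fillings of the columns by pairwise distinct numbers, the filling by the row
  numbers has the least total.\<close>

lemma sum_row_le:
  assumes p: "p \<in> symg n"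
    and distinct: "\<And>x y. x < n \<Longrightarrow> y < n \<Longrightarrow> r x = r y \<Longrightarrow> col (ap p x) = col (ap p y) \<Longrightarrow> x = y"
  shows "(\<Sum>x<n. row x) \<le> (\<Sum>x<n. r x)"
    and "(\<Sum>x<n. r x) = (\<Sum>x<n. row x) \<Longrightarrow> y < n \<Longrightarrow> \<exists>x<n. col (ap p x) = col y \<and> r x = row y"
proof -
  define A where "A c = {x. x < n \<and> col (ap p x) = c}" for c
  define B where "B c = {x. x < n \<and> col x = c}" for c
  have bij: "bij_betw (ap p) (A c) (B c)" for c
  proof (intro bij_betw_imageI inj_onI Set.set_eqI iffI)
    fix y assume "y \<in> B c"
    then have "ap (- p) y \<in> A c" using symg_lt[of "- p" n] p by (simp add: A_def B_def)
    then show "y \<in> ap p ` A c" by (metis ap_minus_ap(2) image_eqI)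
  qed (use p symg_lt in \<open>auto simp: A_def B_def\<close>)
  have cardAB: "card (A c) = card (B c)" for c using bij_betw_same_card[OF bij] .
  have injr: "inj_on r (A c)" for c using distinct by (auto simp: A_def intro!: inj_onI)
  have injrow: "inj_on row (B c)" for c using inj by (auto simp: B_def intro!: inj_onI)
  have fin: "finite (A c)" "finite (B c)" for c by (auto simp: A_def B_def)
  have rowB: "row ` B c = {..<card (B c)}" for c using row_image_column by (simp add: B_def)
  have sA: "sum r (A c) = \<Sum>(r ` A c)" for c using injr by (simp add: sum.reindex)
  have sB: "sum row (B c) = \<Sum>{..<card (B c)}" for c
    using sum.reindex[OF injrow, of id c] rowB by simp
  have cA: "card (r ` A c) = card (B c)" for c using injr cardAB by (simp add: card_image)
  have le: "sum row (B c) \<le> sum r (A c)" for c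
    using sum_lessThan_le[of "r ` A c"] fin by (simp add: sA sB cA)
  let ?I = "col ` {..<n}"
  have im: "(\<lambda>x. col (ap p x)) ` {..<n} = ?I"
    using bij_betw_imp_surj_on[OF ap_image_lt[OF p]] by (metis image_image)
  have tA: "(\<Sum>x<n. r x) = (\<Sum>c\<in>?I. sum r (A c))"
    using sum.image_gen[of "{..<n}" r "\<lambda>x. col (ap p x)"] by (simp add: im A_def)
  have tB: "(\<Sum>x<n. row x) = (\<Sum>c\<in>?I. sum row (B c))"
    using sum.image_gen[of "{..<n}" row col] by (simp add: B_def)
  show "(\<Sum>x<n. row x) \<le> (\<Sum>x<n. r x)"
    unfolding tA tB by (intro sum_mono le)
  assume eq: "(\<Sum>x<n. r x) = (\<Sum>x<n. row x)" and y: "y < n"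
  \<comment> \<open>Columnwise inequalities adding up to an equality are equalities; the equality
    clause of \<open>sum_lessThan_le\<close> then shows that the labels of each column are exactly
    its row numbers.\<close>
  have "sum row (B c) = sum r (A c)" if "c \<in> ?I" for c
  proof (rule ccontr)
    assume "sum row (B c) \<noteq> sum r (A c)"
    with le[of c] have "sum row (B c) < sum r (A c)" by simp
    then have "(\<Sum>c\<in>?I. sum row (B c)) < (\<Sum>c\<in>?I. sum r (A c))"
      using that le by (intro sum_strict_mono_ex1) auto
    with eq tA tB show False by simp
  qed
  from this[of "col y"] y have "r ` A (col y) = {..<card (B (col y))}"
    using sum_lessThan_le[of "r ` A (col y)"] fin by (simp add: sA sB cA)
  moreover have "row y \<in> row ` B (col y)" using y by (simp add: B_def)
  ultimately have "row y \<in> r ` A (col y)" using rowB by simp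
  then show "\<exists>x<n. col (ap p x) = col y \<and> r x = row y" by (auto simp: A_def)
qed

text \<open>The total of the row numbers plays the part of the dominance order. If the labels
  \<open>r\<close> have a smaller total, every permutation sends two points with the same label into
  one column, and \<open>Sy_gb_Sy_zero\<close> kills its term.\<close>

lemma Sy_mult_Sy_zero:
  assumes "x \<in> GA n" "(\<Sum>x<n. r x) < (\<Sum>x<n. row x)"
  shows "Sy e (Grp n col) * x * Sy (\<not> e) (Grp n r) = (0 :: 'k::field_char_0 ga)"
proof -
  have "Sy e (Grp n col) * gb p * Sy (\<not> e) (Grp n r) = (0 :: 'k ga)" if p: "p \<in> symg n" for p
  proof -
    obtain a b where "a < n" "b < n" "a \<noteq> b" "r a = r b" "col (ap p a) = col (ap p b)"
      using sum_row_le(1)[OF p, of r] assms(2) by fastforce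
    then show ?thesis
      using p by (intro Sy_gb_Sy_zero[of _ _ a b]) (auto intro!: tra_Grp simp: symg_lt)
  qed
  then have "(\<Sum>g\<in>symg n. sm (coef x g) (Sy e (Grp n col) * gb g * Sy (\<not> e) (Grp n r))) = 0"
    by simp
  then show ?thesis
    by (subst GA_expand[OF assms(1)])
      (simp add: sum_distrib_left sum_distrib_right mult.assoc)
qed

text \<open>Von Neumann's lemma: either two points of one row are sent into one column and the
  product vanishes, or \<open>p\<close> is a column permutation times a row permutation and both are
  absorbed.\<close>

lemma Sy_gb_Sy:
  assumes p: "p \<in> symg n"
  shows "\<exists>\<kappa>. Sy e (Grp n col) * gb p * Sy (\<not> e) (Grp n row)
    = sm \<kappa> (Sy e (Grp n col) * Sy (\<not> e) (Grp n row) :: 'k::field_char_0 ga)"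
proof (cases "\<exists>a b. a < n \<and> b < n \<and> a \<noteq> b \<and> row a = row b \<and> col (ap p a) = col (ap p b)")
  case True
  then obtain a b where "a < n" "b < n" "a \<noteq> b" "row a = row b" "col (ap p a) = col (ap p b)"
    by blast
  then have "Sy e (Grp n col) * gb p * Sy (\<not> e) (Grp n row) = (0 :: 'k ga)"
    using p by (intro Sy_gb_Sy_zero[of _ _ a b]) (auto intro!: tra_Grp simp: symg_lt)
  then show ?thesis by (intro exI[of _ 0]) simp
next
  case False
  then have ex: "\<exists>x<n. col (ap p x) = col y \<and> row x = row y" if "y < n" for y
    using sum_row_le(2)[OF p, of row] that by blast
  \<comment> \<open>The least total of \<open>sum_row_le\<close> is attained, so every box
    \<open>y\<close> has a partner in its own row that \<open>p\<close> sends into the column of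
    \<open>y\<close>. Thus \<theta> is a row permutation, \<open>p + Fp \<theta>\<close> is a column
    permutation, and \<open>p\<close> factors.\<close>
  define \<theta> where
    "\<theta> y = (if y < n then SOME x. x < n \<and> col (ap p x) = col y \<and> row x = row y else y)" for y
  have \<theta>: "\<theta> y < n \<and> col (ap p (\<theta> y)) = col y \<and> row (\<theta> y) = row y" if "y < n" for y
    using someI_ex[OF ex[OF that]] that unfolding \<theta>_def by simp
  have "inj_on \<theta> {..<n}"
  proof (rule inj_onI)
    fix x y assume "x \<in> {..<n}" "y \<in> {..<n}" "\<theta> x = \<theta> y"
    then show "x = y" using \<theta>[of x] \<theta>[of y] inj[of x y] by simp
  qed
  then have "\<theta> permutes {..<n}"
    using \<theta> by (intro bij_imp_permutes endo_inj_surj bij_betw_imageI) (auto simp: \<theta>_def)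
  then have t: "Fp \<theta> \<in> symg n" "ap (Fp \<theta>) = \<theta>" using permutes_symg by auto
  then have 1: "Fp \<theta> \<in> Grp n row" using \<theta> by (simp add: Grp_def)
  have 2: "p + Fp \<theta> \<in> Grp n col" using \<theta> t p by (auto simp: Grp_def)
  have "gb p = gb (p + Fp \<theta>) * (gb (- Fp \<theta>) :: 'k ga)"
    by (simp add: add.assoc flip: gb_plus)
  then have "Sy e (Grp n col) * gb p * Sy (\<not> e) (Grp n row)
    = (Sy e (Grp n col) * gb (p + Fp \<theta>)) * (gb (- Fp \<theta>) * (Sy (\<not> e) (Grp n row) :: 'k ga))"
    by (simp add: mult.assoc)
  also have "\<dots> = sm (chi e (p + Fp \<theta>) * chi (\<not> e) (Fp \<theta>)) (Sy e (Grp n col) * Sy (\<not> e) (Grp n row))"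
    using Sy_right[OF is_grp_Grp 2, where 'a = 'k] 1
      Sy_left[OF is_grp_Grp, of "- Fp \<theta>" n row, where 'a = 'k]
    by (simp add: is_grpD mult.commute)
  finally show ?thesis by blast
qed

lemma Sy_mult_Sy:
  assumes "x \<in> GA n"
  shows "\<exists>\<kappa>. Sy e (Grp n col) * x * Sy (\<not> e) (Grp n row)
    = sm \<kappa> (Sy e (Grp n col) * Sy (\<not> e) (Grp n row) :: 'k::field_char_0 ga)"
proof -
  have "\<forall>p. \<exists>\<kappa>. p \<in> symg n \<longrightarrow> Sy e (Grp n col) * gb p * Sy (\<not> e) (Grp n row)
    = sm \<kappa> (Sy e (Grp n col) * Sy (\<not> e) (Grp n row) :: 'k ga)"
    using Sy_gb_Sy[of _ e] by blast
  from choice[OF this] obtain \<kappa> where \<kappa>: "\<forall>p. p \<in> symg n \<longrightarrow>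
    Sy e (Grp n col) * gb p * Sy (\<not> e) (Grp n row)
      = sm (\<kappa> p) (Sy e (Grp n col) * Sy (\<not> e) (Grp n row) :: 'k ga)" ..
  have "Sy e (Grp n col) * x * Sy (\<not> e) (Grp n row)
    = (\<Sum>g\<in>symg n. sm (coef x g) (Sy e (Grp n col) * gb g * Sy (\<not> e) (Grp n row)))"
    by (subst GA_expand[OF assms(1)])
      (simp add: sum_distrib_left sum_distrib_right mult.assoc)
  also have "\<dots> = sm (\<Sum>g\<in>symg n. coef x g * \<kappa> g) (Sy e (Grp n col) * Sy (\<not> e) (Grp n row))"
    by (simp add: \<kappa> sm_sum_left)
  finally show ?thesis by blast
qed

abbreviation "rsym \<equiv> Sy False (Grp n row)"
abbreviation "casym \<equiv> Sy True (Grp n col)"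

lemma rsym_mult_casym: "x \<in> GA n \<Longrightarrow> \<exists>\<kappa>. rsym * x * casym = sm \<kappa> (rsym * casym)"
  using tableau.Sy_mult_Sy[OF swap, of x False] by simp

lemma casym_mult_rsym: "x \<in> GA n \<Longrightarrow> \<exists>\<kappa>. casym * x * rsym = sm \<kappa> (casym * rsym)"
  using Sy_mult_Sy[of x True] by simp

lemma syms_GA [intro]: "rsym \<in> GA n" "casym \<in> GA n"
  using Grp_subset by auto

lemma Grp_row_Int_col:
  assumes "g \<in> Grp n row" "g \<in> Grp n col"
  shows "g = 0"
proof (rule fperm_eqI)
  fix x show "ap g x = ap 0 x"
    using assms inj[of "ap g x" x] by (cases "x < n") (auto simp: Grp_def symg_lt symgD)
qed

text \<open>Only the identity preserves both rows and columns, so a single term contributes.\<close>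

lemma tau_rsym_casym:
  "tau (rsym * casym) = 1 / (of_nat (card (Grp n row)) * of_nat (card (Grp n col)))"
proof -
  have "tau (rsym * casym :: 'a ga) = (\<Sum>g\<in>symg n. coef rsym g * coef casym (- g))"
    by (intro tau_sum_coef syms_GA)
  also have "\<dots> = (\<Sum>g\<in>symg n. if g = 0 then coef rsym 0 * coef casym 0 else (0 :: 'a))"
    using Grp_row_Int_col by (intro sum.cong) (auto simp: coef_Sy is_grpD)
  also have "\<dots> = 1 / (of_nat (card (Grp n row)) * of_nat (card (Grp n col)))"
    by (simp add: coef_Sy is_grpD)
  finally show ?thesis .
qed

lemma tau_rsym_casym_nz: "tau (rsym * casym) \<noteq> (0 :: 'k::field_char_0)"
  by (simp add: tau_rsym_casym is_grpD)

end

section \<open>Squares of Young symmetrizers\<close>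

lemma coef_mult: "x \<in> GA n \<Longrightarrow> coef (x * y) g = (\<Sum>h\<in>symg n. coef x h * coef y (- h + g))"
  by (subst GA_expand, assumption)
    (simp add: sum_distrib_right lookup_sum mult.assoc coef_gb_left)

lemma chi_Rats: "chi e g \<in> \<rat>"
  by (simp add: chi_def)

lemma Sy_Rats: "finite G \<Longrightarrow> coef (Sy e G) g \<in> \<rat>"
  by (simp add: coef_Sy chi_Rats)

lemma mult_Rats:
  "x \<in> GA n \<Longrightarrow> (\<And>g. coef x g \<in> \<rat>) \<Longrightarrow> (\<And>g. coef y g \<in> \<rat>) \<Longrightarrow> coef (x * y) g \<in> \<rat>"
  by (subst coef_mult) auto

text \<open>The field carries no order, so positivity is applied after lifting the values to the
  rational numbers.\<close>

lemma sum_squares_Rats: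
  assumes "finite A" "\<And>a. a \<in> A \<Longrightarrow> (f a :: 'k::field_char_0) \<in> \<rat>" "(\<Sum>a\<in>A. f a * f a) = 0" "a \<in> A"
  shows "f a = 0"
proof -
  have "\<forall>a. \<exists>r. a \<in> A \<longrightarrow> f a = of_rat r"
    using assms(2) by (fastforce simp: Rats_def)
  from choice[OF this] obtain q where q: "\<forall>a. a \<in> A \<longrightarrow> f a = of_rat (q a)" ..
  have "(\<Sum>a\<in>A. f a * f a) = (\<Sum>a\<in>A. of_rat (q a * q a))"
    by (intro sum.cong) (simp_all add: q of_rat_mult)
  also have "\<dots> = of_rat (\<Sum>a\<in>A. q a * q a)"
    by (simp add: of_rat_sum)
  finally have "of_rat (\<Sum>a\<in>A. q a * q a) = (0 :: 'k)" using assms(3) by simp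
  then have "(\<Sum>a\<in>A. q a * q a) = 0" by (simp only: of_rat_eq_0_iff)
  then have "q a * q a = 0" using assms(1,4)
    by (subst (asm) sum_nonneg_eq_0_iff) auto
  then show ?thesis using q assms(4) by simp
qed

context tableau
begin

text \<open>The hook product divided by the orders of the row and the column group; the division
  comes from the normalized symmetrizers.\<close>

definition yfac :: "'k::field_char_0" where
  "yfac = (THE \<gamma>. rsym * casym * (rsym * casym) = sm \<gamma> (rsym * casym :: 'k ga))"

lemma yfac:
  "rsym * casym * (rsym * casym) = sm yfac (rsym * casym :: 'k::field_char_0 ga)"
  "casym * rsym * (casym * rsym) = sm yfac (casym * rsym :: 'k ga)"
  "yfac \<noteq> (0 :: 'k)"
proof -
  let ?R = "rsym :: 'k ga" and ?C = "casym :: 'k ga"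
  from rsym_mult_casym[OF GA_mult[OF syms_GA(2,1)]]
  obtain \<gamma> where \<gamma>: "?R * (?C * ?R) * ?C = sm \<gamma> (?R * ?C)" ..
  from casym_mult_rsym[OF GA_mult[OF syms_GA(1,2)]]
  obtain \<gamma>' where \<gamma>': "?C * (?R * ?C) * ?R = sm \<gamma>' (?C * ?R)" ..
  \<comment> \<open>Cyclicity of \<open>tau\<close> identifies the factor for \<open>?R * ?C\<close>
    with the one for \<open>?C * ?R\<close>.\<close>
  have "\<gamma> * tau (?R * ?C) = tau (?R * (?C * ?R) * ?C)" by (simp add: \<gamma>)
  also have "\<dots> = tau (?C * (?R * ?C) * ?R)"
    unfolding tau_commute[of "?R * (?C * ?R)" ?C] by (simp only: mult.assoc)
  also have "\<dots> = \<gamma>' * tau (?R * ?C)" by (simp add: \<gamma>' tau_commute)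
  finally have eq: "\<gamma>' = \<gamma>" using tau_rsym_casym_nz by auto
  have "yfac = \<gamma>"
    unfolding yfac_def
  proof (rule the_equality)
    fix c assume "?R * ?C * (?R * ?C) = sm c (?R * ?C)"
    with \<gamma> have "sm c (?R * ?C) = sm \<gamma> (?R * ?C)" by (simp add: mult.assoc)
    then have "tau (sm c (?R * ?C)) = tau (sm \<gamma> (?R * ?C))" by simp
    then show "c = \<gamma>" using tau_rsym_casym_nz by auto
  qed (use \<gamma> in \<open>simp add: mult.assoc\<close>)
  with \<gamma> \<gamma>' eq show "?R * ?C * (?R * ?C) = sm yfac (?R * ?C)"
    "?C * ?R * (?C * ?R) = sm yfac (?C * ?R)" by (simp_all add: mult.assoc)
  show "yfac \<noteq> (0 :: 'k)"
  proof
    assume "yfac = (0 :: 'k)"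
    with \<open>yfac = \<gamma>\<close> \<gamma> have z: "?R * ?C * ?R * ?C = 0" by (simp add: mult.assoc)
    define X where "X = ?R * ?C * ?R"
    have X: "X \<in> GA n" "coef X (- g) = coef X g" for g
    proof -
      show "X \<in> GA n" unfolding X_def by auto
      have "star X = X" by (simp add: X_def star_mult mult.assoc)
      then show "coef X (- g) = coef X g" by (metis coef_star)
    qed
    \<comment> \<open>The trace form is positive definite on rational elements, so the self-adjoint \<open>X\<close> cannot square to zero.\<close>
    have rat: "coef X g \<in> \<rat>" for g
      unfolding X_def
      by (intro mult_Rats[where n = n] Sy_Rats GA_mult syms_GA) (simp_all add: is_grpD)
    have "X * X = ?R * ?C * ?R * ?C * ?R" by (simp add: X_def Sy_idem mult.assoc)
    also have "\<dots> = 0" by (simp only: z mult_zero_left)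
    finally have "(\<Sum>g\<in>symg n. coef X g * coef X g) = 0"
      using tau_sum_coef[OF X(1), of X] X(2) by simp
    from sum_squares_Rats[OF _ rat this symg_zero] have "tau X = 0"
      by (simp add: tau_def)
    moreover have "tau X = tau (?R * ?C)"
      unfolding X_def tau_commute[of "?R * ?C" ?R] by (simp add: Sy_idem)
    ultimately show False using tau_rsym_casym_nz[where 'k = 'k] by simp
  qed
qed

definition yng :: "'k::field_char_0 ga" where
  "yng = sm (inverse yfac) (rsym * casym)"

lemma yng_GA [intro, simp]: "yng \<in> GA n"
  unfolding yng_def by auto

lemma yng_idem [simp]: "yng * yng = (yng :: 'k::field_char_0 ga)" "yng * (yng * x) = (yng * x :: 'k ga)"
proof -
  show 1: "yng * yng = (yng :: 'k ga)"
    by (simp add: yng_def mult.assoc[of "sm _ _"] yfac)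
  show "yng * (yng * x) = (yng * x :: 'k ga)" by (metis 1 mult.assoc)
qed

lemma rsym_yng [simp]: "rsym * yng = yng" "rsym * (yng * x) = yng * x"
  by (simp_all add: yng_def Sy_idem mult.assoc)

lemma yng_casym [simp]: "yng * casym = yng" "yng * (casym * x) = yng * x"
  by (simp_all add: yng_def Sy_idem mult.assoc)

lemma tau_yng: "tau yng = inverse yfac * tau (rsym * casym)"
  by (simp add: yng_def)

lemma tau_yng_nz: "tau yng \<noteq> (0 :: 'k::field_char_0)"
  by (simp add: tau_yng yfac tau_rsym_casym_nz)

text \<open>Primitivity of the Young idempotent: \<open>rsym_mult_casym\<close> swallows whatever
  stands between the outer symmetrizers.\<close>

lemma yng_mult_yng:
  assumes "x \<in> GA n"
  shows "\<exists>\<kappa>. yng * x * yng = sm \<kappa> yng"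
proof -
  from rsym_mult_casym[OF GA_mult[OF GA_mult[OF syms_GA(2) assms] syms_GA(1)]]
  obtain \<kappa> where "rsym * (casym * x * rsym) * casym = sm \<kappa> (rsym * casym)" ..
  then have "yng * x * yng = sm (inverse yfac * \<kappa>) yng"
    by (simp add: yng_def mult.assoc mult.left_commute mult.commute)
  then show ?thesis by blast
qed

end

section \<open>The exchange relation\<close>

definition Pg :: "nat set \<Rightarrow> fperm set" where
  "Pg X = {g. ap g permutes X}"

lemma finite_Pg: "finite X \<Longrightarrow> finite (Pg X)"
proof -
  assume X: "finite X"
  have "ap ` Pg X \<subseteq> {p. p permutes X}" by (auto simp: Pg_def)
  then have "finite (ap ` Pg X)" using finite_permutations[OF X] by (rule finite_subset)
  then show ?thesis by (rule finite_imageD) (simp add: inj_on_def ap_inject)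
qed

lemma is_grp_Pg: "finite X \<Longrightarrow> is_grp (Pg X)"
  unfolding is_grp_def
  by (auto simp: finite_Pg)
    (auto simp: Pg_def ap_plus_fun ap_zero_fun ap_uminus_fun permutes_compose permutes_inv)

text \<open>Left cosets of the stabilizer of \<open>y\<close>, indexed by the image \<open>b\<close>
  of \<open>y\<close>. The value \<open>b = y\<close> gives the trivial coset because
  \<open>tra y y\<close> is the identity.\<close>

lemma Pg_insert:
  assumes "y \<notin> K"
  shows "bij_betw (\<lambda>(b, g). tra y b + g) (insert y K \<times> Pg K) (Pg (insert y K))"
proof (intro bij_betw_imageI)
  have fixes_y: "ap g y = y" if "g \<in> Pg K" for g
    using that assms by (simp add: Pg_def permutes_not_in)
  show "inj_on (\<lambda>(b, g). tra y b + g) (insert y K \<times> Pg K)"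
  proof (rule inj_onI, clarify)
    fix b b' g g' assume *: "tra y b + g = tra y b' + g'" "g \<in> Pg K" "g' \<in> Pg K"
    then have "ap (tra y b + g) y = ap (tra y b' + g') y" by simp
    then have "b = b'" using fixes_y[OF *(2)] fixes_y[OF *(3)] by simp
    with *(1) show "b = b' \<and> g = g'" by simp
  qed
  show "(\<lambda>(b, g). tra y b + g) ` (insert y K \<times> Pg K) = Pg (insert y K)"
  proof (intro Set.set_eqI iffI)
    fix h assume "h \<in> (\<lambda>(b, g). tra y b + g) ` (insert y K \<times> Pg K)"
    then obtain b g where h: "h = tra y b + g" "b \<in> insert y K" "g \<in> Pg K" by auto
    then have "ap g permutes insert y K"
      using permutes_subset[of "ap g" K "insert y K"] by (auto simp: Pg_def)
    with h show "h \<in> Pg (insert y K)"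
      by (simp add: Pg_def ap_plus_fun ap_tra_fun permutes_compose permutes_swap_id)
  next
    fix h assume h: "h \<in> Pg (insert y K)"
    let ?b = "ap h y"
    have "tra y ?b + h \<in> Pg K"
      using permutes_insert_lemma[of "ap h" y K] h by (simp add: Pg_def ap_plus_fun ap_tra_fun)
    moreover have "?b \<in> insert y K"
      using h permutes_in_image[of "ap h" "insert y K" y] by (simp add: Pg_def)
    moreover have "h = tra y ?b + (tra y ?b + h)" by (rule fperm_eqI) auto
    ultimately show "h \<in> (\<lambda>(b, g). tra y b + g) ` (insert y K \<times> Pg K)"
      by (intro image_eqI[where x = "(?b, tra y ?b + h)"]) auto
  qed
qed

definition tsg :: "bool \<Rightarrow> 'k::field_char_0" where
  "tsg e = (if e then - 1 else 1)"

lemma tsg_sq [simp]: "tsg e * tsg e = 1" "tsg e * (tsg e * c) = c"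
  by (auto simp: tsg_def)

lemma Sy_Pg_insert:
  fixes e :: bool
  assumes "finite K" "y \<notin> K"
  shows "\<exists>c. c \<noteq> 0 \<and> Sy e (Pg (insert y K))
    = sm c (Sy e (Pg K) * (1 + (\<Sum>x\<in>K. sm (tsg e) (gb (tra x y)))) :: 'k::field_char_0 ga)"
proof -
  let ?n = "of_nat (card (Pg K)) :: 'k" and ?n' = "of_nat (card (Pg (insert y K))) :: 'k"
  note fin = finite_Pg[OF assms(1)] is_grp_Pg[OF assms(1)] is_grp_Pg[OF finite.insertI[OF assms(1)]]
  have nz: "?n \<noteq> 0" "?n' \<noteq> 0" using is_grpD[OF fin(2)] is_grpD[OF fin(3)] by auto
  have "Sy e (Pg (insert y K)) = (\<Sum>(b, g)\<in>insert y K \<times> Pg K.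
      sm (chi e (tra y b + g) / ?n') (gb (tra y b + g)) :: 'k ga)"
    unfolding Sy_def by (subst sum.reindex_bij_betw[OF Pg_insert[OF assms(2)], symmetric])
      (simp add: case_prod_unfold)
  also have "\<dots> = (\<Sum>b\<in>insert y K. sm (chi e (tra y b) * (?n / ?n')) (gb (tra y b))) * Sy e (Pg K)"
    unfolding Sy_def sum_product sum.cartesian_product
    using nz by (intro sum.cong) (auto simp: chi_plus gb_plus mult.commute)
  also have "(\<Sum>b\<in>insert y K. sm (chi e (tra y b) * (?n / ?n')) (gb (tra y b)))
      = sm (?n / ?n') (\<Sum>b\<in>insert y K. sm (chi e (tra y b)) (gb (tra y b)))"
    by (simp only: sm_sum sm_sm mult.commute)
  also have "(\<Sum>b\<in>insert y K. sm (chi e (tra y b)) (gb (tra y b)))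
      = 1 + (\<Sum>x\<in>K. sm (tsg e) (gb (tra x y)) :: 'k ga)"
  proof -
    have "tra y y = 0" by (rule fperm_eqI) simp
    moreover have "(\<Sum>b\<in>K. sm (chi e (tra y b)) (gb (tra y b)))
        = (\<Sum>x\<in>K. sm (tsg e) (gb (tra x y)) :: 'k ga)"
    proof (rule sum.cong)
      fix b assume "b \<in> K"
      then have "y \<noteq> b" using assms(2) by auto
      then show "sm (chi e (tra y b)) (gb (tra y b)) = (sm (tsg e) (gb (tra b y)) :: 'k ga)"
        by (simp add: chi_tra tsg_def tra_commute[of b])
    qed simp
    ultimately show ?thesis using assms by simp
  qed
  \<comment> \<open>The coset representatives stand on the left of \<open>Sy e (Pg K)\<close>;
    \<open>star\<close> moves them to the right.\<close>
  finally have "star (Sy e (Pg (insert y K))) = star (sm (?n / ?n')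
      (1 + (\<Sum>x\<in>K. sm (tsg e) (gb (tra x y)))) * (Sy e (Pg K) :: 'k ga))" by simp
  then have "Sy e (Pg (insert y K))
      = sm (?n / ?n') (Sy e (Pg K) * (1 + (\<Sum>x\<in>K. sm (tsg e) (gb (tra x y)))) :: 'k ga)"
    using fin star_gb[of 0, where 'a = 'k] by (simp add: star_mult star_sm star_add star_sum)
  with nz show ?thesis by (intro exI[of _ "?n / ?n'"]) simp
qed

context tableau
begin

text \<open>With \<open>e = True\<close> this is \<open>rsym * casym\<close>. The value
  \<open>e = False\<close> is meant for the transposed tableau, where the product becomes
  \<open>casym * rsym\<close>.\<close>

definition cel :: "bool \<Rightarrow> 'k::field_char_0 ga" where
  "cel e = Sy (\<not> e) (Grp n row) * Sy e (Grp n col)"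

lemma cel_right: "h \<in> Grp n col \<Longrightarrow> cel e * gb h = sm (chi e h) (cel e)"
  by (simp add: cel_def mult.assoc Sy_right)

text \<open>A Garnir relation. For every column permutation \<open>h\<close>, \<open>cover\<close>
  provides a box of column \<open>j\<close> in the row of \<open>ap h y\<close>, so
  \<open>cel e\<close> annihilates the symmetrizer \<open>Sy e\<close> of column \<open>j\<close>
  enlarged by \<open>y\<close>. Splitting off the symmetrizer of column \<open>j\<close>, which
  \<open>cel e\<close> absorbs, leaves the sum of transpositions.\<close>

lemma exchange:
  assumes y: "y < n" "col y \<noteq> j"
    and cover: "\<And>z. z < n \<Longrightarrow> col z = col y \<Longrightarrow> \<exists>x<n. col x = j \<and> row x = row z"
  shows "(\<Sum>x | x < n \<and> col x = j. cel e * gb (tra x y)) = sm (- tsg e) (cel e :: 'k::field_char_0 ga)"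
proof -
  define K where "K = {x. x < n \<and> col x = j}"
  have K: "finite K" "y \<notin> K" using y by (auto simp: K_def)
  note grp = is_grp_Pg[OF finite.insertI[OF K(1)]]
  have zero: "Sy (\<not> e) (Grp n row) * gb h * Sy e (Pg (insert y K)) = (0 :: 'k ga)"
    if h: "h \<in> Grp n col" for h
  proof -
    have hs: "h \<in> symg n" using h by (simp add: Grp_def)
    have "ap h y < n" "col (ap h y) = col y" using h y hs by (auto simp: symg_lt Grp_def)
    then obtain x' where x': "x' < n" "col x' = j" "row x' = row (ap h y)"
      using cover by blast
    define x where "x = ap (- h) x'"
    have "- h \<in> Grp n col" using h is_grpD(4)[OF is_grp_Grp] by blast
    then have xK: "x \<in> K" using x' symg_lt[of "- h" n x'] by (simp add: x_def K_def Grp_def)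
    have hx: "ap h x = x'" by (simp add: x_def)
    have "tra x y \<in> Pg (insert y K)"
      using xK by (simp add: Pg_def ap_tra_fun permutes_swap_id)
    moreover have "tra (ap h x) (ap h y) \<in> Grp n row"
      using x' y hs by (intro tra_Grp) (simp_all add: hx symg_lt)
    moreover have "x \<noteq> y" using xK K by auto
    ultimately show ?thesis
      using Sy_gb_Sy_zero[OF is_grp_Grp grp, where g = h and a = x and b = y and e = "\<not> e"] by simp
  qed
  have "cel e * Sy e (Pg (insert y K)) = (\<Sum>h\<in>Grp n col. sm (chi e h / of_nat (card (Grp n col)))
      (Sy (\<not> e) (Grp n row) * gb h * Sy e (Pg (insert y K))) :: 'k ga)"
    unfolding cel_def Sy_def[of e "Grp n col"]
    by (simp add: sum_distrib_left sum_distrib_right mult.assoc)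
  also have "\<dots> = 0" by (simp add: zero)
  finally have z: "cel e * Sy e (Pg (insert y K)) = (0 :: 'k ga)" .
  obtain c where c: "c \<noteq> 0" "Sy e (Pg (insert y K))
    = sm c (Sy e (Pg K) * (1 + (\<Sum>x\<in>K. sm (tsg e) (gb (tra x y)))) :: 'k ga)"
    using Sy_Pg_insert[OF K, of e] by blast
  have "cel e * Sy e (Pg K) = (cel e :: 'k ga)"
  proof (rule mult_Sy_absorb)
    show "finite (Pg K)" "Pg K \<noteq> {}" using is_grpD[OF is_grp_Pg[OF K(1)]] by auto
    fix h assume "h \<in> Pg K"
    then have h: "ap h permutes K" by (simp add: Pg_def)
    have "col (ap h i) = col i" for i
      using permutes_in_image[OF h, of i] permutes_not_in[OF h, of i]
      by (cases "i \<in> K") (auto simp: K_def)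
    moreover have "h \<in> symg n"
      using permutes_not_in[OF h] by (auto simp: symg_def K_def)
    ultimately show "cel e * gb h = sm (chi e h) (cel e :: 'k ga)"
      by (intro cel_right) (simp add: Grp_def)
  qed
  then have "cel e * (Sy e (Pg K) * (1 + (\<Sum>x\<in>K. sm (tsg e) (gb (tra x y)))))
      = (cel e * (1 + (\<Sum>x\<in>K. sm (tsg e) (gb (tra x y)))) :: 'k ga)"
    by (simp only: mult.assoc[symmetric])
  with z c have "cel e * (1 + (\<Sum>x\<in>K. sm (tsg e) (gb (tra x y)))) = (0 :: 'k ga)"
    by (auto intro: sm_cancel[where c = c])
  then have "cel e + sm (tsg e) (\<Sum>x\<in>K. cel e * gb (tra x y)) = (0 :: 'k ga)"
    by (simp add: distrib_left sum_distrib_left sm_sum)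
  then have "sm (tsg e) (cel e + sm (tsg e) (\<Sum>x\<in>K. cel e * gb (tra x y))) = (0 :: 'k ga)"
    by simp
  then have "sm (tsg e) (cel e) + (\<Sum>x\<in>K. cel e * gb (tra x y)) = (0 :: 'k ga)"
    by (simp add: sm_add)
  then show ?thesis by (simp add: K_def sm_uminus_left eq_neg_iff_add_eq_0 add.commute)
qed

definition corner :: "nat \<Rightarrow> bool" where
  "corner p \<longleftrightarrow> p < n \<and> (\<forall>x<n. row x = row p \<longrightarrow> col x \<le> col p) \<and> (\<forall>x<n. col x = col p \<longrightarrow> row x \<le> row p)"

lemma corner_swap: "tableau.corner n col row p \<longleftrightarrow> corner p"
  using tableau.corner_def[OF swap] corner_def by blast

text \<open>A transposition inside the column of \<open>p\<close> corrects the image of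
  \<open>N\<close> at the price of a scalar; the corrected permutation differs from \<open>m\<close>
  by a right factor fixing \<open>N\<close>.\<close>

lemma cel_coset:
  assumes "n = Suc N" "m \<in> symg n" "ap m N = p" "g \<in> symg n" "col (ap g N) = col p"
  obtains c a where "a \<in> symg N" "cel e * gb g = sm c (cel e * gb m * gb a :: 'k::field_char_0 ga)"
proof -
  let ?t = "tra (ap g N) p"
  let ?a = "- m + (?t + g)"
  have p: "p < n" "ap g N < n" using assms symg_lt[of m n N] symg_lt[of g n N] by auto
  have "ap ?a N = N" using assms(3) ap_minus_ap(1)[of m N] by simp
  moreover have "?a \<in> symg n" using assms p by auto
  ultimately have a: "?a \<in> symg N" using symg_pred assms(1) by blast
  have "cel e = (sm (chi e ?t) (cel e * gb ?t) :: 'k ga)"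
    using p by (simp add: cel_right tra_Grp assms(5))
  then have "cel e * gb g = sm (chi e ?t) (cel e * gb ?t) * (gb g :: 'k ga)"
    by (rule arg_cong[where f = "\<lambda>z. z * gb g"])
  also have "\<dots> = sm (chi e ?t) (cel e * gb m * gb ?a)"
    by (simp add: mult.assoc flip: gb_plus)
  finally show ?thesis using that a by blast
qed

end

section \<open>Right submodules and generation by the corners\<close>

definition submod :: "nat \<Rightarrow> 'k::field_char_0 ga set \<Rightarrow> bool" where
  "submod N S \<longleftrightarrow> 0 \<in> S \<and> (\<forall>x\<in>S. \<forall>y\<in>S. x + y \<in> S) \<and> (\<forall>x\<in>S. \<forall>c. sm c x \<in> S) \<and>
     (\<forall>x\<in>S. \<forall>a\<in>symg N. x * gb a \<in> S)"

lemma submodD: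
  assumes "submod N S"
  shows "0 \<in> S" "x \<in> S \<Longrightarrow> y \<in> S \<Longrightarrow> x + y \<in> S" "x \<in> S \<Longrightarrow> sm c x \<in> S"
    "x \<in> S \<Longrightarrow> a \<in> symg N \<Longrightarrow> x * gb a \<in> S"
  using assms by (auto simp: submod_def)

lemma submod_sum: "submod N S \<Longrightarrow> (\<And>i. i \<in> A \<Longrightarrow> f i \<in> S) \<Longrightarrow> (\<Sum>i\<in>A. f i) \<in> S"
  by (induction A rule: infinite_finite_induct) (auto simp: submodD)

context tableau
begin

text \<open>The box of \<open>N\<close> is moved to the bottom of its column, and from there to a longer row by the
  exchange relation, until it is a corner.\<close>

lemma corner_generation:
  assumes n: "n = Suc N" and S: "submod N S"
    and m: "\<And>p. corner p \<Longrightarrow> m p \<in> symg n \<and> ap (m p) N = p"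
    and step: "\<And>p. corner p \<Longrightarrow>
      k \<le> col p \<Longrightarrow> (\<And>g. g \<in> symg n \<Longrightarrow> col p < col (ap g N) \<Longrightarrow> cel e * gb g \<in> S) \<Longrightarrow>
      cel e * gb (m p) \<in> S"
    and g: "g \<in> symg n" "k \<le> col (ap g N)"
  shows "cel e * gb g \<in> (S :: 'k::field_char_0 ga set)"
  using g
\<comment> \<open>Induction on the distance to the last column. The bound \<open>k\<close> survives
  since only columns further right are visited.\<close>
proof (induction "Max (col ` {..<n}) - col (ap g N)" arbitrary: g rule: less_induct)
  case (less g)
  define y where "y = ap g N"
  have y: "y < n" using less.prems(1) n symg_lt by (simp add: y_def)
  have IH: "cel e * gb h \<in> S" if "h \<in> symg n" "col y < col (ap h N)" for h
  proof -
    have "col (ap h N) \<le> Max (col ` {..<n})"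
      using that(1) n symg_lt by (intro Max_ge) auto
    then show ?thesis using less.hyps[OF _ that(1)] that(2) less.prems by (simp add: y_def)
  qed
  show ?case
  \<comment> \<open>If the next column meets every row of the column of \<open>y\<close>, the
    exchange relation moves \<open>N\<close> one column to the right. Otherwise the column reaches
    below its right neighbour and its lowest box is a corner.\<close>
  proof (cases "\<forall>z<n. col z = col y \<longrightarrow> (\<exists>x<n. col x = Suc (col y) \<and> row x = row z)")
    case True
    then have ex: "(\<Sum>x | x < n \<and> col x = Suc (col y). cel e * gb (tra x y))
        = sm (- tsg e) (cel e :: 'k ga)"
      by (intro exchange y) auto
    have "(\<Sum>x | x < n \<and> col x = Suc (col y). cel e * gb (tra x y + g)) \<in> S"
    proof (intro submod_sum[OF S] IH)
      fix x assume x: "x \<in> {x. x < n \<and> col x = Suc (col y)}"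
      then show "tra x y + g \<in> symg n" by (intro symg_plus symg_tra y less.prems(1)) simp
      have "ap (tra x y + g) N = x" unfolding y_def by simp
      then show "col y < col (ap (tra x y + g) N)" using x by simp
    qed
    then have "sm (- tsg e) (\<Sum>x | x < n \<and> col x = Suc (col y). cel e * gb (tra x y + g)) \<in> S"
      by (rule submodD[OF S])
    also have "(\<Sum>x | x < n \<and> col x = Suc (col y). cel e * gb (tra x y + g))
        = sm (- tsg e) (cel e * gb g :: 'k ga)"
      using arg_cong[OF ex, of "\<lambda>z. z * gb g"] by (simp add: sum_distrib_right gb_plus mult.assoc)
    finally show ?thesis by simp
  next
    case False
    then obtain z where z: "z < n" "col z = col y" "\<not> (\<exists>x<n. col x = Suc (col y) \<and> row x = row z)"
      by blast
    let ?B = "{x. x < n \<and> col x = col y}"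
    have B: "finite (row ` ?B)" "row ` ?B \<noteq> {}" using y by auto
    from Max_in[OF B] obtain p where pB: "Max (row ` ?B) = row p" "p \<in> ?B" by (rule imageE)
    then have p: "p < n" "col p = col y" by auto
    have pmax: "row x \<le> row p" if "x < n" "col x = col y" for x
      unfolding pB(1)[symmetric] using that by (intro Max_ge B) auto
    have "corner p"
      unfolding corner_def
    proof (intro conjI allI impI)
      fix x assume x: "x < n" "row x = row p"
      show "col x \<le> col p"
      proof (rule ccontr)
        assume "\<not> col x \<le> col p"
        then show False
          using closed[OF x(1), of "row z" "Suc (col y)"] z x(2) p(2) pmax[OF z(1,2)] by auto
      qed
    qed (use p pmax in auto)
    then have mp: "m p \<in> symg n" "ap (m p) N = p" using m by auto
    have "cel e * gb (m p) \<in> S" using step[OF \<open>corner p\<close>] IH p less.prems(2) by (simp add: y_def)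
    moreover have cg: "col (ap g N) = col p" using p by (simp add: y_def)
    obtain c a where "a \<in> symg N" "cel e * gb g = sm c (cel e * gb (m p) * gb a :: 'k ga)"
      by (rule cel_coset[OF n mp less.prems(1) cg])
    ultimately show ?thesis by (simp add: submodD[OF S])
  qed
qed

end

section \<open>The Jucys-Murphy element\<close>

definition JM :: "nat \<Rightarrow> 'k::field_char_0 ga" where
  "JM N = (\<Sum>i<N. gb (tra i N))"

lemma JM_commute:
  assumes "a \<in> GA N"
  shows "a * JM N = JM N * a"
proof -
  have "gb g * JM N = JM N * (gb g :: 'a ga)" if g: "g \<in> symg N" for g
  proof -
    have "gb g * JM N = (\<Sum>i<N. gb (tra (ap g i) N) :: 'a ga) * gb g"
      using g by (simp add: JM_def sum_distrib_left sum_distrib_right tra_conj symgD flip: gb_plus)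
    also have "(\<Sum>i<N. gb (tra (ap g i) N) :: 'a ga) = JM N"
      unfolding JM_def using sum.reindex_bij_betw[OF ap_image_lt[OF g], of "\<lambda>i. gb (tra i N)"] .
    finally show ?thesis .
  qed
  then show ?thesis
    by (subst (1 2) GA_expand[OF assms]) (simp add: sum_distrib_left sum_distrib_right)
qed

lemma star_JM [simp]: "star (JM N) = JM N"
  by (simp add: JM_def star_sum)

context tableau
begin

lemma corner_rows: "corner p \<Longrightarrow> card {x. x < n \<and> col x = col p \<and> x \<noteq> p} = row p"
proof -
  assume p: "corner p"
  let ?B = "{x. x < n \<and> col x = col p}"
  have "row ` ?B = {..row p}"
  proof (intro Set.set_eqI iffI)
    fix i assume "i \<in> {..row p}"
    then show "i \<in> row ` ?B" using closed[of p i "col p"] p by (auto simp: corner_def)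
  qed (use p in \<open>auto simp: corner_def\<close>)
  then have "card ?B = Suc (row p)" using row_image_column[of "col p"]
    by (metis card_atMost card_lessThan)
  moreover have "{x. x < n \<and> col x = col p \<and> x \<noteq> p} = ?B - {p}" by auto
  ultimately show ?thesis using p by (simp add: corner_def)
qed

text \<open>The Jucys-Murphy element inserts the transpositions \<open>tra x p\<close>, sorted here
  by the column of \<open>x\<close>. The \<open>row p\<close> boxes above \<open>p\<close> give
  \<open>tsg e\<close> each, each column on the left gives \<open>- tsg e\<close> by the exchange
  relation, and the columns on the right give elements of \<open>S\<close>. For
  \<open>e = True\<close> the factor is the content \<open>col p - row p\<close>.\<close>

lemma JM_corner:
  assumes n: "n = Suc N" and S: "submod N S" and p: "corner p" and m: "m \<in> symg n" "ap m N = p"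
    and S': "\<And>g. g \<in> symg n \<Longrightarrow> col p < col (ap g N) \<Longrightarrow> cel e * gb g \<in> S"
  shows "cel e * gb m * JM N - sm (tsg e * (of_nat (row p) - of_nat (col p))) (cel e * gb m)
    \<in> (S :: 'k::field_char_0 ga set)"
proof -
  let ?f = "\<lambda>x. cel e * gb (tra x p) :: 'k ga"
  have pn: "p < n" using p by (simp add: corner_def)
  have bij: "bij_betw (ap m) {..<N} ({..<n} - {p})"
  proof (intro bij_betw_imageI)
    have "ap m ` {..<N} = ap m ` ({..<n} - {N})" using n by (simp add: lessThan_Suc)
    also have "\<dots> = ap m ` {..<n} - {p}" using m by (auto simp: image_iff)
    also have "ap m ` {..<n} = {..<n}" using ap_image_lt[OF m(1)] by (simp add: bij_betw_def)
    finally show "ap m ` {..<N} = {..<n} - {p}" .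
  qed (simp add: inj_on_def)
  have "gb m * JM N = (\<Sum>i<N. gb (tra (ap m i) p) :: 'k ga) * gb m"
    by (simp add: JM_def sum_distrib_left sum_distrib_right tra_conj m flip: gb_plus)
  also have "(\<Sum>i<N. gb (tra (ap m i) p)) = (\<Sum>x\<in>{..<n} - {p}. gb (tra x p) :: 'k ga)"
    using sum.reindex_bij_betw[OF bij, of "\<lambda>x. gb (tra x p)"] .
  finally have "cel e * gb m * JM N = (\<Sum>x\<in>{..<n} - {p}. ?f x) * gb m"
    by (simp add: mult.assoc sum_distrib_left sum_distrib_right)
  also have "(\<Sum>x\<in>{..<n} - {p}. ?f x) = (\<Sum>x | x < n \<and> col x = col p \<and> x \<noteq> p. ?f x)
      + (\<Sum>x | x < n \<and> col x < col p. ?f x) + (\<Sum>x | x < n \<and> col p < col x. ?f x)"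
    by (subst sum.union_disjoint[symmetric]; (force)?)+ (intro sum.cong; force)
  also have "(\<Sum>x | x < n \<and> col x = col p \<and> x \<noteq> p. ?f x)
      = (\<Sum>x | x < n \<and> col x = col p \<and> x \<noteq> p. sm (tsg e) (cel e))"
    using pn by (intro sum.cong) (auto simp: cel_right tra_Grp chi_tra tsg_def)
  also have "\<dots> = sm (\<Sum>x | x < n \<and> col x = col p \<and> x \<noteq> p. tsg e) (cel e)"
    by (simp only: sm_sum_left)
  also have "(\<Sum>x | x < n \<and> col x = col p \<and> x \<noteq> p. tsg e) = (of_nat (row p) * tsg e :: 'k)"
    by (simp add: corner_rows[OF p])
  also have "(\<Sum>x | x < n \<and> col x < col p. ?f x)
      = (\<Sum>j<col p. \<Sum>x | x < n \<and> col x = j. ?f x)"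
  proof -
    have "(\<Sum>j<col p. sum ?f {x \<in> {x. x < n \<and> col x < col p}. col x = j})
        = (\<Sum>x | x < n \<and> col x < col p. ?f x)"
      by (intro sum.group) auto
    moreover have "{x \<in> {x. x < n \<and> col x < col p}. col x = j} = {x. x < n \<and> col x = j}"
      if "j < col p" for j using that by auto
    ultimately show ?thesis by simp
  qed
  also have "\<dots> = (\<Sum>j<col p. sm (- tsg e) (cel e))"
  proof (intro sum.cong refl exchange pn)
    fix j z assume "j \<in> {..<col p}" "z < n" "col z = col p"
    then show "\<exists>x<n. col x = j \<and> row x = row z" using closed[of z "row z" j] by auto
  qed auto
  also have "\<dots> = sm (\<Sum>j<col p. - tsg e) (cel e)"
    by (simp only: sm_sum_left)
  also have "(\<Sum>j<col p. - tsg e) = (- (of_nat (col p) * tsg e) :: 'k)"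
    by simp
  finally have eq: "cel e * gb m * JM N = (sm (of_nat (row p) * tsg e) (cel e)
      + sm (- (of_nat (col p) * tsg e)) (cel e) + (\<Sum>x | x < n \<and> col p < col x. ?f x)) * gb m" .
  have "tsg e * (of_nat (row p) - of_nat (col p))
      = of_nat (row p) * tsg e + - (of_nat (col p) * tsg e :: 'k)"
    by (simp add: algebra_simps)
  then have "cel e * gb m * JM N - sm (tsg e * (of_nat (row p) - of_nat (col p))) (cel e * gb m)
      = (\<Sum>x | x < n \<and> col p < col x. cel e * gb (tra x p + m) :: 'k ga)"
    unfolding eq by (simp only: sm_add_left) (simp add: distrib_right sum_distrib_right gb_plus mult.assoc)
  also have "\<dots> \<in> S"
  proof (intro submod_sum[OF S] S')
    fix x assume "x \<in> {x. x < n \<and> col p < col x}"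
    then show "tra x p + m \<in> symg n" "col p < col (ap (tra x p + m) N)" using m pn by auto
  qed
  finally show ?thesis .
qed

end

section \<open>The projection onto the smaller group algebra\<close>

definition Er :: "nat \<Rightarrow> 'k::field_char_0 ga \<Rightarrow> 'k ga" where
  "Er N x = (\<Sum>g\<in>symg N. sm (coef x g) (gb g))"

lemma coef_Er: "coef (Er N x) g = (if g \<in> symg N then coef x g else 0)"
  by (simp add: Er_def lookup_sum coef_gb if_distrib cong: if_cong)

lemma Er_GA [intro, simp]: "Er N x \<in> GA N"
  by (simp add: GA_def coef_Er)

lemma Er_simps [simp]: "Er N 0 = 0" "Er N (x + y) = Er N x + Er N y" "Er N (- x) = - Er N x"
  "Er N (x - y) = Er N x - Er N y" "Er N (sm c x) = sm c (Er N x)"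
  by (rule poly_mapping_eqI, simp add: coef_Er lookup_add lookup_minus)+

lemma Er_sum: "Er N (\<Sum>i\<in>I. f i) = (\<Sum>i\<in>I. Er N (f i))"
  by (induction I rule: infinite_finite_induct) simp_all

lemma Er_id: "x \<in> GA N \<Longrightarrow> Er N x = x"
  by (rule poly_mapping_eqI) (simp add: coef_Er GA_def)

lemma tau_Er [simp]: "tau (Er N x) = tau x"
  by (simp add: tau_def coef_Er)

lemma Er_gb: "Er N (gb g) = (if g \<in> symg N then gb g else 0)"
  by (rule poly_mapping_eqI) (auto simp: coef_Er coef_gb)

lemma Er_mult_left:
  assumes "a \<in> GA N"
  shows "Er N (a * x) = a * Er N x"
proof -
  have "Er N (gb g * x) = gb g * Er N x" if "g \<in> symg N" for g
    using that by (intro poly_mapping_eqI) (simp add: coef_Er coef_gb_left symg_plus_left_iff)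
  then show ?thesis
    by (subst (1 2) GA_expand[OF assms]) (simp add: sum_distrib_right Er_sum)
qed

lemma Er_mult_right:
  assumes "a \<in> GA N"
  shows "Er N (x * a) = Er N x * a"
proof -
  have "Er N (x * gb g) = Er N x * gb g" if "g \<in> symg N" for g
    using that symg_plus_right_iff[of "- g" N]
    by (intro poly_mapping_eqI) (simp add: coef_Er coef_gb_right)
  then show ?thesis
    by (subst (1 2) GA_expand[OF assms]) (simp add: sum_distrib_left Er_sum)
qed

text \<open>If \<open>g\<close> moves \<open>N\<close>, exactly one transposition survives on each
  side, \<open>tra i N\<close> with \<open>i = ap (- g) N\<close> on the right and
  \<open>tra (ap g N) N\<close> on the left, and the two products agree. If \<open>g\<close> fixes
  \<open>N\<close>, nothing survives.\<close>

lemma Er_JM: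
  assumes "x \<in> GA (Suc N)"
  shows "Er N (x * JM N) = Er N (JM N * x)"
proof -
  have "Er N (gb g * JM N) = Er N (JM N * (gb g :: 'a ga))" if g: "g \<in> symg (Suc N)" for g
  proof -
    have tS: "tra i N \<in> symg (Suc N)" if "i < N" for i using that by auto
    have l: "Er N (gb (g + tra i N)) = (if ap g i = N then gb (g + tra i N) else (0 :: 'a ga))"
      if "i < N" for i
      using that g tS[OF that] by (simp add: Er_gb symg_pred[of "g + tra i N"] symg_plus)
    have r: "Er N (gb (tra i N + g)) = (if i = ap g N then gb (tra i N + g) else (0 :: 'a ga))"
      if "i < N" for i
      using that g tS[OF that] by (auto simp add: Er_gb symg_pred[of "tra i N + g"] symg_plus)
    show ?thesis
    proof (cases "ap g N = N")
      case True
      then have "ap g i \<noteq> N" if "i < N" for i using that by (metis ap_eq_iff less_irrefl)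
      with True show ?thesis
        by (simp add: JM_def sum_distrib_left sum_distrib_right Er_sum l r flip: gb_plus)
    next
      case False
      define i where "i = ap (- g) N"
      have gi: "ap g k = N \<longleftrightarrow> k = i" for k unfolding i_def by (metis ap_minus_ap)
      have lt: "i < N" "ap g N < N"
        using symg_lt[of "- g" "Suc N" N] symg_lt[OF g, of N] g False gi[of N] gi[of i]
        by (auto simp: i_def less_Suc_eq)
      have "Er N (gb g * JM N) = (gb (g + tra i N) :: 'a ga)"
        using lt by (simp add: JM_def sum_distrib_left Er_sum l gi flip: gb_plus)
      moreover have "Er N (JM N * gb g) = (gb (tra (ap g N) N + g) :: 'a ga)"
        using lt by (simp add: JM_def sum_distrib_right Er_sum r flip: gb_plus)
      moreover have "g + tra i N = tra (ap g N) N + g"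
        using gi[of i] by (simp add: tra_conj[of g] tra_commute)
      ultimately show ?thesis by simp
    qed
  qed
  then show ?thesis
    by (subst (1 2) GA_expand[OF assms]) (simp add: sum_distrib_left sum_distrib_right Er_sum)
qed

section \<open>Removing a corner\<close>

lemma Grp_mono: "Grp N f \<subseteq> Grp (Suc N) f"
  unfolding Grp_def by (auto simp: symgD less_Suc_eq intro: symg_mono[of N "Suc N"])

text \<open>\<open>m p\<close> may be any permutation taking the last point to the corner
  \<open>p\<close>; partitions use the cycle \<open>mv n p\<close>.\<close>

locale corner_tableau = tableau +
  fixes N :: nat and m :: "nat \<Rightarrow> fperm"
  assumes n_Suc: "n = Suc N"
    and m: "corner p \<Longrightarrow> m p \<in> symg n" "corner p \<Longrightarrow> ap (m p) N = p"
begin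

text \<open>Transporting the tableau along \<open>m p\<close> puts \<open>N\<close> in the corner \<open>p\<close>; removing it leaves a
  tableau on \<open>{..<N}\<close>.\<close>

abbreviation "srow p \<equiv> row \<circ> ap (m p)"
abbreviation "scol p \<equiv> col \<circ> ap (m p)"

lemma corner_lt: "corner p \<Longrightarrow> p < n"
  by (simp add: corner_def)

lemma m_lt:
  assumes "corner p" "x < N"
  shows "ap (m p) x < n" "ap (m p) x \<noteq> p"
  using assms m[OF assms(1)] symg_lt[of "m p" n x] n_Suc
  by (auto simp del: ap_eq_iff) (metis ap_eq_iff less_irrefl)

lemma corner_le_iff:
  assumes "corner p" "x < n" "row p \<le> row x" "col p \<le> col x"
  shows "x = p"
proof -
  obtain y where y: "y < n" "row y = row p" "col y = col x"
    using closed[OF assms(2,3) order.refl] by blast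
  then have "col x = col p" using assms(1,4) by (force simp: corner_def)
  moreover from this have "row x = row p" using assms by (force simp: corner_def)
  ultimately show ?thesis using assms corner_lt inj by blast
qed

lemma sub_tableau:
  assumes p: "corner p"
  shows "tableau N (srow p) (scol p)"
proof
  fix x y assume "x < N" "y < N" "srow p x = srow p y" "scol p x = scol p y"
  then show "x = y" using inj m_lt[OF p] by (metis ap_eq_iff comp_apply)
next
  fix x i j assume x: "x < N" "i \<le> srow p x" "j \<le> scol p x"
  obtain y where y: "y < n" "row y = i" "col y = j"
    using closed[of "ap (m p) x" i j] x m_lt[OF p] by auto
  let ?y = "ap (- m p) y"
  \<comment> \<open>No other box lies weakly below and to the right of a corner, so the box
    \<open>y\<close> above and to the left of another one is not the removed one.\<close>
  have "y \<noteq> p" using corner_le_iff[OF p m_lt(1)[OF p x(1)]] m_lt(2)[OF p x(1)] x y by auto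
  then have "?y \<noteq> N" using m[OF p] by (metis ap_minus_ap(2))
  moreover have "?y < n" using symg_lt[of "- m p" n y] m[OF p] y by simp
  ultimately show "\<exists>y<N. srow p y = i \<and> scol p y = j"
    using y n_Suc by (intro exI[of _ ?y]) auto
qed

text \<open>The Young idempotent of the shape without \<open>p\<close>.\<close>

definition f :: "nat \<Rightarrow> 'k::field_char_0 ga" where
  "f p = tableau.yng N (srow p) (scol p)"

abbreviation "R p \<equiv> Sy False (Grp N (srow p))"
abbreviation "C p \<equiv> Sy True (Grp N (scol p))"
abbreviation "fac p \<equiv> tableau.yfac N (srow p) (scol p)"

lemma f_eq: "corner p \<Longrightarrow> f p = sm (inverse (fac p)) (R p * C p)"
  by (simp add: f_def tableau.yng_def[OF sub_tableau])

lemma f_simps: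
  assumes "corner p"
  shows "f p * f p = f p" "f p * (f p * x) = f p * x" "R p * f p = f p" "R p * (f p * x) = f p * x"
    "f p * C p = f p" "f p * (C p * x) = f p * x" "f p \<in> GA N" "tau (f p) \<noteq> 0"
    "R p \<in> GA N" "C p \<in> GA N"
  using tableau.yng_idem[OF sub_tableau[OF assms]] tableau.rsym_yng[OF sub_tableau[OF assms]]
    tableau.yng_casym[OF sub_tableau[OF assms]] tableau.yng_GA[OF sub_tableau[OF assms]]
    tableau.tau_yng_nz[OF sub_tableau[OF assms]] tableau.syms_GA[OF sub_tableau[OF assms]]
  by (simp_all add: f_def)

lemma GA_N: "x \<in> GA N \<Longrightarrow> x \<in> GA n"
  by (rule GA_mono[of N n]) (simp add: n_Suc)

lemma symg_N: "x \<in> symg N \<Longrightarrow> x \<in> symg n"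
  by (rule symg_mono[of N n]) (simp add: n_Suc)

lemma f_GA_Suc: "corner p \<Longrightarrow> f p \<in> GA n"
  by (rule GA_N[OF f_simps(7)])

lemma Grp_sub: "Grp N h \<subseteq> Grp n h"
  using Grp_mono n_Suc by simp

lemma conj_Sy: "corner p \<Longrightarrow> Sy e (Grp n h) * gb (m p) = gb (m p) * Sy e (Grp n (h \<circ> ap (m p)))"
  using arg_cong[OF Sy_Grp_conj[OF m(1), of p e h], of "\<lambda>x. gb (m p) * x"] by (simp add: mult.assoc)

lemma conj_Sy': "corner p \<Longrightarrow> gb (- m p) * Sy e (Grp n h) = Sy e (Grp n (h \<circ> ap (m p))) * gb (- m p)"
  using arg_cong[OF Sy_Grp_conj[OF m(1), of p e h], of "\<lambda>x. x * gb (- m p)"] by (simp add: mult.assoc)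

text \<open>\<open>m p\<close> conjugates the column group of the smaller tableau into that of the
  larger one.\<close>

lemma yng_m_C: "corner p \<Longrightarrow> yng * gb (m p) * C p = (yng * gb (m p) :: 'k::field_char_0 ga)"
proof -
  assume p: "corner p"
  have "casym * gb (m p) * C p = (casym * gb (m p) :: 'k ga)"
    by (simp add: conj_Sy[OF p] mult.assoc Sy_absorb[OF is_grp_Grp is_grp_Grp Grp_sub])
  then have "yng * (casym * gb (m p) * C p) = (yng * (casym * gb (m p)) :: 'k ga)"
    by (rule arg_cong[where f = "\<lambda>z. yng * z"])
  then show ?thesis by (simp add: mult.assoc)
qed

lemma R_m_yng: "corner p \<Longrightarrow> R p * (gb (- m p) * yng) = (gb (- m p) * yng :: 'k::field_char_0 ga)"
proof -
  assume p: "corner p"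
  have "R p * (gb (- m p) * rsym) = (gb (- m p) * rsym :: 'k ga)"
    by (simp add: conj_Sy'[OF p] mult.assoc Sy_absorb'[OF is_grp_Grp is_grp_Grp Grp_sub])
  then have "R p * (gb (- m p) * rsym) * yng = (gb (- m p) * rsym * yng :: 'k ga)"
    by (rule arg_cong[where f = "\<lambda>z. z * yng"])
  then show ?thesis by (simp add: mult.assoc)
qed

lemma sum_srow:
  assumes "corner p"
  shows "(\<Sum>x<N. srow p x) + row p = (\<Sum>x<n. row x)"
proof -
  have "(\<Sum>x<n. row x) = (\<Sum>x<n. row (ap (m p) x))"
    using sum.reindex_bij_betw[OF ap_image_lt[OF m(1)[OF assms]], of row] by simp
  then show ?thesis using n_Suc m(2)[OF assms] by simp
qed

lemma corner_cases:
  assumes "corner p" "corner q" "p \<noteq> q"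
  shows "row p < row q \<and> col q < col p \<or> row q < row p \<and> col p < col q"
  using corner_le_iff[OF assms(1) corner_lt[OF assms(2)]] corner_le_iff[OF assms(2) corner_lt[OF assms(1)]]
    assms(3) by linarith

text \<open>Removing the lower corner \<open>q\<close> leaves the smaller total of row numbers, so
  \<open>Sy_mult_Sy_zero\<close> applies.\<close>

lemma C_R_zero:
  assumes "corner p" "corner q" "row p < row q" "a \<in> GA N"
  shows "C p * (a * R q) = 0"
proof -
  have "(\<Sum>x<N. srow q x) < (\<Sum>x<N. srow p x)"
    using sum_srow[OF assms(1)] sum_srow[OF assms(2)] assms(3) by linarith
  then show ?thesis
    using tableau.Sy_mult_Sy_zero[OF sub_tableau[OF assms(1)] assms(4), of "srow q" True]
    by (simp add: mult.assoc)
qed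

lemma R_C_zero:
  assumes "corner p" "corner q" "row p < row q" "a \<in> GA N"
  shows "R q * (a * C p) = 0"
  using arg_cong[OF C_R_zero[OF assms(1-3) star_GA[OF assms(4)]], of star]
  by (simp add: star_mult mult.assoc)

text \<open>If \<open>p\<close> is the higher corner, the inner symmetrizers already annihilate each
  other by \<open>C_R_zero\<close>. In the other order they need not, and cyclicity with
  non-degeneracy of the trace reduces it to the first.\<close>

lemma f_f_zero:
  assumes pq: "corner p" "corner q" "p \<noteq> q" and a: "a \<in> GA N"
  shows "f p * (a * f q) = (0 :: 'k::field_char_0 ga)"
proof -
  have 1: "f p * (a * f q) = (0 :: 'k ga)"
    if "corner p" "corner q" "row p < row q" "a \<in> GA N" for p q a
    using that C_R_zero[OF that] by (simp add: f_eq mult.assoc) (simp flip: mult.assoc)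
  show ?thesis
  proof (cases "row p < row q")
    case True
    with 1 pq a show ?thesis by blast
  next
    case False
    then have lt: "row q < row p" using corner_cases[OF pq] by auto
    show ?thesis
    proof (rule tau_nondegenerate)
      show "f p * (a * f q) \<in> GA N" by (intro GA_mult f_simps(7) pq a)
      fix g assume g: "g \<in> symg N"
      have "tau (f p * (a * f q) * gb (- g)) = tau ((f p * a) * (f q * gb (- g)))"
        by (simp add: mult.assoc)
      also have "\<dots> = tau (f q * (gb (- g) * f p) * a)"
        by (subst tau_commute) (simp add: mult.assoc)
      also have "f q * (gb (- g) * f p) = (0 :: 'k ga)" using g by (intro 1 pq lt GA_gb symg_uminus)
      also have "tau (0 * a) = 0" by simp
      finally show "tau (f p * (a * f q) * gb (- g)) = 0" .
    qed
  qed
qed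

text \<open>Under the trace \<open>?C'\<close> absorbs \<open>?C\<close> and \<open>?R'\<close>
  absorbs \<open>?R\<close>, so both can be inserted once more. This creates
  \<open>?C * ?R * ?C * ?R\<close>, whose factor \<open>fac p\<close> cancels the normalization of
  \<open>f p\<close>.\<close>

lemma tau_f_yng:
  assumes p: "corner p"
  shows "tau (f p * (gb (- m p) * (yng * gb (m p)))) = tau (yng :: 'k::field_char_0 ga)"
proof -
  let ?R' = "Sy False (Grp n (srow p)) :: 'k ga" and ?C' = "Sy True (Grp n (scol p)) :: 'k ga"
  let ?R = "R p :: 'k ga" and ?C = "C p :: 'k ga"
  have yfac_p: "?C * (?R * (?C * ?R)) = sm (fac p) (?C * ?R)"
    using tableau.yfac(2)[OF sub_tableau[OF p]] by (simp add: mult.assoc)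
  have nz: "fac p \<noteq> (0 :: 'k)" using tableau.yfac(3)[OF sub_tableau[OF p]] .
  note ab = Sy_absorb[OF is_grp_Grp is_grp_Grp Grp_sub]
  have mm: "Sy e (Grp n h) * (Sy e' (Grp n h') * gb (m p))
      = gb (m p) * (Sy e (Grp n (h \<circ> ap (m p))) * Sy e' (Grp n (h' \<circ> ap (m p))) :: 'k ga)" for e e' h h'
  proof -
    have "Sy e (Grp n h) * (Sy e' (Grp n h') * gb (m p))
        = Sy e (Grp n h) * gb (m p) * (Sy e' (Grp n (h' \<circ> ap (m p))) :: 'k ga)"
      by (subst conj_Sy[OF p, of e' h']) (simp only: mult.assoc)
    also have "Sy e (Grp n h) * gb (m p) = (gb (m p) * Sy e (Grp n (h \<circ> ap (m p))) :: 'k ga)"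
      by (rule conj_Sy[OF p])
    finally show ?thesis by (simp only: mult.assoc)
  qed
  have conj: "gb (- m p) * (yng * gb (m p)) = sm (inverse yfac) (?R' * ?C')"
    by (simp add: yng_def mm mult.assoc)
  have "tau (?R * ?C * (?R' * ?C')) = tau (?C' * (?R * ?C * ?R'))"
    by (subst tau_commute[of ?C']) (simp add: mult.assoc)
  also have "?C' * (?R * ?C * ?R') = ?C' * ?C * (?R * ?C * (?R * ?R'))"
    by (simp only: ab)
  also have "\<dots> = ?C' * (?C * (?R * (?C * ?R))) * ?R'"
    by (simp only: mult.assoc)
  also have "\<dots> = sm (fac p) (?C' * ?C * (?R * ?R'))"
    unfolding yfac_p by (simp add: mult.assoc)
  also have "\<dots> = sm (fac p) (?C' * ?R')" by (simp only: ab)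
  also have "?C' * ?R' = gb (- m p) * (casym * (rsym * gb (m p)))"
    by (simp add: mm)
  also have "tau (sm (fac p) (gb (- m p) * (casym * (rsym * gb (m p)))))
      = fac p * tau (rsym * casym :: 'k ga)"
    by (subst tau_simps, subst tau_commute) (simp add: mult.assoc tau_commute[of casym])
  finally have fin: "tau (?R * ?C * (?R' * ?C')) = fac p * tau (rsym * casym :: 'k ga)" .
  have "tau (f p * (gb (- m p) * (yng * gb (m p))))
      = inverse (fac p) * (inverse yfac * (fac p * tau (rsym * casym :: 'k ga)))"
    by (simp only: f_eq[OF p] conj sm_mult_left sm_mult_right tau_simps fin mult.left_commute)
  then show ?thesis using nz by (simp add: tau_yng)
qed

section \<open>Elements connecting the idempotents of the two shapes\<close>

definition g :: "nat \<Rightarrow> 'k::field_char_0 ga" where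
  "g p = yng * gb (m p) * f p"

definition g' :: "nat \<Rightarrow> 'k::field_char_0 ga" where
  "g' p = f p * (gb (- m p) * yng)"

text \<open>The trace of a Young idempotent is the inverse of the hook product, so this is the hook
  product of the large shape divided by that of the shape without \<open>p\<close>.\<close>

definition nf :: "nat \<Rightarrow> 'k::field_char_0" where
  "nf p = tau (f p) / tau yng"

lemma g_GA: "corner p \<Longrightarrow> g p \<in> GA n" "corner p \<Longrightarrow> g' p \<in> GA n"
  unfolding g_def g'_def by (intro GA_mult yng_GA GA_gb f_GA_Suc symg_uminus m(1); assumption)+

text \<open>On the diagonal, primitivity gives a multiple of \<open>f p\<close>, and
  \<open>tau_f_yng\<close> determines it by comparing traces. Off the diagonal
  \<open>f_f_zero\<close> applies.\<close>

lemma Er_g'_g: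
  assumes p: "corner p" and q: "corner q"
  shows "Er N (g' p * g q) = (if p = q then sm (inverse (nf p)) (f p) else (0 :: 'k::field_char_0 ga))"
proof -
  let ?X = "gb (- m p) * (yng * gb (m q)) :: 'k ga"
  have "g' p * g q = f p * (?X * f q)"
    by (simp add: g_def g'_def mult.assoc)
  moreover have E': "Er N (f p * (?X * f q)) = f p * (Er N ?X * f q)"
    by (simp only: Er_mult_left[OF f_simps(7)[OF p]] Er_mult_right[OF f_simps(7)[OF q]])
  ultimately have E: "Er N (g' p * g q) = f p * (Er N ?X * f q)" by simp
  show ?thesis
  proof (cases "p = q")
    case True
    obtain \<kappa> where \<kappa>: "f p * (Er N ?X * f q) = sm \<kappa> (f p)"
      using tableau.yng_mult_yng[OF sub_tableau[OF p] Er_GA, of ?X] True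
      by (auto simp: f_def mult.assoc)
    have "\<kappa> * tau (f p) = tau (Er N (f p * (?X * f q)))"
      by (simp only: E' \<kappa> tau_simps)
    also have "\<dots> = tau (f p * ?X)"
    proof -
      have "?X * f q * f p = ?X * f p" using True by (simp add: mult.assoc f_simps[OF q])
      then show ?thesis
        unfolding tau_Er tau_commute[of "f p" "?X * f q"] tau_commute[of "f p" ?X] by simp
    qed
    also have "\<dots> = tau yng" using tau_f_yng[OF p] True by simp
    finally have "\<kappa> * tau (f p) = tau (yng :: 'k ga)" .
    moreover have "tau (f p) \<noteq> (0 :: 'k)" by (rule f_simps(8)[OF p])
    ultimately have "\<kappa> = inverse (nf p)" by (simp add: nf_def field_simps)
    with E \<kappa> True show ?thesis by simp
  next
    case False
    then show ?thesis by (simp add: E f_f_zero[OF p q False])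
  qed
qed

definition ct :: "nat \<Rightarrow> 'k::field_char_0" where
  "ct p = of_nat (col p) - of_nat (row p)"

lemma ct_distinct:
  assumes "corner p" "corner q" "p \<noteq> q"
  shows "ct p \<noteq> (ct q :: 'k::field_char_0)"
proof
  assume "ct p = (ct q :: 'k)"
  then have "of_nat (col p + row q) = (of_nat (col q + row p) :: 'k)"
    by (simp add: ct_def algebra_simps)
  then have "col p + row q = col q + row p" by (simp only: of_nat_eq_iff)
  then show False using corner_cases[OF assms] by linarith
qed

lemma yng_cel: "yng = sm (inverse yfac) (cel True)"
  by (simp add: yng_def cel_def)

lemma cel_yng: "cel True = sm yfac (yng :: 'k::field_char_0 ga)"
  by (simp add: yng_cel yfac)

lemma submod_right_annihilator:
  "submod N {x. \<forall>a\<in>GA N. x * (a * y) = 0}"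
  unfolding submod_def by (auto simp: distrib_right mult.assoc[of _ "gb _"])
    (metis GA_gb GA_mult mult.assoc)

text \<open>\<open>JM_corner\<close> gives the eigenvalue only modulo the columns right of
  \<open>p\<close>. Corners there lie above \<open>p\<close>, so \<open>C_R_zero\<close> shows that
  right multiplication by \<open>k[S_N] f p\<close> annihilates their contribution. Hence
  \<open>S\<close> is taken to be this annihilator.\<close>

lemma g_JM:
  assumes p: "corner p"
  shows "g p * JM N = sm (ct p) (g p :: 'k::field_char_0 ga)"
proof -
  define S where "S = {x :: 'k ga. \<forall>a\<in>GA N. x * (a * f p) = 0}"
  have S: "submod N S" unfolding S_def by (rule submod_right_annihilator)
  have gen: "cel True * gb h \<in> S" if h: "h \<in> symg n" "col p < col (ap h N)" for h
  proof (rule corner_generation[OF n_Suc S _ _ h(1), of m "Suc (col p)"])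
    fix q assume q: "corner q" "Suc (col p) \<le> col q"
    then have lt: "row q < row p" using corner_cases[OF p q(1)] by fastforce
    have "yng * gb (m q) * (a * f p) = (0 :: 'k ga)" if a: "a \<in> GA N" for a
    proof -
      have "yng * gb (m q) * (a * f p) = yng * gb (m q) * C q * (a * (f p :: 'k ga))"
        by (simp only: yng_m_C[OF q(1)])
      also have "\<dots> = sm (inverse (fac p)) (yng * gb (m q) * (C q * (a * R p)) * C p)"
        by (simp add: f_eq[OF p] mult.assoc)
      also have "\<dots> = 0" using C_R_zero[OF q(1) p lt a] by simp
      finally show ?thesis .
    qed
    then show "cel True * gb (m q) \<in> S" by (simp add: cel_yng S_def mult.assoc)
  qed (use m h in auto)
  have "cel True * gb (m p) * JM N - sm (tsg True * (of_nat (row p) - of_nat (col p)))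
      (cel True * gb (m p)) \<in> S"
    by (rule JM_corner[OF n_Suc S p m(1)[OF p] m(2)[OF p] gen])
  then have "(cel True * gb (m p) * JM N - sm (ct p) (cel True * gb (m p))) * (1 * f p) = (0 :: 'k ga)"
    unfolding S_def tsg_def ct_def using GA_one[of N] by auto
  then have "cel True * gb (m p) * (JM N * f p) = sm (ct p) (cel True * gb (m p) * (f p :: 'k ga))"
    by (simp add: left_diff_distrib mult.assoc)
  then have "sm (inverse yfac) (cel True * gb (m p) * (f p * JM N))
      = sm (inverse yfac) (sm (ct p) (cel True * gb (m p) * (f p :: 'k ga)))"
    by (simp add: JM_commute[OF f_simps(7)[OF p]])
  then show ?thesis by (simp add: g_def yng_cel mult.assoc mult.commute)
qed

lemma swapped_cel: "tableau.cel n col row False = star (cel True)"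
  by (simp add: cel_def tableau.cel_def[OF swap] star_mult)

text \<open>The mirror image of \<open>g_JM\<close>, read in the transposed tableau, whose
  \<open>cel\<close> is proportional to \<open>star yng\<close>.\<close>

lemma JM_g':
  assumes p: "corner p"
  shows "JM N * g' p = sm (ct p) (g' p :: 'k::field_char_0 ga)"
proof -
  let ?c = "tableau.cel n col row False :: 'k ga"
  have c: "?c = sm yfac (star yng)" by (simp add: swapped_cel cel_yng star_sm)
  define S where "S = {x :: 'k ga. \<forall>a\<in>GA N. x * (a * star (f p)) = 0}"
  have S: "submod N S" unfolding S_def by (rule submod_right_annihilator)
  have sf: "star (f p) = sm (inverse (fac p)) (C p * R p :: 'k ga)"
    by (simp add: f_eq[OF p] star_sm star_mult)
  have gen: "?c * gb h \<in> S" if h: "h \<in> symg n" "row p < row (ap h N)" for h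
  proof (rule tableau.corner_generation[OF swap n_Suc S _ _ h(1), of m "Suc (row p)"])
    fix q assume q: "tableau.corner n col row q" "Suc (row p) \<le> row q"
    then have q': "corner q" "row p < row q" by (auto simp: corner_swap)
    have "star yng * gb (m q) * (a * star (f p)) = (0 :: 'k ga)" if a: "a \<in> GA N" for a
    proof -
      have "star yng * gb (m q) * R q = star yng * (gb (m q) :: 'k ga)"
        using arg_cong[OF R_m_yng[OF q'(1), where 'k = 'k], of star] by (simp add: star_mult)
      then have "star yng * gb (m q) * (a * star (f p))
          = star yng * gb (m q) * R q * (a * star (f p :: 'k ga))" by simp
      also have "\<dots> = sm (inverse (fac p)) (star yng * gb (m q) * (R q * (a * C p)) * R p)"
        by (simp add: sf mult.assoc)
      also have "\<dots> = 0" using R_C_zero[OF p q' a] by simp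
      finally show ?thesis .
    qed
    then show "?c * gb (m q) \<in> S" by (simp add: c S_def mult.assoc)
  qed (use m h in \<open>auto simp: corner_swap\<close>)
  \<comment> \<open>Transposition exchanges \<open>row\<close> and \<open>col\<close> while
    \<open>tsg False\<close> has the opposite sign of \<open>tsg True\<close>; the two changes
    cancel and the eigenvalue is again \<open>ct p\<close>.\<close>
  have "?c * gb (m p) * JM N - sm (tsg False * (of_nat (col p) - of_nat (row p))) (?c * gb (m p)) \<in> S"
    using gen m p by (intro tableau.JM_corner[OF swap n_Suc S]) (auto simp: corner_swap)
  then have "(?c * gb (m p) * JM N - sm (ct p) (?c * gb (m p))) * (1 * star (f p)) = (0 :: 'k ga)"
    unfolding S_def tsg_def ct_def using GA_one[of N] by auto
  then have "?c * gb (m p) * (JM N * star (f p)) = sm (ct p) (?c * gb (m p) * (star (f p) :: 'k ga))"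
    by (simp add: left_diff_distrib mult.assoc)
  then have "sm (inverse yfac) (?c * gb (m p) * (star (f p) * JM N))
      = sm (inverse yfac) (sm (ct p) (?c * gb (m p) * (star (f p) :: 'k ga)))"
    by (simp add: JM_commute[OF star_GA[OF f_simps(7)[OF p]]])
  then have "star yng * gb (m p) * (star (f p) * JM N)
      = sm (ct p) (star yng * gb (m p) * (star (f p) :: 'k ga))"
    using yfac(3)[where 'k = 'k] by (simp add: c mult.assoc yfac field_simps)
  from arg_cong[OF this, of star] show ?thesis
    by (simp add: g'_def star_mult star_sm mult.assoc)
qed

section \<open>The defect of the branching rule\<close>

definition T :: "'k::field_char_0 ga \<Rightarrow> 'k ga" where
  "T x = x - (\<Sum>p | corner p. sm (nf p) (g p * Er N (g' p * x)))"

lemma finite_corners [simp]: "finite {p. corner p}"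
  by (rule finite_subset[of _ "{..<n}"]) (auto simp: corner_def)

lemma T_simps: "T (x + y) = T x + T y" "T (sm c x) = sm c (T x)" "T 0 = 0" "T (x - y) = T x - T y"
  by (simp_all add: T_def distrib_left right_diff_distrib sm_add sm_diff sum.distrib sum_subtractf
      sm_sum mult.commute)

lemma T_right:
  assumes "a \<in> GA N"
  shows "T (x * a) = T x * a"
proof -
  have "Er N (y * (x * a)) = Er N (y * x) * a" for y
    using Er_mult_right[OF assms, of "y * x"] by (simp only: mult.assoc)
  then show ?thesis by (simp add: T_def left_diff_distrib sum_distrib_right mult.assoc)
qed

lemma T_yng: "T (yng * x) = yng * T (x :: 'k::field_char_0 ga)"
proof -
  have "yng * g p = (g p :: 'k ga)" "g' p * (yng * x) = g' p * x" for p
    by (simp_all add: g_def g'_def mult.assoc)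
  then show ?thesis
    by (simp only: T_def right_diff_distrib sum_distrib_left sm_mult_right mult.assoc[symmetric])
qed

text \<open>\<open>Er_JM\<close> moves the Jucys-Murphy element from the right of \<open>x\<close>
  to the left of \<open>g' p\<close>. There it becomes the scalar \<open>ct p\<close>, which
  \<open>g p\<close> turns back into the Jucys-Murphy element, and this commutes with the projected
  factor.\<close>

lemma T_JM:
  assumes "x \<in> GA n"
  shows "T (x * JM N) = T x * JM N"
proof -
  have "g p * Er N (g' p * (x * JM N)) = g p * Er N (g' p * x) * JM N" if p: "corner p" for p
  proof -
    have "g' p * x \<in> GA (Suc N)" using g_GA[OF p] assms n_Suc by auto
    then have "Er N (g' p * (x * JM N)) = Er N (JM N * g' p * x)"
      using Er_JM by (metis mult.assoc)
    also have "\<dots> = sm (ct p) (Er N (g' p * x))" by (simp add: JM_g'[OF p])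
    finally have "g p * Er N (g' p * (x * JM N)) = sm (ct p) (g p) * Er N (g' p * x)" by simp
    also have "\<dots> = g p * (JM N * Er N (g' p * x))" by (simp add: g_JM[OF p] flip: mult.assoc)
    also have "JM N * Er N (g' p * x) = Er N (g' p * x) * JM N" by (simp add: JM_commute)
    finally show ?thesis by (simp add: mult.assoc)
  qed
  then show ?thesis
    by (simp add: T_def left_diff_distrib sum_distrib_right)
qed

lemma T_g:
  assumes q: "corner q"
  shows "T (g q) = (0 :: 'k::field_char_0 ga)"
proof -
  have "(\<Sum>p | corner p. sm (nf p) (g p * Er N (g' p * g q)))
      = (\<Sum>p | corner p. if p = q then g q else (0 :: 'k ga))"
  proof (rule sum.cong)
    fix p assume "p \<in> {p. corner p}"
    moreover have "tau (f q) \<noteq> (0 :: 'k)" "tau yng \<noteq> (0 :: 'k)"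
      using f_simps(8)[OF q] tau_yng_nz by blast+
    then have "nf q * inverse (nf q) = (1 :: 'k)" by (simp add: nf_def)
    moreover have "g q * f q = (g q :: 'k ga)" by (simp add: g_def mult.assoc f_simps(1)[OF q])
    ultimately show "sm (nf p) (g p * Er N (g' p * g q)) = (if p = q then g q else (0 :: 'k ga))"
      using q by (simp add: Er_g'_g)
  qed simp
  then show ?thesis using q by (simp add: T_def)
qed

lemma T_GA:
  assumes "x \<in> GA n"
  shows "T x \<in> GA n"
proof -
  have "g p * Er N (g' p * x) \<in> GA n" if "corner p" for p
    by (intro GA_mult g_GA that GA_N Er_GA)
  then show ?thesis unfolding T_def using assms by auto
qed

text \<open>The set \<open>S\<close> of elements orthogonal to \<open>w k[S_N]\<close> is a
  submodule, and corner generation in the transposed tableau shows that it contains all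
  \<open>?c * gb h\<close>. Non-degeneracy of the trace then gives \<open>w = 0\<close>.\<close>

lemma eigenvector_zero:
  assumes p: "corner p" and w: "w \<in> GA n" "w * JM N = sm (ct p) w" "w * C p = w" "w * f p = 0"
    "yng * w = w"
  shows "w = (0 :: 'k::field_char_0 ga)"
proof -
  let ?c = "tableau.cel n col row False :: 'k ga"
  have c: "?c = sm yfac (star yng)" by (simp add: swapped_cel cel_yng star_sm)
  define S where "S = {x :: 'k ga. \<forall>a\<in>GA N. tau (w * (a * star x)) = 0}"
  have S: "submod N S"
    unfolding submod_def S_def
  proof (intro conjI ballI allI; clarsimp simp: star_add star_sm distrib_left star_mult)
    fix x a :: "'k ga" and h assume "\<forall>a\<in>GA N. tau (w * (a * star x)) = 0" "h \<in> symg N" "a \<in> GA N"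
    then have "tau (w * ((a * gb (- h)) * star x)) = 0" by auto
    then show "tau (w * (a * (gb (- h) * star x))) = 0" by (simp add: mult.assoc)
  qed
  have gen: "?c * gb h \<in> S" if h: "h \<in> symg n" for h
  proof (rule tableau.corner_generation[OF swap n_Suc S _ _ h, of m 0])
    fix q assume q: "tableau.corner n col row q"
      and big: "\<And>h. h \<in> symg n \<Longrightarrow> row q < row (ap h N) \<Longrightarrow> ?c * gb h \<in> S"
    then have q': "corner q" by (simp add: corner_swap)
    let ?y = "star (?c * gb (m q))"
    have y: "?y = sm yfac (gb (- m q) * yng)" by (simp add: c star_mult star_sm)
    show "?c * gb (m q) \<in> S"
      unfolding S_def
    proof (intro CollectI ballI)
      fix a :: "'k ga" assume a: "a \<in> GA N"
      show "tau (w * (a * ?y)) = 0"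
      proof (cases "q = p")
        \<comment> \<open>Evaluated through \<open>w\<close> the Jucys-Murphy element acts by
          \<open>ct p\<close>, evaluated through the generator by \<open>ct q\<close> up to elements
          of \<open>S\<close>. Distinct contents force the value zero.\<close>
        case False
        have "?c * gb (m q) * JM N - sm (tsg False * (of_nat (col q) - of_nat (row q))) (?c * gb (m q)) \<in> S"
          using big m q' q by (intro tableau.JM_corner[OF swap n_Suc S]) auto
        then have "tau (w * (a * (JM N * ?y - sm (ct q) ?y))) = 0"
          using a unfolding S_def tsg_def ct_def
          by (simp add: star_mult star_sm star_add star_uminus diff_conv_add_uminus
              del: add_uminus_conv_diff)
        moreover have "w * (a * (JM N * ?y)) = sm (ct p) (w * (a * ?y))"
        proof -
          have "w * (a * (JM N * ?y)) = w * (a * JM N) * ?y" by (simp only: mult.assoc)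
          also have "\<dots> = w * JM N * (a * ?y)" by (simp only: JM_commute[OF a] mult.assoc)
          finally show ?thesis by (simp add: w(2))
        qed
        ultimately have "(ct p - ct q) * tau (w * (a * ?y)) = 0"
          by (simp add: right_diff_distrib left_diff_distrib)
        then show ?thesis using ct_distinct[OF p q'] False by auto
      next
        \<comment> \<open>\<open>w\<close> kills \<open>?R * ?C\<close> and absorbs
          \<open>?C\<close>, hence it kills \<open>?C * ?R\<close>, which is proportional to its
          square. Every \<open>?C * a * ?R\<close> is a multiple of this.\<close>
        case True
        let ?R = "R p :: 'k ga" and ?C = "C p :: 'k ga"
        have Ry: "?R * ?y = ?y" unfolding y by (simp add: True R_m_yng[OF p])
        have "w * (?R * ?C) = sm (fac p) (w * f p)"
          using tableau.yfac(3)[OF sub_tableau[OF p], where 'k = 'k] by (simp add: f_eq[OF p])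
        then have RC: "w * (?R * ?C) = 0" using w(4) by simp
        have "sm (fac p) (w * (?C * ?R)) = w * ?C * (?R * ?C) * ?R"
          using tableau.yfac(2)[OF sub_tableau[OF p], where 'k = 'k]
          by (metis (no_types) mult.assoc sm_mult_right)
        also have "\<dots> = 0" by (simp add: w(3) RC)
        finally have CR: "w * (?C * ?R) = 0"
          using tableau.yfac(3)[OF sub_tableau[OF p]] by (rule sm_cancel)
        from tableau.casym_mult_rsym[OF sub_tableau[OF p] a]
        obtain \<kappa> where \<kappa>: "?C * a * ?R = sm \<kappa> (?C * ?R)" ..
        have "w * (a * ?y) = w * ?C * (a * (?R * ?y))" by (simp only: w(3) Ry)
        also have "\<dots> = w * (?C * a * ?R) * ?y" by (simp only: mult.assoc)
        also have "\<dots> = 0" by (simp add: \<kappa> CR)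
        finally show ?thesis by simp
      qed
    qed
  qed (use m in \<open>auto simp: corner_swap\<close>)
  show ?thesis
  proof (rule tau_nondegenerate[OF w(1)])
    fix h assume h: "h \<in> symg n"
    have "tau (w * (1 * star (?c * gb h))) = 0" using gen[OF h] GA_one unfolding S_def by blast
    then have "tau (w * (gb (- h) * yng)) = 0" by (simp add: c star_mult star_sm yfac)
    then have "tau (yng * (w * gb (- h))) = 0" by (subst tau_commute) (simp add: mult.assoc)
    then show "tau (w * gb (- h)) = 0" using w(5) by (metis mult.assoc)
  qed
qed

text \<open>The kernel of \<open>T\<close> is a submodule. Once it contains the columns further
  right, \<open>T (yng * gb (m p))\<close> is an exact eigenvector of content \<open>ct p\<close>,
  and \<open>T_g\<close> supplies the last hypothesis of \<open>eigenvector_zero\<close>.\<close>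

lemma T_yng_gb:
  assumes h: "h \<in> symg n"
  shows "T (yng * gb h) = (0 :: 'k::field_char_0 ga)"
proof -
  define S where "S = {x :: 'k ga. x \<in> GA n \<and> T x = 0}"
  have S: "submod N S"
    unfolding submod_def S_def
    by (auto simp: T_simps T_right GA_gb intro!: GA_mult GA_gb[of _ n] symg_N)
  have "cel True * gb h \<in> S"
  proof (rule corner_generation[OF n_Suc S _ _ h, of m 0])
    fix p assume p: "corner p"
      and big: "\<And>h. h \<in> symg n \<Longrightarrow> col p < col (ap h N) \<Longrightarrow> cel True * gb h \<in> S"
    let ?v = "yng * gb (m p) :: 'k ga"
    have v: "?v \<in> GA n" using m(1)[OF p] by auto
    have "cel True * gb (m p) * JM N - sm (tsg True * (of_nat (row p) - of_nat (col p)))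
        (cel True * gb (m p)) \<in> S"
      using big by (intro JM_corner[OF n_Suc S p m(1)[OF p] m(2)[OF p]])
    also have "cel True * gb (m p) * JM N - sm (tsg True * (of_nat (row p) - of_nat (col p)))
        (cel True * gb (m p)) = sm yfac (?v * JM N - sm (ct p) ?v)"
      by (simp add: cel_yng tsg_def ct_def sm_diff mult.commute)
    finally have "sm yfac (T (?v * JM N - sm (ct p) ?v)) = 0"
      unfolding S_def by (simp only: T_simps mem_Collect_eq)
    then have "T (?v * JM N - sm (ct p) ?v) = 0"
      using yfac(3) by (rule sm_cancel)
    then have 1: "T ?v * JM N = sm (ct p) (T ?v)"
      by (simp only: T_simps T_JM[OF v] right_minus_eq)
    have 2: "T ?v * C p = T ?v"
      by (simp only: T_right[OF f_simps(10)[OF p], symmetric] yng_m_C[OF p])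
    have "T ?v * f p = T (g p)"
      by (simp only: T_right[OF f_simps(7)[OF p], symmetric] g_def)
    then have 3: "T ?v * f p = 0" by (simp only: T_g[OF p])
    have 4: "yng * T ?v = T ?v"
      by (simp only: T_yng[symmetric] yng_idem)
    have "T ?v = 0" by (rule eigenvector_zero[OF p T_GA[OF v] 1 2 3 4])
    with v show "cel True * gb (m p) \<in> S" by (auto simp: S_def cel_yng T_simps)
  qed (use m in auto)
  then have "sm yfac (T (yng * gb h)) = (0 :: 'k ga)" by (simp add: S_def cel_yng T_simps)
  then show ?thesis using yfac(3) by (rule sm_cancel)
qed

text \<open>The branching rule for the restriction of a Specht module from \<open>n\<close> to \<open>n - 1\<close>.\<close>

theorem branching:
  assumes "x \<in> GA n"
  shows "yng * x = (\<Sum>p | corner p. sm (nf p) (g p * Er N (g' p * x)))"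
proof -
  have "T (\<Sum>h\<in>A. sm (c h) (yng * gb h)) = 0" if "A \<subseteq> symg n" for A c
    using finite_subset[OF that finite_symg] that
    by induction (auto simp: T_simps T_yng_gb)
  then have "T (\<Sum>h\<in>symg n. sm (coef x h) (yng * gb h)) = 0" by blast
  moreover have "(\<Sum>h\<in>symg n. sm (coef x h) (yng * gb h)) = yng * x"
    by (subst (2) GA_expand[OF assms]) (simp add: sum_distrib_left)
  moreover have "g' p * (yng * x) = g' p * x" for p by (simp add: g'_def mult.assoc)
  ultimately show ?thesis by (simp add: T_def)
qed

end

section \<open>Calculus of diagrams\<close>

text \<open>A typed representative rather than membership in \<open>hom\<close>, because the unit
  and interchange laws are imposed on typed diagrams.\<close>

definition tp :: "'k::field_char_0 hmor \<Rightarrow> word \<Rightarrow> word \<Rightarrow> bool" where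
  "tp f a b \<longleftrightarrow> (\<exists>d. typed d a b \<and> f = abs_hmor d)"

lift_definition crossPP :: "'k::field_char_0 hmor" is Cross .
lift_definition cupPQ :: "'k::field_char_0 hmor" is "Cup Up" .
lift_definition capPQ :: "'k::field_char_0 hmor" is "Cap Up" .

lemma abs_hmor_simps:
  "abs_hmor (Comp f g) = abs_hmor f * abs_hmor g"
  "abs_hmor (Tens f g) = abs_hmor f \<boxtimes> abs_hmor g"
  "abs_hmor (Add f g) = abs_hmor f + abs_hmor g"
  "abs_hmor (Scale c f) = scal c (abs_hmor f)"
  "abs_hmor (Idt a) = idn a"
  "abs_hmor Zero = 0"
  "abs_hmor Cross = crossPP"
  "abs_hmor (Cup Dn) = cupQP" "abs_hmor (Cap Dn) = capQP"
  "abs_hmor (Cup Up) = cupPQ" "abs_hmor (Cap Up) = capPQ"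
  by (simp_all add: times_hmor.abs_eq tens.abs_eq plus_hmor.abs_eq scal.abs_eq idn.abs_eq
      zero_hmor.abs_eq crossPP.abs_eq cupQP.abs_eq capQP.abs_eq cupPQ.abs_eq capPQ.abs_eq)

lemma abs_hmor_eq: "f \<approx> g \<Longrightarrow> abs_hmor f = abs_hmor g"
  by (simp add: hmor.abs_eq_iff)

lemma scal_simps [simp]: "scal 1 f = f" "scal c (scal d f) = scal (c * d) f"
  "scal c 0 = 0" "scal 0 f = 0" "scal c (- f) = - scal c f"
  and scal_add: "scal c (f + g) = scal c f + scal c g"
  and scal_add_left: "scal (c + d) f = scal c f + scal d f"
  and scal_mult [simp]: "scal c f * g = scal c (f * g)" "f * scal c g = scal c (f * g)"
  and scal_tens [simp]: "scal c f \<boxtimes> g = scal c (f \<boxtimes> g)" "f \<boxtimes> scal c g = scal c (f \<boxtimes> g)"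
  and scal_uminus: "scal (- 1) f = - f"
proof -
  show 1: "scal 1 f = f" for f by transfer (rule Scale_one)
  show 2: "scal c (scal d f) = scal (c * d) f" for c d f by transfer (rule Scale_Scale)
  show 3: "scal c (f + g) = scal c f + scal c g" for c f g by transfer (rule Scale_Add)
  show 4: "scal (c + d) f = scal c f + scal d f" for c d f by transfer (rule Scale_add)
  show "scal c f * g = scal c (f * g)" by transfer (rule Comp_Scale_left)
  show "f * scal c g = scal c (f * g)" by transfer (rule Comp_Scale_right)
  show "scal c f \<boxtimes> g = scal c (f \<boxtimes> g)" by transfer (rule Tens_Scale_left)
  show "f \<boxtimes> scal c g = scal c (f \<boxtimes> g)" by transfer (rule Tens_Scale_right)
  show 5: "scal (- 1) f = - f" for f :: "'a hmor" by transfer (rule heq_refl)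
  show "scal c 0 = (0 :: 'a hmor)" using 3[of c 0 0] by simp
  show "scal 0 f = 0" using 4[of 0 0 f] by simp
  show "scal c (- f) = - scal c f" unfolding 5[symmetric] 2 by (simp add: mult.commute)
qed

lemma tens_assoc: "(f \<boxtimes> g) \<boxtimes> h = f \<boxtimes> g \<boxtimes> h"
  by transfer (rule Tens_assoc)

lemma tens_unit [simp]: "idn [] \<boxtimes> f = f" "f \<boxtimes> idn [] = f"
  by (transfer, rule Tens_unit_left, transfer, rule Tens_unit_right)

lemma tens_idn: "idn a \<boxtimes> idn b = idn (a @ b)"
  by transfer (rule Tens_Idt)

lemma tens_idn': "idn a \<boxtimes> idn b \<boxtimes> f = idn (a @ b) \<boxtimes> f"
  by (simp add: tens_idn flip: tens_assoc)

lemma tens_add: "(f + g) \<boxtimes> h = f \<boxtimes> h + g \<boxtimes> h" "f \<boxtimes> (g + h) = f \<boxtimes> g + f \<boxtimes> h"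
  by (transfer, rule Tens_Add_left, transfer, rule Tens_Add_right)

lemma tens_zero [simp]: "0 \<boxtimes> f = 0" "f \<boxtimes> 0 = 0"
  using tens_add(1)[of 0 0 f] tens_add(2)[of f 0 0] by simp_all

lemma tens_uminus: "(- f) \<boxtimes> g = - (f \<boxtimes> g)" "f \<boxtimes> (- g) = - (f \<boxtimes> g)"
  by (simp_all flip: scal_uminus)

lemma tens_diff: "(f - g) \<boxtimes> h = f \<boxtimes> h - g \<boxtimes> h" "f \<boxtimes> (g - h) = f \<boxtimes> g - f \<boxtimes> h"
  by (simp_all add: diff_conv_add_uminus tens_add tens_uminus del: add_uminus_conv_diff)

lemma tens_sum: "(\<Sum>i\<in>I. f i) \<boxtimes> h = (\<Sum>i\<in>I. f i \<boxtimes> h)" "h \<boxtimes> (\<Sum>i\<in>I. f i) = (\<Sum>i\<in>I. h \<boxtimes> f i)"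
  by (induction I rule: infinite_finite_induct) (simp_all add: tens_add)

lemma scal_sum: "scal c (\<Sum>i\<in>I. f i) = (\<Sum>i\<in>I. scal c (f i))"
  by (induction I rule: infinite_finite_induct) (simp_all add: scal_add)

lemma tp_typed: "typed d a b \<Longrightarrow> tp (abs_hmor d) a b"
  by (auto simp: tp_def)

lemma tp_gens: "tp (idn a) a a" "tp 0 a b" "tp crossPP [Up, Up] [Up, Up]"
  "tp cupQP [] [Dn, Up]" "tp capQP [Dn, Up] []" "tp cupPQ [] [Up, Dn]" "tp capPQ [Up, Dn] []"
  unfolding abs_hmor_simps[symmetric]
  using typed_Cup[of Dn] typed_Cup[of Up] typed_Cap[of Dn] typed_Cap[of Up]
  by (auto intro!: tp_typed intro: typed.intros)

lemma tp_mult: "tp g a b \<Longrightarrow> tp f b' c \<Longrightarrow> b = b' \<Longrightarrow> tp (f * g) a c"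
  and tp_tens: "tp f1 a1 b1 \<Longrightarrow> tp g1 c1 d1 \<Longrightarrow> tp (f1 \<boxtimes> g1) (a1 @ c1) (b1 @ d1)"
  and tp_add: "tp f2 a2 b2 \<Longrightarrow> tp g2 a2 b2 \<Longrightarrow> tp (f2 + g2) a2 b2"
  and tp_scal: "tp f2 a2 b2 \<Longrightarrow> tp (scal r f2) a2 b2"
  unfolding tp_def by (metis abs_hmor_simps(1) typed_Comp, metis abs_hmor_simps(2) typed_Tens,
    metis abs_hmor_simps(3) typed_Add, metis abs_hmor_simps(4) typed_Scale)

lemma tp_sum: "(\<And>i. i \<in> I \<Longrightarrow> tp (f i) a b) \<Longrightarrow> tp (\<Sum>i\<in>I. f i) a b"
  by (induction I rule: infinite_finite_induct) (auto simp: tp_gens tp_add)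

lemma tp_conv: "tp f a b \<Longrightarrow> a = a' \<Longrightarrow> b = b' \<Longrightarrow> tp f a' b'"
  by simp

lemma idn_left: "tp f a b \<Longrightarrow> idn b * f = f"
  by (auto simp: tp_def simp flip: abs_hmor_simps intro!: abs_hmor_eq Idt_left)

lemma idn_right: "tp f a b \<Longrightarrow> f * idn a = f"
  by (auto simp: tp_def simp flip: abs_hmor_simps intro!: abs_hmor_eq Idt_right)

lemma tens_mult:
  "tp f' a b \<Longrightarrow> tp f b c \<Longrightarrow> tp g' a' b' \<Longrightarrow> tp g b' c' \<Longrightarrow>
    (f \<boxtimes> g) * (f' \<boxtimes> g') = (f * f') \<boxtimes> (g * g')"
  by (auto simp: tp_def simp flip: abs_hmor_simps intro!: abs_hmor_eq interchange)

text \<open>Whiskering by identity strands. Diagrams are written as products of such layers, which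
  slide past each other by \<open>lay_exchange\<close>.\<close>

definition lay :: "word \<Rightarrow> 'k::field_char_0 hmor \<Rightarrow> word \<Rightarrow> 'k hmor" where
  "lay a f b = idn a \<boxtimes> f \<boxtimes> idn b"

lemma lay_nil [simp]: "lay [] f [] = f"
  by (simp add: lay_def)

lemma lay_idn [simp]: "lay a (idn b) c = idn (a @ b @ c)"
  by (simp add: lay_def tens_idn)

lemma lay_zero [simp]: "lay a 0 c = 0"
  by (simp add: lay_def)

lemma lay_lay [simp]: "lay a (lay b f c) d = lay (a @ b) f (c @ d)"
  by (simp add: lay_def tens_assoc tens_idn tens_idn')

lemma tp_lay: "tp f s t \<Longrightarrow> tp (lay a f b) (a @ s @ b) (a @ t @ b)"
  unfolding lay_def by (intro tp_tens tp_gens)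

lemma lay_mult:
  assumes "tp g s t" "tp f t u"
  shows "lay a (f * g) b = lay a f b * lay a g b"
  unfolding lay_def
    tens_mult[OF tp_gens(1) tp_gens(1) tp_tens[OF assms(1) tp_gens(1)] tp_tens[OF assms(2) tp_gens(1)]]
    tens_mult[OF assms tp_gens(1) tp_gens(1)] idn_left[OF tp_gens(1)] ..

lemma lay_exchange:
  assumes f: "tp f s s'" and g: "tp g t t'"
  shows "lay a f (b @ t' @ c) * lay (a @ s @ b) g c = lay (a @ s' @ b) g c * lay a f (b @ t @ c)"
proof -
  have "(f \<boxtimes> idn (b @ t')) * (idn (s @ b) \<boxtimes> g) = (f \<boxtimes> idn b \<boxtimes> idn t') * (idn s \<boxtimes> idn b \<boxtimes> g)"
    by (simp add: tens_idn tens_idn')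
  also have "\<dots> = (f * idn s) \<boxtimes> ((idn b \<boxtimes> idn t') * (idn b \<boxtimes> g))"
    by (rule tens_mult[OF tp_gens(1) f tp_tens[OF tp_gens(1) g] tp_tens[OF tp_gens(1) tp_gens(1)]])
  also have "(idn b \<boxtimes> idn t') * (idn b \<boxtimes> g) = idn b \<boxtimes> g"
    by (simp add: tens_mult[OF tp_gens(1) tp_gens(1) g tp_gens(1)] idn_left[OF g] idn_left[OF tp_gens(1)])
  also have "idn b \<boxtimes> g = (idn b \<boxtimes> g) * (idn b \<boxtimes> idn t)"
    by (simp add: tens_mult[OF tp_gens(1) tp_gens(1) tp_gens(1) g] idn_right[OF g] idn_left[OF tp_gens(1)])
  also have "(f * idn s) \<boxtimes> ((idn b \<boxtimes> g) * (idn b \<boxtimes> idn t)) = (idn s' * f) \<boxtimes> ((idn b \<boxtimes> g) * (idn b \<boxtimes> idn t))"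
    by (simp add: idn_left[OF f] idn_right[OF f])
  also have "\<dots> = (idn s' \<boxtimes> idn b \<boxtimes> g) * (f \<boxtimes> idn b \<boxtimes> idn t)"
    by (rule tens_mult[OF f tp_gens(1) tp_tens[OF tp_gens(1) tp_gens(1)] tp_tens[OF tp_gens(1) g], symmetric])
  also have "\<dots> = (idn (s' @ b) \<boxtimes> g) * (f \<boxtimes> idn (b @ t))"
    by (simp add: tens_idn tens_idn')
  finally have eq: "(f \<boxtimes> idn (b @ t')) * (idn (s @ b) \<boxtimes> g) = (idn (s' @ b) \<boxtimes> g) * (f \<boxtimes> idn (b @ t))" .
  have 1: "lay a ((f \<boxtimes> idn (b @ t')) * (idn (s @ b) \<boxtimes> g)) c
      = lay a (f \<boxtimes> idn (b @ t')) c * lay a (idn (s @ b) \<boxtimes> g) c"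
    by (rule lay_mult[OF tp_tens[OF tp_gens(1) g] tp_conv[OF tp_tens[OF f tp_gens(1)]]]) simp_all
  have 2: "lay a ((idn (s' @ b) \<boxtimes> g) * (f \<boxtimes> idn (b @ t))) c
      = lay a (idn (s' @ b) \<boxtimes> g) c * lay a (f \<boxtimes> idn (b @ t)) c"
    by (rule lay_mult[OF tp_tens[OF f tp_gens(1)] tp_conv[OF tp_tens[OF tp_gens(1) g]]]) simp_all
  have 3: "lay a (h \<boxtimes> idn v) c = lay a h (v @ c)" "lay a (idn v \<boxtimes> h) c = lay (a @ v) h c" for h :: "'a hmor" and v
    by (simp_all add: lay_def tens_assoc tens_idn tens_idn')
  show ?thesis using 1 2 unfolding eq 3 by simp
qed

section \<open>Reflection of diagrams\<close>

primrec flip_dgm :: "'k dgm \<Rightarrow> 'k dgm" where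
  "flip_dgm (Idt a) = Idt a"
| "flip_dgm Cross = Cross"
| "flip_dgm (Cup x) = Cap x"
| "flip_dgm (Cap x) = Cup x"
| "flip_dgm Zero = Zero"
| "flip_dgm (Add f g) = Add (flip_dgm f) (flip_dgm g)"
| "flip_dgm (Scale c f) = Scale c (flip_dgm f)"
| "flip_dgm (Comp f g) = Comp (flip_dgm g) (flip_dgm f)"
| "flip_dgm (Tens f g) = Tens (flip_dgm f) (flip_dgm g)"

lemma typed_flip: "typed d a b \<Longrightarrow> typed (flip_dgm d) b a"
  by (induction rule: typed.induct) (auto intro: typed.intros)

text \<open>This is reflection in a horizontal line together with reversal of all orientations, so
  that words stay fixed. It exchanges the two zigzag relations and the two half-turn rotations; the
  other local relations are preserved up to associativity.\<close>

lemma heq_flip: "f \<approx> g \<Longrightarrow> flip_dgm f \<approx> flip_dgm g"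
proof (induction rule: heq.induct)
  case (Comp_assoc f g h)
  then show ?case by (simp add: heq.Comp_assoc heq_sym)
next
  case rotation
  have "flip_dgm crossQQ_l \<approx> crossQQ_r"
    unfolding crossQQ_l_def crossQQ_r_def caps2_def cups2_def flip_dgm.simps
    by (meson heq.Comp_assoc heq_sym heq_trans)
  moreover have "crossQQ_l \<approx> flip_dgm crossQQ_r"
    unfolding crossQQ_l_def crossQQ_r_def caps2_def cups2_def flip_dgm.simps
    by (meson heq.Comp_assoc heq_sym heq_trans)
  ultimately show ?case by (meson heq.rotation heq_sym heq_trans)
next
  case braid
  show ?case unfolding flip_dgm.simps by (meson heq.Comp_assoc heq.braid heq_sym heq_trans)
next
  case updown
  have 1: "flip_dgm crossQP \<approx> crossPQ" "flip_dgm crossPQ \<approx> crossQP"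
    unfolding crossQP_def crossPQ_def flip_dgm.simps by (rule heq.Comp_assoc)+
  show ?case unfolding flip_dgm.simps
    by (rule heq_trans[OF cong_Comp[OF 1(2,1)] heq.updown])
next
  case downup
  have 1: "flip_dgm crossQP \<approx> crossPQ" "flip_dgm crossPQ \<approx> crossQP"
    unfolding crossQP_def crossPQ_def flip_dgm.simps by (rule heq.Comp_assoc)+
  show ?case unfolding flip_dgm.simps
    by (rule heq_trans[OF cong_Comp[OF 1(1,2)] heq.downup])
next
  case left_curl
  show ?case unfolding flip_dgm.simps by (meson heq.Comp_assoc heq.left_curl heq_sym heq_trans)
qed (auto intro: heq.intros typed_flip)

lift_definition flip :: "'k::field_char_0 hmor \<Rightarrow> 'k hmor" is flip_dgm
  by (rule heq_flip)

lemma flip_simps [simp]: "flip (f * g) = flip g * flip f" "flip (f \<boxtimes> g) = flip f \<boxtimes> flip g"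
  "flip (f + g) = flip f + flip g" "flip (scal c f) = scal c (flip f)" "flip (idn a) = idn a"
  "flip 0 = 0" "flip cupQP = capQP" "flip capQP = cupQP" "flip cupPQ = capPQ" "flip capPQ = cupPQ"
  "flip crossPP = crossPP"
  by (transfer, simp add: heq_refl)+

lemma flip_lay [simp]: "flip (lay a f b) = lay a (flip f) b"
  by (simp add: lay_def)

lemma flip_X [simp]: "flip XPQ = XQP" "flip XQP = XPQ" "flip XQQ = XQQ"
proof -
  show "flip XPQ = XQP" "flip XQP = XPQ"
    by (transfer, unfold crossQP_def crossPQ_def flip_dgm.simps, rule heq.Comp_assoc)+
  show "flip XQQ = XQQ"
  proof transfer
    have "flip_dgm crossQQ_l \<approx> crossQQ_r"
      unfolding crossQQ_l_def crossQQ_r_def caps2_def cups2_def flip_dgm.simps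
      by (meson heq.Comp_assoc heq_sym heq_trans)
    then show "flip_dgm crossQQ_l \<approx> crossQQ_l" by (meson heq.rotation heq_sym heq_trans)
  qed
qed

section \<open>Rotated relations\<close>

lemma pull: "a * b = c \<Longrightarrow> a * (b * x) = c * (x :: 'a :: semigroup_mult)"
  by (simp flip: mult.assoc)

lemma zigzags:
  "lay [] capQP [Dn] * lay [Dn] cupPQ [] = idn [Dn]"
  "lay [Up] capQP [] * lay [] cupPQ [Up] = idn [Up]"
  using abs_hmor_eq[OF zigzag1[of Dn]] abs_hmor_eq[OF zigzag2[of Up]]
  by (simp_all add: abs_hmor_simps lay_def)

lemma circle_eq: "capQP * cupQP = idn []"
  using abs_hmor_eq[OF circle] by (simp add: abs_hmor_simps)

lemma curl_eq: "lay [] capQP [Up] * lay [Dn] crossPP [] * lay [] cupQP [Up] = 0"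
  using abs_hmor_eq[OF left_curl] by (simp add: abs_hmor_simps lay_def mult.assoc)

lemma crossPP_sq: "crossPP * crossPP = idn [Up, Up]"
  using abs_hmor_eq[OF upup] by (simp add: abs_hmor_simps)

lemma crossPP_braid:
  "lay [] crossPP [Up] * lay [Up] crossPP [] * lay [] crossPP [Up]
    = lay [Up] crossPP [] * (lay [] crossPP [Up] * lay [Up] crossPP [])"
  using abs_hmor_eq[OF braid] by (simp add: abs_hmor_simps lay_def mult.assoc)

lemma XQP_XPQ: "XQP * XPQ = idn [Up, Dn]"
  using abs_hmor_eq[OF updown] by (simp add: abs_hmor_simps XQP.abs_eq XPQ.abs_eq)

lemma XPQ_XQP: "XPQ * XQP = idn [Dn, Up] - cupQP * capQP"
  using abs_hmor_eq[OF downup] by (simp add: abs_hmor_simps XQP.abs_eq XPQ.abs_eq scal_uminus)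

text \<open>The rotation of \<open>f\<close> by a quarter turn.\<close>

definition rot :: "word \<Rightarrow> word \<Rightarrow> 'k::field_char_0 hmor \<Rightarrow> 'k hmor" where
  "rot x y f = lay [] capQP (y @ [Dn]) * (lay [Dn] f [Dn] * lay (Dn # x) cupPQ [])"

lemma tp_rot: "tp f (x @ [Up]) (Up # y) \<Longrightarrow> tp (rot x y f) (Dn # x) (y @ [Dn])"
  unfolding rot_def
  by (rule tp_conv, rule tp_mult, rule tp_mult, rule tp_lay, rule tp_gens, rule tp_lay, assumption,
      simp, rule tp_lay, rule tp_gens, simp_all)

lemma lay_rot:
  assumes "tp f (x @ [Up]) (Up # y)"
  shows "lay a (rot x y f) b = lay a capQP (y @ Dn # b) * (lay (a @ [Dn]) f (Dn # b) * lay (a @ Dn # x) cupPQ b)"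
proof -
  have 1: "tp (lay [Dn] f [Dn]) (Dn # x @ [Up, Dn]) (Dn # Up # y @ [Dn])"
    by (rule tp_conv, rule tp_lay[OF assms]) simp_all
  have 2: "tp (lay (Dn # x) cupPQ []) (Dn # x) (Dn # x @ [Up, Dn])"
    by (rule tp_conv, rule tp_lay, rule tp_gens) simp_all
  have 3: "tp (lay [] capQP (y @ [Dn])) (Dn # Up # y @ [Dn]) (y @ [Dn])"
    by (rule tp_conv, rule tp_lay, rule tp_gens) simp_all
  show ?thesis
    unfolding rot_def lay_mult[OF tp_mult[OF 2 1 refl] 3] lay_mult[OF 2 1] by simp
qed

lemma XQP_rot: "XQP = rot [Up] [Up] crossPP"
proof -
  have "XQP = abs_hmor crossQP" by (rule XQP.abs_eq)
  then show ?thesis by (simp add: crossQP_def rot_def lay_def abs_hmor_simps)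
qed

lemma tp_XQP: "tp XQP [Dn, Up] [Up, Dn]"
  unfolding XQP_rot using tp_rot[of crossPP "[Up]" "[Up]"] by (simp add: tp_gens)

lemma XQQ_rot: "XQQ = rot [Dn] [Dn] XQP"
proof -
  have "XQQ = abs_hmor crossQQ_l" by (rule XQQ.abs_eq)
  also have "\<dots> = (capQP * lay [Dn] capQP [Up]) \<boxtimes> idn [Dn, Dn] *
      (lay [Dn, Dn] crossPP [Dn, Dn] * (idn [Dn, Dn] \<boxtimes> (lay [Up] cupPQ [Dn] * cupPQ)))"
    by (simp add: crossQQ_l_def caps2_def cups2_def lay_def abs_hmor_simps)
  also have "(capQP * lay [Dn] capQP [Up]) \<boxtimes> idn [Dn, Dn]
      = lay [] (lay [] capQP [] * lay [Dn] capQP [Up]) [Dn, Dn]" by (simp add: lay_def)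
  also have "\<dots> = lay [] capQP [Dn, Dn] * lay [Dn] capQP [Up, Dn, Dn]"
    by (subst lay_mult[of _ "[Dn, Dn, Up, Up]" "[Dn, Up]" _ "[]"])
      (use tp_lay[OF tp_gens(5), of "[Dn]" "[Up]"] tp_gens(5) in simp_all)
  also have "idn [Dn, Dn] \<boxtimes> (lay [Up] cupPQ [Dn] * cupPQ)
      = lay [Dn, Dn] (lay [Up] cupPQ [Dn] * lay [] cupPQ []) []" by (simp add: lay_def)
  also have "\<dots> = lay [Dn, Dn, Up] cupPQ [Dn] * lay [Dn, Dn] cupPQ []"
    by (subst lay_mult[of _ "[]" "[Up, Dn]" _ "[Up, Up, Dn, Dn]"])
      (use tp_lay[OF tp_gens(6), of "[Up]" "[Dn]"] tp_gens(6) in simp_all)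
  finally have "XQQ = lay [] capQP [Dn, Dn] * (lay [Dn] capQP [Up, Dn, Dn] *
      (lay [Dn, Dn] crossPP [Dn, Dn] * (lay [Dn, Dn, Up] cupPQ [Dn] * lay [Dn, Dn] cupPQ [])))"
    by (simp only: mult.assoc)
  moreover have "lay [Dn] (XQP :: 'a hmor) [Dn] = lay [Dn] capQP [Up, Dn, Dn] *
      (lay [Dn, Dn] crossPP [Dn, Dn] * lay [Dn, Dn, Up] cupPQ [Dn])"
    unfolding XQP_rot by (subst lay_rot) (simp_all add: tp_gens)
  ultimately show ?thesis by (simp add: rot_def mult.assoc)
qed

lemma tp_XQQ: "tp XQQ [Dn, Dn] [Dn, Dn]"
  unfolding XQQ_rot using tp_rot[of XQP "[Dn]" "[Dn]"] by (simp add: tp_XQP)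

lemma tp_flip: "tp f a b \<Longrightarrow> tp (flip f) b a"
  unfolding tp_def using typed_flip flip.abs_eq by metis

lemma tp_XPQ: "tp XPQ [Up, Dn] [Dn, Up]"
  using tp_flip[OF tp_XQP] by simp

lemma cap_rot:
  assumes f: "tp f [x, Up] [Up, y]"
  shows "lay [y] capQP [] * lay [] (rot [x] [y] f) [Up] = lay [] capQP [y] * lay [Dn] f []"
proof -
  have e1: "lay [y] capQP [] * lay [] capQP [y, Dn, Up] = lay [] capQP [y] * lay [Dn, Up, y] capQP []"
    by (rule lay_exchange[OF tp_gens(5) tp_gens(5), of "[]" "[y]" "[]", simplified, symmetric])
  have e2: "lay [Dn, Up, y] capQP [] * lay [Dn] f [Dn, Up] = lay [Dn] f [] * lay [Dn, x, Up] capQP []"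
    using lay_exchange[OF f tp_gens(5), of "[Dn]" "[]" "[]"] by simp
  have e3: "lay [Dn, x, Up] capQP [] * lay [Dn, x] cupPQ [Up] = idn [Dn, x, Up]"
  proof -
    have "lay [Dn, x] (lay [Up] capQP [] * lay [] cupPQ [Up]) [] = idn [Dn, x, Up]"
      by (simp add: zigzags)
    then show ?thesis
      by (subst (asm) lay_mult[of _ "[Up]" "[Up, Dn, Up]" _ "[Up]"])
        (use tp_lay[OF tp_gens(5), of "[Up]" "[]"] tp_lay[OF tp_gens(6), of "[]" "[Up]"] in simp_all)
  qed
  have e4: "lay [Dn] f [] * idn [Dn, x, Up] = lay [Dn] f []"
    by (rule idn_right, rule tp_conv, rule tp_lay[OF f]) simp_all
  show ?thesis
    by (subst lay_rot) (simp_all add: f e4 mult.assoc pull[OF e1] pull[OF e2] e3)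
qed

lemma rot_whisker_left:
  assumes F: "tp F (x @ [Up]) (Up # y)" and h: "tp h y y'"
  shows "rot x y' (lay [Up] h [] * F) = lay [] h [Dn] * rot x y F"
proof -
  have 1: "lay [Dn] (lay [Up] h [] * F) [Dn] = lay [Dn, Up] h [Dn] * lay [Dn] F [Dn]"
    by (subst lay_mult[OF F]) (use tp_lay[OF h, of "[Up]" "[]"] in simp_all)
  have 2: "lay [] capQP (y' @ [Dn]) * lay [Dn, Up] h [Dn] = lay [] h [Dn] * lay [] capQP (y @ [Dn])"
    using lay_exchange[OF tp_gens(5) h, of "[]" "[]" "[Dn]"] by simp
  show ?thesis unfolding rot_def 1 by (simp only: mult.assoc pull[OF 2])
qed

lemma rot_whisker_right:
  assumes F: "tp F (x @ [Up]) (Up # y)" and k: "tp k x' x"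
  shows "rot x' y (F * lay [] k [Up]) = rot x y F * lay [Dn] k []"
proof -
  have 1: "lay [Dn] (F * lay [] k [Up]) [Dn] = lay [Dn] F [Dn] * lay [Dn] k [Up, Dn]"
    by (subst lay_mult[OF _ F]) (use tp_lay[OF k, of "[]" "[Up]"] in simp_all)
  have 2: "lay [Dn] k [Up, Dn] * lay (Dn # x') cupPQ [] = lay (Dn # x) cupPQ [] * lay [Dn] k []"
    using lay_exchange[OF k tp_gens(6), of "[Dn]" "[]" "[]"] by simp
  show ?thesis unfolding rot_def 1 by (simp only: mult.assoc 2)
qed

text \<open>Both diagrams bend one strand that crosses two others. On the right it is bent down and
  up again in between: the cap of \<open>rot [x] [z] g\<close> and the cup of
  \<open>rot [w] [y] f\<close> form a zigzag, straightened in \<open>e9\<close>.\<close>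

lemma rot_comp:
  assumes f: "tp f [w, Up] [Up, y]" and g: "tp g [x, Up] [Up, z]"
  shows "rot [w, x] [y, z] (lay [] f [z] * lay [w] g [])
    = lay [y] (rot [x] [z] g) [] * lay [] (rot [w] [y] f) [x]"
proof -
  note cap = tp_gens(5) and cup = tp_gens(6)
  have e1: "lay [y, Dn, x] cupPQ [] * lay [] capQP [y, Dn, x]
      = lay [] capQP [y, Dn, x, Up, Dn] * lay [Dn, Up, y, Dn, x] cupPQ []"
    by (rule lay_exchange[OF cap cup, of "[]" "[y, Dn, x]" "[]", simplified, symmetric])
  have e2: "lay [y, Dn] g [Dn] * lay [] capQP [y, Dn, x, Up, Dn]
      = lay [] capQP [y, Dn, Up, z, Dn] * lay [Dn, Up, y, Dn] g [Dn]"
    using lay_exchange[OF cap g, of "[]" "[y, Dn]" "[Dn]"] by simp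
  have e3: "lay [y] capQP [z, Dn] * lay [] capQP [y, Dn, Up, z, Dn]
      = lay [] capQP [y, z, Dn] * lay [Dn, Up, y] capQP [z, Dn]"
    by (rule lay_exchange[OF cap cap, of "[]" "[y]" "[z, Dn]", simplified, symmetric])
  have e4: "lay [Dn, Up, y, Dn, x] cupPQ [] * lay [Dn] f [Dn, x]
      = lay [Dn] f [Dn, x, Up, Dn] * lay [Dn, w, Up, Dn, x] cupPQ []"
    using lay_exchange[OF f cup, of "[Dn]" "[Dn, x]" "[]"] by simp
  have e5: "lay [Dn, w, Up, Dn, x] cupPQ [] * lay [Dn, w] cupPQ [x]
      = lay [Dn, w] cupPQ [x, Up, Dn] * lay [Dn, w, x] cupPQ []"
    by (rule lay_exchange[OF cup cup, of "[Dn, w]" "[x]" "[]", simplified, symmetric])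
  have e6: "lay [Dn, Up, y, Dn] g [Dn] * lay [Dn] f [Dn, x, Up, Dn]
      = lay [Dn] f [Dn, Up, z, Dn] * lay [Dn, w, Up, Dn] g [Dn]"
    using lay_exchange[OF f g, of "[Dn]" "[Dn]" "[Dn]"] by simp
  have e7: "lay [Dn, Up, y] capQP [z, Dn] * lay [Dn] f [Dn, Up, z, Dn]
      = lay [Dn] f [z, Dn] * lay [Dn, w, Up] capQP [z, Dn]"
    using lay_exchange[OF f cap, of "[Dn]" "[]" "[z, Dn]"] by simp
  have e8: "lay [Dn, w, Up, Dn] g [Dn] * lay [Dn, w] cupPQ [x, Up, Dn]
      = lay [Dn, w] cupPQ [Up, z, Dn] * lay [Dn, w] g [Dn]"
    using lay_exchange[OF cup g, of "[Dn, w]" "[]" "[Dn]"] by simp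
  have e9: "lay [Dn, w, Up] capQP [z, Dn] * lay [Dn, w] cupPQ [Up, z, Dn] = idn [Dn, w, Up, z, Dn]"
  proof -
    have "lay [Dn, w] (lay [Up] capQP [] * lay [] cupPQ [Up]) [z, Dn] = idn [Dn, w, Up, z, Dn]"
      by (simp add: zigzags)
    then show ?thesis
      by (subst (asm) lay_mult[of _ "[Up]" "[Up, Dn, Up]" _ "[Up]"])
        (use tp_lay[OF cap, of "[Up]" "[]"] tp_lay[OF cup, of "[]" "[Up]"] in simp_all)
  qed
  have e10: "idn [Dn, w, Up, z, Dn] * lay [Dn, w] g [Dn] = lay [Dn, w] g [Dn]"
    by (rule idn_left, rule tp_conv, rule tp_lay[OF g]) simp_all
  have 1: "lay [Dn] (lay [] f [z] * lay [w] g []) [Dn] = lay [Dn] f [z, Dn] * lay [Dn, w] g [Dn]"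
    by (subst lay_mult[of _ "[w, x, Up]" "[w, Up, z]" _ "[Up, y, z]"])
      (use tp_lay[OF f, of "[]" "[z]"] tp_lay[OF g, of "[w]" "[]"] in simp_all)
  have 2: "lay [y] (rot [x] [z] g) [] = lay [y] capQP [z, Dn] * (lay [y, Dn] g [Dn] * lay [y, Dn, x] cupPQ [])"
    by (subst lay_rot) (simp_all add: g)
  have 3: "lay [] (rot [w] [y] f) [x] = lay [] capQP [y, Dn, x] * (lay [Dn] f [Dn, x] * lay [Dn, w] cupPQ [x])"
    by (subst lay_rot) (simp_all add: f)
  show ?thesis
    unfolding 2 3
    unfolding rot_def append.simps 1
    by (simp only: mult.assoc pull[OF e1] pull[OF e2] pull[OF e3] pull[OF e4] e5 pull[OF e6]
        pull[OF e7] pull[OF e8] pull[OF e9] pull[OF e10])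
qed

lemma tp_lay_comp2:
  assumes "tp f [w, Up] [Up, y]" "tp g [x, Up] [Up, z]"
  shows "tp (lay [] f [z] * lay [w] g []) [w, x, Up] [Up, y, z]"
  using tp_mult[OF tp_lay[OF assms(2), of "[w]" "[]"] tp_lay[OF assms(1), of "[]" "[z]"]] by simp

text \<open>Rotating the strands of the braid relation one after the other.\<close>

lemma braid_QPP:
  "lay [Up] XQP [] * (lay [] XQP [Up] * lay [Dn] crossPP [])
    = lay [] crossPP [Dn] * lay [Up] XQP [] * lay [] XQP [Up]"
proof -
  note c = tp_gens(3)
  let ?A = "lay [] crossPP [Up] * lay [Up] crossPP [] :: 'a hmor"
  have A: "tp ?A ([Up, Up] @ [Up]) (Up # [Up, Up])" using tp_lay_comp2[OF c c] by simp
  have rA: "rot [Up, Up] [Up, Up] ?A = lay [Up] XQP [] * lay [] XQP [Up]"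
    by (simp add: rot_comp[OF c c] XQP_rot)
  have "rot [Up, Up] [Up, Up] (?A * lay [] crossPP [Up]) = rot [Up, Up] [Up, Up] (lay [Up] crossPP [] * ?A)"
    by (simp only: crossPP_braid)
  then show ?thesis
    unfolding rot_whisker_left[OF A c] rot_whisker_right[OF A c] rA by (simp only: mult.assoc)
qed

lemma braid_QQP:
  "lay [] XQP [Dn] * lay [Dn] XQP [] * lay [] XQQ [Up]
    = lay [Up] XQQ [] * (lay [] XQP [Dn] * lay [Dn] XQP [])"
proof -
  note c = tp_gens(3) and q = tp_XQP
  let ?A = "lay [] XQP [Up] * lay [Dn] crossPP [] :: 'a hmor"
  let ?B = "lay [] crossPP [Dn] * lay [Up] XQP [] :: 'a hmor"
  have A: "tp ?A ([Dn, Up] @ [Up]) (Up # [Dn, Up])" using tp_lay_comp2[OF q c] by simp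
  have B: "tp ?B ([Up, Dn] @ [Up]) (Up # [Up, Dn])" using tp_lay_comp2[OF c q] by simp
  have rA: "rot [Dn, Up] [Dn, Up] ?A = lay [Dn] XQP [] * lay [] XQQ [Up]"
    unfolding rot_comp[OF q c] by (simp add: XQP_rot[symmetric] XQQ_rot[symmetric])
  have rB: "rot [Up, Dn] [Up, Dn] ?B = lay [Up] XQQ [] * lay [] XQP [Dn]"
    unfolding rot_comp[OF c q] by (simp add: XQP_rot[symmetric] XQQ_rot[symmetric])
  have "rot [Dn, Up] [Up, Dn] (lay [Up] XQP [] * ?A) = rot [Dn, Up] [Up, Dn] (?B * lay [] XQP [Up])"
    by (simp only: braid_QPP)
  then show ?thesis
    unfolding rot_whisker_left[OF A q] rot_whisker_right[OF B q] rA rB by (simp only: mult.assoc)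
qed

lemma braid_QQQ:
  "lay [] XQQ [Dn] * lay [Dn] XQQ [] * lay [] XQQ [Dn]
    = lay [Dn] XQQ [] * lay [] XQQ [Dn] * lay [Dn] XQQ []"
proof -
  note q = tp_XQP and r = tp_XQQ
  let ?A = "lay [] XQP [Dn] * lay [Dn] XQP [] :: 'a hmor"
  have A: "tp ?A ([Dn, Dn] @ [Up]) (Up # [Dn, Dn])" using tp_lay_comp2[OF q q] by simp
  have rA: "rot [Dn, Dn] [Dn, Dn] ?A = lay [Dn] XQQ [] * lay [] XQQ [Dn]"
    unfolding rot_comp[OF q q] by (simp add: XQQ_rot[symmetric])
  have "rot [Dn, Dn] [Dn, Dn] (?A * lay [] XQQ [Up]) = rot [Dn, Dn] [Dn, Dn] (lay [Up] XQQ [] * ?A)"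
    by (simp only: braid_QQP)
  then show ?thesis
    unfolding rot_whisker_left[OF A r] rot_whisker_right[OF A r] rA by (simp only: mult.assoc)
qed

lemma cap_XQQ: "lay [Dn] capQP [] * lay [] XQQ [Up] = lay [] capQP [Dn] * lay [Dn] XQP []"
  unfolding XQQ_rot by (rule cap_rot[OF tp_XQP])

lemma cap_XQP: "lay [Up] capQP [] * lay [] XQP [Up] = lay [] capQP [Up] * lay [Dn] crossPP []"
  by (subst XQP_rot) (rule cap_rot[OF tp_gens(3)])

text \<open>The nested caps \<open>C\<close> turn a crossing of downward strands into one of upward
  strands, where the double crossing is trivial. The nested cups \<open>U\<close> undo the caps by
  zigzags.\<close>

lemma XQQ_sq: "XQQ * XQQ = (idn [Dn, Dn] :: 'k::field_char_0 hmor)"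
proof -
  note cap = tp_gens(5) and cup = tp_gens(6)
  define C :: "'k hmor" where "C = lay [] capQP [] * lay [Dn] capQP [Up]"
  define U :: "'k hmor" where "U = lay [Up] cupPQ [Dn] * lay [] cupPQ []"
  have tpC: "tp C [Dn, Dn, Up, Up] []"
    unfolding C_def using tp_mult[OF tp_lay[OF cap, of "[Dn]" "[Up]"] tp_lay[OF cap, of "[]" "[]"]] by simp
  have tpU: "tp U [] [Up, Up, Dn, Dn]"
    unfolding U_def using tp_mult[OF tp_lay[OF cup, of "[]" "[]"] tp_lay[OF cup, of "[Up]" "[Dn]"]] by simp
  have tph: "tp (XQQ * XQQ :: 'k hmor) [Dn, Dn] [Dn, Dn]" using tp_mult[OF tp_XQQ tp_XQQ] by simp
  have C1: "C * lay [] XQQ [Up, Up] = C * lay [Dn, Dn] crossPP []"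
  proof -
    have 1: "lay [Dn] capQP [Up] * lay [] XQQ [Up, Up] = lay [] capQP [Dn, Up] * lay [Dn] (XQP :: 'k hmor) [Up]"
    proof -
      have "lay [] (lay [Dn] capQP [] * lay [] XQQ [Up]) [Up] = lay [] (lay [] capQP [Dn] * lay [Dn] (XQP :: 'k hmor) []) [Up]"
        by (simp only: cap_XQQ)
      moreover have "tp (lay [] (XQQ :: 'k hmor) [Up]) [Dn, Dn, Up] [Dn, Dn, Up]"
        "tp (lay [Dn] (capQP :: 'k hmor) []) [Dn, Dn, Up] [Dn]"
        "tp (lay [Dn] (XQP :: 'k hmor) []) [Dn, Dn, Up] [Dn, Up, Dn]"
        "tp (lay [] (capQP :: 'k hmor) [Dn]) [Dn, Up, Dn] [Dn]"
        using tp_lay[OF tp_XQQ, of "[]" "[Up]"] tp_lay[OF cap, of "[Dn]" "[]"]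
          tp_lay[OF tp_XQP, of "[Dn]" "[]"] tp_lay[OF cap, of "[]" "[Dn]"] by simp_all
      ultimately show ?thesis by (simp add: lay_mult)
    qed
    have 2: "lay [] capQP [] * lay [] capQP [Dn, Up] = lay [] capQP [] * (lay [Dn, Up] capQP [] :: 'k hmor)"
      by (rule lay_exchange[OF cap cap, of "[]" "[]" "[]", unfolded append.simps, symmetric])
    have 3: "lay [Dn, Up] capQP [] * lay [Dn] XQP [Up] = lay [Dn] capQP [Up] * lay [Dn, Dn] (crossPP :: 'k hmor) []"
    proof -
      have "lay [Dn] (lay [Up] capQP [] * lay [] XQP [Up]) [] = lay [Dn] (lay [] capQP [Up] * lay [Dn] (crossPP :: 'k hmor) []) []"
        by (simp only: cap_XQP)
      moreover have "tp (lay [] (XQP :: 'k hmor) [Up]) [Dn, Up, Up] [Up, Dn, Up]"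
        "tp (lay [Up] (capQP :: 'k hmor) []) [Up, Dn, Up] [Up]"
        "tp (lay [Dn] (crossPP :: 'k hmor) []) [Dn, Up, Up] [Dn, Up, Up]"
        "tp (lay [] (capQP :: 'k hmor) [Up]) [Dn, Up, Up] [Up]"
        using tp_lay[OF tp_XQP, of "[]" "[Up]"] tp_lay[OF cap, of "[Up]" "[]"]
          tp_lay[OF tp_gens(3), of "[Dn]" "[]"] tp_lay[OF cap, of "[]" "[Up]"] by simp_all
      ultimately show ?thesis by (simp add: lay_mult)
    qed
    show ?thesis unfolding C_def by (simp only: mult.assoc 1 pull[OF 2] 3)
  qed
  have ex: "lay [Dn, Dn] crossPP [] * lay [] XQQ [Up, Up] = lay [] XQQ [Up, Up] * lay [Dn, Dn] (crossPP :: 'k hmor) []"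
    by (rule lay_exchange[OF tp_XQQ tp_gens(3), of "[]" "[]" "[]", simplified, symmetric])
  have "C * lay [] (XQQ * XQQ) [Up, Up] = C * (lay [] XQQ [Up, Up] * lay [] XQQ [Up, Up])"
    by (subst lay_mult[OF tp_XQQ tp_XQQ]) simp
  also have "\<dots> = C * (lay [Dn, Dn] crossPP [] * lay [Dn, Dn] crossPP [])"
    by (simp only: pull[OF C1] mult.assoc ex C1)
  also have "lay [Dn, Dn] crossPP [] * lay [Dn, Dn] crossPP [] = (idn [Dn, Dn, Up, Up] :: 'k hmor)"
    using lay_mult[OF tp_gens(3) tp_gens(3), of "[Dn, Dn]" "[]", symmetric] by (simp add: crossPP_sq)
  also have "C * idn [Dn, Dn, Up, Up] = C" by (rule idn_right[OF tpC])
  finally have Ch: "C * lay [] (XQQ * XQQ) [Up, Up] = C" .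
  have zz: "lay [] C [Dn, Dn] * lay [Dn, Dn] U [] = idn [Dn, Dn]"
  proof -
    have lC: "lay [] C [Dn, Dn] = lay [] capQP [Dn, Dn] * (lay [Dn] capQP [Up, Dn, Dn] :: 'k hmor)"
      unfolding C_def
      by (subst lay_mult[of _ "[Dn, Dn, Up, Up]" "[Dn, Up]" _ "[]"])
        (use tp_lay[OF cap, of "[Dn]" "[Up]"] cap in simp_all)
    have lU: "lay [Dn, Dn] U [] = lay [Dn, Dn, Up] cupPQ [Dn] * (lay [Dn, Dn] cupPQ [] :: 'k hmor)"
      unfolding U_def
      by (subst lay_mult[of _ "[]" "[Up, Dn]" _ "[Up, Up, Dn, Dn]"])
        (use tp_lay[OF cup, of "[Up]" "[Dn]"] cup in simp_all)
    have 1: "lay [Dn] capQP [Up, Dn, Dn] * lay [Dn, Dn, Up] cupPQ [Dn]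
        = lay [Dn] cupPQ [Dn] * (lay [Dn] capQP [Dn] :: 'k hmor)"
      by (rule lay_exchange[OF cap cup, of "[Dn]" "[]" "[Dn]", simplified])
    have z: "tp (lay [Dn] (cupPQ :: 'k hmor) []) [Dn] [Dn, Up, Dn]" "tp (lay [] (capQP :: 'k hmor) [Dn]) [Dn, Up, Dn] [Dn]"
      using tp_lay[OF cup, of "[Dn]" "[]"] tp_lay[OF cap, of "[]" "[Dn]"] by simp_all
    have 2: "lay [] capQP [Dn, Dn] * lay [Dn] cupPQ [Dn] = (idn [Dn, Dn] :: 'k hmor)"
      using lay_mult[OF z, of "[]" "[Dn]"] by (simp add: zigzags)
    have 3: "lay [Dn] capQP [Dn] * lay [Dn, Dn] cupPQ [] = (idn [Dn, Dn] :: 'k hmor)"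
      using lay_mult[OF z, of "[Dn]" "[]"] by (simp add: zigzags)
    have "lay [] C [Dn, Dn] * lay [Dn, Dn] U [] = lay [] capQP [Dn, Dn] * (lay [Dn] cupPQ [Dn] *
        (lay [Dn] capQP [Dn] * lay [Dn, Dn] cupPQ []))"
      unfolding lC lU by (simp only: mult.assoc pull[OF 1])
    also have "\<dots> = idn [Dn, Dn]" by (simp only: 3 pull[OF 2] idn_left[OF tp_gens(1)])
    finally show ?thesis .
  qed
  have "XQQ * XQQ = lay [] C [Dn, Dn] * lay [Dn, Dn] U [] * lay [] (XQQ * XQQ) []"
    by (simp add: zz idn_left[OF tph])
  also have "\<dots> = lay [] C [Dn, Dn] * (lay [] (XQQ * XQQ) [Up, Up, Dn, Dn] * lay [Dn, Dn] U [])"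
    using lay_exchange[OF tph tpU, of "[]" "[]" "[]"] by (simp add: mult.assoc)
  also have "\<dots> = lay [] (C * lay [] (XQQ * XQQ) [Up, Up]) [Dn, Dn] * lay [Dn, Dn] U []"
    by (subst lay_mult[OF tp_conv[OF tp_lay[OF tph]] tpC]) (simp_all add: mult.assoc)
  also have "\<dots> = idn [Dn, Dn]" by (simp add: Ch zz)
  finally show ?thesis .
qed

text \<open>Sliding \<open>cupPQ\<close> below the other cup exhibits a left curl on an upward
  strand.\<close>

lemma XQP_cup: "XQP * cupQP = 0"
proof -
  note cap = tp_gens(5) and cup = tp_gens(6) and cup' = tp_gens(4)
  have 1: "lay [Dn, Up] cupPQ [] * lay [] cupQP [] = lay [] cupQP [Up, Dn] * (lay [] cupPQ [] :: 'a hmor)"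
    by (rule lay_exchange[OF cup' cup, of "[]" "[]" "[]", unfolded append.simps, symmetric])
  have t: "tp (lay [] (cupQP :: 'a hmor) [Up]) [Up] [Dn, Up, Up]" "tp (lay [Dn] (crossPP :: 'a hmor) []) [Dn, Up, Up] [Dn, Up, Up]"
    "tp (lay [] (capQP :: 'a hmor) [Up]) [Dn, Up, Up] [Up]"
    using tp_lay[OF cup', of "[]" "[Up]"] tp_lay[OF tp_gens(3), of "[Dn]" "[]"] tp_lay[OF cap, of "[]" "[Up]"]
    by simp_all
  have "lay [] (lay [] capQP [Up] * (lay [Dn] crossPP [] * lay [] cupQP [Up])) [Dn] = (0 :: 'a hmor)"
    by (simp only: curl_eq[unfolded mult.assoc] lay_zero)
  then have 2: "lay [] capQP [Up, Dn] * (lay [Dn] crossPP [Dn] * lay [] cupQP [Up, Dn]) = (0 :: 'a hmor)"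
    by (simp add: lay_mult[OF tp_mult[OF t(1,2) refl] t(3)] lay_mult[OF t(1,2)])
  have "XQP * cupQP = lay [] capQP [Up, Dn] * (lay [Dn] crossPP [Dn] *
      (lay [Dn, Up] cupPQ [] * lay [] (cupQP :: 'a hmor) []))"
    by (simp add: XQP_rot rot_def mult.assoc)
  also have "\<dots> = lay [] capQP [Up, Dn] * (lay [Dn] crossPP [Dn] * lay [] cupQP [Up, Dn]) * lay [] cupPQ []"
    by (simp only: 1 mult.assoc)
  finally show ?thesis by (simp add: 2)
qed

lemma XQQ_cup: "lay [] XQQ [Up] * lay [Dn] cupQP [] = lay [Dn] XPQ [] * lay [] cupQP [Dn]"
  using arg_cong[OF cap_XQQ, of flip] by simp

lemma curl_QQ: "lay [Dn] capQP [] * lay [] XQQ [Up] * lay [Dn] cupQP [] = 0"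
proof -
  have "lay [Dn] capQP [] * lay [] XQQ [Up] * lay [Dn] cupQP [] = lay [] capQP [Dn] * lay [Dn] (XQP * cupQP) []"
    unfolding cap_XQQ lay_mult[OF tp_gens(4) tp_XQP] by (simp add: mult.assoc)
  then show ?thesis by (simp add: XQP_cup)
qed

section \<open>Permutations of downward strands\<close>

lemma Qpow_add: "Qpow a @ Qpow b = Qpow (a + b)"
  by (simp add: Qpow_def replicate_add)

lemma Qpow_simps: "Qpow 0 = []" "Qpow (Suc n) = Qpow n @ [Dn]"
  by (simp_all add: Qpow_def replicate_append_same)

lemma Qpow_Cons: "Dn # Qpow n = Qpow (Suc n)"
  by (simp add: Qpow_def)

lemma Qpow_sigma: "i < r - 1 \<Longrightarrow> Qpow i @ [Dn, Dn] @ Qpow (r - 2 - i) = Qpow r"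
proof -
  assume "i < r - 1"
  then have "r = i + 2 + (r - 2 - i)" by simp
  then show ?thesis using Qpow_add[of "i + 2" "r - 2 - i"]
    by (metis Qpow_add append.assoc append_Cons append_Nil Qpow_simps(1) Qpow_Cons one_add_one plus_1_eq_Suc Suc_1)
qed

lemma sigma_lay: "sigma r i = lay (Qpow i) XQQ (Qpow (r - 2 - i))"
  by (simp add: sigma_def lay_def)

lemma tp_sigma: "i < r - 1 \<Longrightarrow> tp (sigma r i) (Qpow r) (Qpow r)"
  using tp_lay[OF tp_XQQ, of "Qpow i" "Qpow (r - 2 - i)"] Qpow_sigma[of i r] by (simp add: sigma_lay)

lemma sigma_sq: "i < r - 1 \<Longrightarrow> sigma r i * sigma r i = idn (Qpow r)"
  using Qpow_sigma[of i r] by (simp add: sigma_lay XQQ_sq flip: lay_mult[OF tp_XQQ tp_XQQ])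

lemma tp_XQQ3: "tp (lay [] XQQ [Dn]) [Dn, Dn, Dn] [Dn, Dn, Dn]" "tp (lay [Dn] XQQ []) [Dn, Dn, Dn] [Dn, Dn, Dn]"
  using tp_lay[OF tp_XQQ, of "[]" "[Dn]"] tp_lay[OF tp_XQQ, of "[Dn]" "[]"] by simp_all

lemma sigma_braid:
  assumes "Suc i < r - 1"
  shows "sigma r i * (sigma r (Suc i) * sigma r i) = sigma r (Suc i) * (sigma r i * sigma r (Suc i))"
proof -
  have r: "r - 2 - i = Suc (r - 2 - Suc i)" using assms by simp
  let ?b = "Qpow (r - 2 - Suc i)"
  have 1: "sigma r i = lay (Qpow i) (lay [] XQQ [Dn]) ?b" "sigma r (Suc i) = lay (Qpow i) (lay [Dn] XQQ []) ?b"
    unfolding sigma_lay r by (simp_all add: Qpow_Cons Qpow_simps(2))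
  have "lay (Qpow i) (lay [] XQQ [Dn] * lay [Dn] XQQ [] * lay [] XQQ [Dn]) ?b
      = lay (Qpow i) (lay [Dn] XQQ [] * lay [] XQQ [Dn] * lay [Dn] XQQ []) ?b"
    by (simp only: braid_QQQ)
  then show ?thesis
    unfolding 1 mult.assoc
      lay_mult[OF tp_mult[OF tp_XQQ3(1) tp_XQQ3(2) refl] tp_XQQ3(1)] lay_mult[OF tp_XQQ3(1) tp_XQQ3(2)]
      lay_mult[OF tp_mult[OF tp_XQQ3(2) tp_XQQ3(1) refl] tp_XQQ3(2)] lay_mult[OF tp_XQQ3(2) tp_XQQ3(1)] .
qed

lemma sigma_far:
  assumes "Suc i < j" "j < r - 1"
  shows "sigma r i * sigma r j = sigma r j * sigma r i"
proof -
  define b where "b = j - i - 2"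
  define c where "c = r - 2 - j"
  have eq: "j = i + 2 + b" "r - 2 - i = b + (2 + c)" using assms by (simp_all add: b_def c_def)
  have D2: "Qpow 2 = [Dn, Dn]" by (simp add: Qpow_def numeral_2_eq_2)
  have "lay (Qpow i) XQQ (Qpow b @ [Dn, Dn] @ Qpow c) * lay (Qpow i @ [Dn, Dn] @ Qpow b) XQQ (Qpow c)
      = lay (Qpow i @ [Dn, Dn] @ Qpow b) XQQ (Qpow c) * lay (Qpow i) XQQ (Qpow b @ [Dn, Dn] @ Qpow c)"
    by (rule lay_exchange[OF tp_XQQ tp_XQQ])
  then show ?thesis
    unfolding sigma_lay eq(2) c_def[symmetric] unfolding eq(1) D2[symmetric] Qpow_add by (simp add: add.assoc)
qed

section \<open>Words in the crossings and the Coxeter presentation\<close>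

lemma word_dgm_simps: "word_dgm r [] = idn (Qpow r)" "word_dgm r (i # w) = sigma r i * word_dgm r w"
  by (simp_all add: word_dgm_def)

lemma tp_word_dgm: "set w \<subseteq> {..<r - 1} \<Longrightarrow> tp (word_dgm r w) (Qpow r) (Qpow r)"
  by (induction w) (auto simp: word_dgm_simps tp_gens intro!: tp_mult tp_sigma)

lemma word_dgm_append:
  "set u \<subseteq> {..<r - 1} \<Longrightarrow> set v \<subseteq> {..<r - 1} \<Longrightarrow> word_dgm r (u @ v) = word_dgm r u * word_dgm r v"
  by (induction u) (auto simp: word_dgm_simps mult.assoc idn_left[OF tp_word_dgm])

definition wperm :: "nat list \<Rightarrow> fperm" where
  "wperm w = foldr (\<lambda>i g. tra i (Suc i) + g) w 0"

lemma wperm_simps: "wperm [] = 0" "wperm (i # w) = tra i (Suc i) + wperm w"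
  by (simp_all add: wperm_def)

lemma wperm_append: "wperm (u @ v) = wperm u + wperm v"
  by (induction u) (simp_all add: wperm_simps add.assoc)

lemma ap_wperm: "ap (wperm w) = word_perm w"
  by (induction w) (simp_all add: wperm_simps word_perm_def ap_zero_fun ap_plus_fun ap_tra_fun)

lemma wperm_rev: "wperm (rev w) = - wperm w"
  by (induction w) (simp_all add: wperm_simps wperm_append minus_add)

lemma wperm_symg: "set w \<subseteq> {..<r - 1} \<Longrightarrow> wperm w \<in> symg r"
  by (induction w) (auto simp: wperm_simps intro!: symg_plus symg_tra)

text \<open>Rewriting that preserves both the permutation and the diagram. The \<open>itself\<close>
  argument fixes the coefficient field, which the words do not determine.\<close>

definition weq :: "'k::field_char_0 itself \<Rightarrow> nat \<Rightarrow> nat list \<Rightarrow> nat list \<Rightarrow> bool" where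
  "weq T r u v \<longleftrightarrow> wperm u = wperm v \<and> word_dgm r u = (word_dgm r v :: 'k hmor)"

lemma weq_trans: "weq T r u v \<Longrightarrow> weq T r v w \<Longrightarrow> weq T r u w"
  by (simp add: weq_def)

lemma weq_refl [simp]: "weq T r u u"
  by (simp add: weq_def)

lemma weq_append:
  assumes "weq T r u u'" "weq T r v v'" "set (u @ u' @ v @ v') \<subseteq> {..<r - 1}"
  shows "weq T r (u @ v) (u' @ v')"
  using assms by (simp add: weq_def wperm_append word_dgm_append)

lemma weq_far:
  assumes "\<And>j. j \<in> set u \<Longrightarrow> Suc i < j \<or> Suc j < i" "set u \<subseteq> {..<r - 1}" "i < r - 1"
  shows "weq T r (u @ [i]) (i # u)"
  using assms
proof (induction u)
  case (Cons j u)
  from Cons have IH: "weq T r (u @ [i]) (i # u)" by simp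
  have far: "Suc i < j \<or> Suc j < i" using Cons.prems(1)[of j] by simp
  have "tra j (Suc j) + tra i (Suc i) = tra i (Suc i) + tra j (Suc j)"
    using far by (intro fperm_eqI) auto
  then have 1: "tra j (Suc j) + (tra i (Suc i) + h) = tra i (Suc i) + (tra j (Suc j) + h)" for h
    by (simp flip: add.assoc)
  have "sigma r j * sigma r i = sigma r i * (sigma r j :: 'a hmor)"
    using far
  proof
    assume "Suc i < j"
    then show ?thesis by (rule sigma_far[symmetric]) (use Cons.prems in auto)
  next
    assume "Suc j < i"
    then show ?thesis by (rule sigma_far) (use Cons.prems in auto)
  qed
  from pull[OF this] have 2: "sigma r j * (sigma r i * h) = sigma r i * (sigma r j * (h :: 'a hmor))" for h
    by (simp add: mult.assoc)
  show ?case using IH 1 2 by (simp add: weq_def wperm_simps word_dgm_simps)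
qed simp

lemma weq_sq: "i < r - 1 \<Longrightarrow> weq T r [i, i] []"
  unfolding weq_def
proof
  assume i: "i < r - 1"
  show "wperm [i, i] = wperm []" by (rule fperm_eqI) (simp add: wperm_simps)
  show "word_dgm r [i, i] = word_dgm r []"
    using i by (simp add: word_dgm_simps sigma_sq idn_right[OF tp_sigma])
qed

lemma weq_braid:
  assumes "Suc i < r - 1"
  shows "weq T r [Suc i, i, Suc i] [i, Suc i, i]"
  unfolding weq_def
proof
  show "wperm [Suc i, i, Suc i] = wperm [i, Suc i, i]"
    by (rule fperm_eqI) (auto simp: wperm_simps)
  show "word_dgm r [Suc i, i, Suc i] = word_dgm r [i, Suc i, i]"
    using assms by (simp add: word_dgm_simps idn_right[OF tp_sigma] sigma_braid[OF assms])
qed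

text \<open>Every word in the generators below \<open>Suc k\<close> can be rewritten so that \<open>k\<close> occurs in it only
  in a final descending run.\<close>

lemma normal_form:
  assumes "set w \<subseteq> {..<Suc k}" "Suc k \<le> r - 1"
  shows "\<exists>w' j. set w' \<subseteq> {..<k} \<and> j \<le> Suc k \<and> weq T r w (w' @ rev [j..<Suc k])"
  using assms(1)
proof (induction w rule: rev_induct)
  case Nil
  then show ?case by (intro exI[of _ "[]"] exI[of _ "Suc k"]) simp
next
  case (snoc i w)
  then obtain w' j where w': "set w' \<subseteq> {..<k}" "j \<le> Suc k" "weq T r w (w' @ rev [j..<Suc k])" by auto
  have i: "i \<le> k" using snoc.prems by simp
  have sub: "set w \<subseteq> {..<r - 1}" "set w' \<subseteq> {..<r - 1}" "i < r - 1" "\<And>x. x < Suc k \<Longrightarrow> x < r - 1"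
    using snoc.prems w'(1) assms(2) by (auto simp: subset_eq)
  have w: "weq T r (w @ [i]) ((w' @ rev [j..<Suc k]) @ [i])"
    by (rule weq_append[OF w'(3)]) (use sub w'(2) in \<open>auto simp: subset_eq\<close>)
  have goal: ?case if v: "weq T r (rev [j..<Suc k] @ [i]) (v @ rev [j'..<Suc k])" "set v \<subseteq> {..<k}" "j' \<le> Suc k" for v j'
  proof -
    have "weq T r (w' @ (rev [j..<Suc k] @ [i])) (w' @ (v @ rev [j'..<Suc k]))"
      by (rule weq_append[OF weq_refl v(1)])
        (use sub v(2) i w'(1) in \<open>auto simp: subset_eq intro: less_trans[OF _ sub(4)[of k]]\<close>)
    then have "weq T r (w @ [i]) ((w' @ v) @ rev [j'..<Suc k])"
      using weq_trans[OF w] by simp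
    then show ?thesis using w'(1) v(2,3) by (intro exI[of _ "w' @ v"] exI[of _ j']) auto
  qed
  consider "Suc i = j" | "i = j" | "Suc i < j" | "j < i" by linarith
  then show ?case
  proof cases
    case 1
    then have "rev [j..<Suc k] @ [i] = [] @ rev [i..<Suc k]" using i by (simp add: upt_conv_Cons)
    then show ?thesis using i by (intro goal[of "[]" i]) auto
  next
    case 2
    have "rev [j..<Suc k] @ [i] = rev [Suc j..<Suc k] @ [i, i]" using i 2 by (simp add: upt_conv_Cons)
    moreover have "weq T r (rev [Suc j..<Suc k] @ [i, i]) (rev [Suc j..<Suc k] @ [])"
      by (rule weq_append[OF weq_refl weq_sq[OF sub(3)]]) (use sub in auto)
    ultimately show ?thesis using i 2 by (intro goal[of "[]" "Suc j"]) auto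
  next
    case 3
    have "weq T r (rev [j..<Suc k] @ [i]) (i # rev [j..<Suc k])"
      by (rule weq_far) (use 3 sub in auto)
    then show ?thesis using 3 w'(2) by (intro goal[of "[i]" j]) auto
  next
    \<comment> \<open>Here \<open>i\<close> and \<open>i - 1\<close> both occur in the run. The
      letter commutes with everything below \<open>i - 1\<close>, the braid relation turns it into
      \<open>i - 1\<close>, and this commutes with everything above \<open>i\<close>.\<close>
    case 4
    then obtain i' where i': "i = Suc i'" by (cases i) auto
    let ?u = "rev [Suc i..<Suc k]" and ?v = "rev [j..<i']"
    have "[j..<Suc k] = [j..<i'] @ [i', i] @ [Suc i..<Suc k]"
    proof -
      have "[j..<Suc k] = [j..<i'] @ [i'..<Suc k]"
        using 4 i i' upt_add_eq_append[of j i' "Suc k - i'"] by simp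
      also have "[i'..<Suc k] = i' # i # [Suc i..<Suc k]" using i i' by (simp add: upt_conv_Cons)
      finally show ?thesis by simp
    qed
    then have D: "rev [j..<Suc k] = ?u @ [i, i'] @ ?v" by simp
    have setuv: "set ?u \<subseteq> {..<r - 1}" "set ?v \<subseteq> {..<r - 1}" "i' < r - 1"
      using sub i i' by auto
    have "weq T r (?v @ [i]) (i # ?v)" by (rule weq_far) (use i' setuv sub in auto)
    from weq_append[OF weq_refl[of T r "?u @ [i, i']"] this]
    have 1: "weq T r (rev [j..<Suc k] @ [i]) (?u @ [i, i', i] @ ?v)"
      unfolding D append_assoc append.simps using setuv sub(3) by simp
    have "weq T r [i, i', i] [i', i, i']" unfolding i' by (rule weq_braid) (use sub i' in auto)
    from weq_append[OF weq_refl[of T r ?u] weq_append[OF this weq_refl[of T r ?v]]]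
    have 2: "weq T r (?u @ [i, i', i] @ ?v) (?u @ [i', i, i'] @ ?v)"
      unfolding append_assoc append.simps using setuv sub(3) by simp
    have "weq T r (?u @ [i']) (i' # ?u)" by (rule weq_far) (use i' setuv in auto)
    from weq_append[OF this weq_refl[of T r "[i, i'] @ ?v"]]
    have 3: "weq T r (?u @ [i', i, i'] @ ?v) (i' # rev [j..<Suc k])"
      unfolding D append_assoc append.simps using setuv sub(3) by simp
    have "weq T r (rev [j..<Suc k] @ [i]) (i' # rev [j..<Suc k])"
      by (rule weq_trans[OF 1 weq_trans[OF 2 3]])
    then show ?thesis using i i' w'(2) by (intro goal[of "[i']" j]) auto
  qed
qed

lemma wperm_run: "j \<le> k \<Longrightarrow> ap (wperm (rev [j..<k])) j = k"
proof (induction k)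
  case (Suc k)
  then show ?case by (cases "j = Suc k") (auto simp: wperm_simps le_Suc_eq)
qed (simp add: wperm_simps)

text \<open>In normal form the lower end of the final run is the point sent to \<open>Suc k\<close>,
  so the permutation determines the run. It cancels, and the remaining words have one generator
  less.\<close>

lemma wperm_eq_imp:
  assumes "set u \<subseteq> {..<k}" "set v \<subseteq> {..<k}" "k \<le> r - 1" "wperm u = wperm v"
  shows "word_dgm r u = (word_dgm r v :: 'k::field_char_0 hmor)"
  using assms
proof (induction k arbitrary: u v)
  case (Suc k)
  obtain u' j where u: "set u' \<subseteq> {..<k}" "j \<le> Suc k" "weq TYPE('k) r u (u' @ rev [j..<Suc k])"
    using normal_form[OF Suc.prems(1,3)] by blast
  obtain v' l where v: "set v' \<subseteq> {..<k}" "l \<le> Suc k" "weq TYPE('k) r v (v' @ rev [l..<Suc k])"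
    using normal_form[OF Suc.prems(2,3)] by blast
  have fix_k: "ap (wperm w) (Suc k) = Suc k" if "set w \<subseteq> {..<k}" for w
    using wperm_symg[of w "Suc k"] that by (simp add: symgD)
  have eq: "wperm u' + wperm (rev [j..<Suc k]) = wperm v' + wperm (rev [l..<Suc k])"
    using u(3) v(3) Suc.prems(4) by (simp add: weq_def wperm_append)
  have "ap (wperm u' + wperm (rev [j..<Suc k])) j = Suc k"
    using wperm_run[OF u(2)] fix_k[OF u(1)] by (simp del: upt_Suc)
  moreover have "ap (wperm v' + wperm (rev [l..<Suc k])) l = Suc k"
    using wperm_run[OF v(2)] fix_k[OF v(1)] by (simp del: upt_Suc)
  ultimately have jl: "j = l" using eq by (metis ap_eq_iff)
  then have "wperm u' = wperm v'" using eq by simp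
  then have "word_dgm r u' = (word_dgm r v' :: 'k hmor)"
    using Suc.IH[OF u(1) v(1)] Suc.prems(3) by simp
  moreover have "set u' \<subseteq> {..<r - 1}" "set v' \<subseteq> {..<r - 1}" "set (rev [j..<Suc k]) \<subseteq> {..<r - 1}"
    using u v Suc.prems(3) by auto
  ultimately show ?case using u(3) v(3) jl by (simp add: weq_def word_dgm_append del: upt_Suc)
qed simp

lemma ex_word: "g \<in> symg r \<Longrightarrow> \<exists>w. set w \<subseteq> {..<r - 1} \<and> wperm w = g"
proof (induction r arbitrary: g)
  case 0
  then have "g = 0" by (intro fperm_eqI) (simp add: symgD)
  then show ?case by (intro exI[of _ "[]"]) (simp add: wperm_simps)
next
  case (Suc r)
  define j where "j = ap (- g) r"
  have j: "j \<le> r" using symg_lt[of "- g" "Suc r" r] Suc.prems by (simp add: j_def)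
  let ?c = "rev [j..<r]"
  have "ap (g - wperm ?c) r = r"
  proof -
    have "ap (- wperm ?c) r = j" using wperm_run[OF j] ap_minus_ap(1)[of "wperm ?c" j] by simp
    then show ?thesis
      by (simp add: j_def diff_conv_add_uminus del: add_uminus_conv_diff)
  qed
  moreover have "wperm ?c \<in> symg (Suc r)" by (rule wperm_symg) auto
  then have "g - wperm ?c \<in> symg (Suc r)"
    using Suc.prems symg_plus[of g "Suc r" "- wperm ?c"] by simp
  ultimately have "g - wperm ?c \<in> symg r" by (simp add: symg_pred)
  then obtain w where w: "set w \<subseteq> {..<r - 1}" "wperm w = g - wperm ?c" using Suc.IH by blast
  then have "wperm (w @ ?c) = g" by (simp add: wperm_append)
  moreover have "set (w @ ?c) \<subseteq> {..<Suc r - 1}" using w(1) by auto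
  ultimately show ?case by blast
qed

definition pd :: "nat \<Rightarrow> fperm \<Rightarrow> 'k::field_char_0 hmor" where
  "pd r g = perm_dgm r (ap g)"

text \<open>Frees \<open>perm_dgm\<close> from the chosen word.\<close>

lemma pd_word: "set w \<subseteq> {..<r - 1} \<Longrightarrow> pd r (wperm w) = word_dgm r w"
proof -
  assume w: "set w \<subseteq> {..<r - 1}"
  let ?P = "\<lambda>v. set v \<subseteq> {..<r - 1} \<and> word_perm v = ap (wperm w)"
  define v where "v = (SOME v. ?P v)"
  have "?P v" unfolding v_def by (rule someI[of ?P w]) (use w in \<open>simp add: ap_wperm\<close>)
  then have v: "set v \<subseteq> {..<r - 1}" "wperm v = wperm w"
    by (simp_all add: ap_wperm[symmetric] ap_inject)
  show ?thesis
    unfolding pd_def perm_dgm_def v_def[symmetric] by (rule wperm_eq_imp[OF v(1) w order.refl v(2)])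
qed

lemma pd_plus:
  assumes "g \<in> symg r" "h \<in> symg r"
  shows "pd r (g + h) = pd r g * pd r h"
proof -
  obtain u v where uv: "set u \<subseteq> {..<r - 1}" "wperm u = g" "set v \<subseteq> {..<r - 1}" "wperm v = h"
    using ex_word[OF assms(1)] ex_word[OF assms(2)] by blast
  have "pd r (wperm (u @ v)) = pd r (wperm u) * (pd r (wperm v) :: 'a hmor)"
    using uv(1,3) by (simp only: pd_word word_dgm_append set_append Un_least)
  then show ?thesis by (simp add: wperm_append uv)
qed

lemma tp_pd: "g \<in> symg r \<Longrightarrow> tp (pd r g) (Qpow r) (Qpow r)"
  using ex_word[of g r] tp_word_dgm pd_word by metis

lemma pd_zero: "pd r 0 = idn (Qpow r)"
  using pd_word[of "[]" r] by (simp add: wperm_simps word_dgm_simps)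

lemma pd_Suc:
  assumes "g \<in> symg r"
  shows "pd (Suc r) g = (pd r g \<boxtimes> idn [Dn] :: 'k::field_char_0 hmor)"
proof -
  have s: "sigma (Suc r) i = (lay [] (sigma r i) [Dn] :: 'k hmor)" if "i < r - 1" for i
  proof -
    have "Suc r - 2 - i = Suc (r - 2 - i)" using that by simp
    then show ?thesis by (simp add: sigma_lay Qpow_simps(2))
  qed
  obtain w where w: "set w \<subseteq> {..<r - 1}" "wperm w = g" using ex_word[OF assms] by blast
  have "word_dgm (Suc r) w = (lay [] (word_dgm r w) [Dn] :: 'k hmor)"
    using w(1) by (induction w) (simp_all add: word_dgm_simps s lay_mult[OF tp_word_dgm tp_sigma] Qpow_simps)
  moreover have "set w \<subseteq> {..<Suc r - 1}" using w(1) by auto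
  ultimately show ?thesis unfolding w(2)[symmetric] using w(1) by (simp only: pd_word) (simp add: lay_def)
qed

lemma flip_sigma [simp]: "flip (sigma r i) = sigma r i"
  by (simp add: sigma_lay)

lemma flip_pd:
  assumes "g \<in> symg r"
  shows "flip (pd r g) = pd r (- g)"
proof -
  have "flip (word_dgm r w) = word_dgm r (rev w)" if "set w \<subseteq> {..<r - 1}" for w
    using that
    by (induction w) (auto simp: word_dgm_simps word_dgm_append idn_right[OF tp_sigma])
  then show ?thesis using ex_word[OF assms] pd_word wperm_rev by (metis set_rev)
qed

section \<open>The action of the group algebra on downward strands\<close>

definition Act :: "nat \<Rightarrow> 'k::field_char_0 ga \<Rightarrow> 'k hmor" where
  "Act r x = (\<Sum>g\<in>symg r. scal (coef x g) (pd r g))"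

lemma Act_zero [simp]: "Act r 0 = 0"
  by (simp add: Act_def)

lemma Act_add: "Act r (x + y) = Act r x + Act r y"
  by (simp add: Act_def lookup_add scal_add_left sum.distrib)

lemma Act_sm: "Act r (sm c x) = scal c (Act r x)"
  by (simp add: Act_def scal_sum)

lemma Act_sum: "Act r (\<Sum>i\<in>I. f i) = (\<Sum>i\<in>I. Act r (f i))"
  by (induction I rule: infinite_finite_induct) (simp_all add: Act_add)

lemma Act_gb: "g \<in> symg r \<Longrightarrow> Act r (gb g) = pd r g"
proof -
  assume g: "g \<in> symg r"
  have "Act r (gb g) = (\<Sum>h\<in>symg r. if h = g then pd r h else 0 :: 'a hmor)"
    unfolding Act_def by (intro sum.cong) (auto simp: coef_gb)
  then show ?thesis using g by simp
qed

lemma Act_one: "Act r 1 = idn (Qpow r)"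
  using Act_gb[of 0 r] by (simp add: pd_zero)

lemma tp_Act: "tp (Act r x) (Qpow r) (Qpow r)"
  unfolding Act_def by (intro tp_sum tp_scal tp_pd)

lemma Act_mult:
  assumes "x \<in> GA r" "y \<in> GA r"
  shows "Act r (x * y) = Act r x * Act r y"
proof -
  have "x * y = (\<Sum>g\<in>symg r. \<Sum>h\<in>symg r. sm (coef x g * coef y h) (gb (g + h)))"
    by (subst (1) GA_expand[OF assms(1)], subst (1) GA_expand[OF assms(2)])
      (simp add: sum_product gb_plus mult.commute)
  also have "Act r \<dots> = (\<Sum>g\<in>symg r. \<Sum>h\<in>symg r. scal (coef x g * coef y h) (pd r g * pd r h))"
    by (simp add: Act_sum Act_sm Act_gb pd_plus symg_plus)
  also have "\<dots> = Act r x * Act r y"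
    by (simp add: Act_def sum_product mult.commute)
  finally show ?thesis .
qed

lemma Act_Suc:
  assumes "x \<in> GA r"
  shows "Act (Suc r) x = Act r x \<boxtimes> idn [Dn]"
proof -
  have "Act (Suc r) x = (\<Sum>g\<in>symg r. scal (coef x g) (Act (Suc r) (gb g)))"
    by (subst GA_expand[OF assms]) (simp add: Act_sum Act_sm)
  also have "\<dots> = Act r x \<boxtimes> idn [Dn]"
    by (simp add: Act_gb symg_mono[of r "Suc r"] pd_Suc) (simp add: Act_def tens_sum)
  finally show ?thesis .
qed

lemma flip_sum: "flip (\<Sum>i\<in>I. f i) = (\<Sum>i\<in>I. flip (f i))"
  by (induction I rule: infinite_finite_induct) simp_all

lemma flip_Act: "flip (Act r x) = Act r (star x)"
proof -
  have "flip (Act r x) = (\<Sum>g\<in>symg r. scal (coef x g) (pd r (- g)))"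
    by (simp add: Act_def flip_sum flip_pd)
  also have "\<dots> = (\<Sum>g\<in>symg r. scal (coef x (- g)) (pd r g))"
    by (rule sum.reindex_bij_witness[of _ uminus uminus]) auto
  finally show ?thesis by (simp add: Act_def)
qed

section \<open>Crossings, caps and cups\<close>

definition CC :: "nat \<Rightarrow> 'k::field_char_0 hmor" where
  "CC N = idn (Qpow N) \<boxtimes> capQP"

definition KK :: "nat \<Rightarrow> 'k::field_char_0 hmor" where
  "KK N = idn (Qpow N) \<boxtimes> cupQP"

definition aP :: "nat \<Rightarrow> 'k::field_char_0 ga \<Rightarrow> 'k hmor" where
  "aP r x = Act r x \<boxtimes> idn [Up]"

lemma CC_lay: "CC N = lay (Qpow N) capQP []" and KK_lay: "KK N = lay (Qpow N) cupQP []"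
  and aP_lay: "aP r x = lay [] (Act r x) [Up]"
  by (simp_all add: CC_def KK_def aP_def lay_def)

lemma tp_CC: "tp (CC N) (Qpow (Suc N) @ [Up]) (Qpow N)"
  unfolding CC_lay using tp_lay[OF tp_gens(5), of "Qpow N" "[]"] by (simp add: Qpow_simps)

lemma tp_KK: "tp (KK N) (Qpow N) (Qpow (Suc N) @ [Up])"
  unfolding KK_lay using tp_lay[OF tp_gens(4), of "Qpow N" "[]"] by (simp add: Qpow_simps)

lemma tp_aP: "tp (aP r x) (Qpow r @ [Up]) (Qpow r @ [Up])"
  unfolding aP_lay using tp_lay[OF tp_Act, of "[]" r x "[Up]"] by simp

lemma flip_CC [simp]: "flip (CC N) = KK N" and flip_KK [simp]: "flip (KK N) = CC N"
  and flip_aP [simp]: "flip (aP r x) = aP r (star x)"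
  by (simp_all add: CC_def KK_def aP_def flip_Act)

lemma aP_mult: "x \<in> GA r \<Longrightarrow> y \<in> GA r \<Longrightarrow> aP r x * aP r y = aP r (x * y)"
  by (simp add: aP_lay Act_mult lay_mult[OF tp_Act tp_Act])

lemma aP_linear: "aP r (x + y) = aP r x + aP r y" "aP r (sm c x) = scal c (aP r x)" "aP r 0 = 0"
  "aP r (\<Sum>i\<in>I. f i) = (\<Sum>i\<in>I. aP r (f i))"
  by (simp_all add: aP_def Act_add Act_sm Act_sum tens_add tens_sum)

lemma aP_Suc: "y \<in> GA N \<Longrightarrow> aP (Suc N) y = lay [] (Act N y) [Dn, Up]"
  by (simp add: aP_def Act_Suc tens_assoc tens_idn lay_def)

lemma CC_nat: "y \<in> GA N \<Longrightarrow> CC N * aP (Suc N) y = Act N y * CC N"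
  using lay_exchange[OF tp_Act tp_gens(5), of "[]" N y "[]" "[]"] by (simp add: CC_lay aP_Suc)

lemma KK_nat: "y \<in> GA N \<Longrightarrow> aP (Suc N) y * KK N = KK N * Act N y"
  using arg_cong[OF CC_nat[OF star_GA], of y N flip] by (simp add: flip_Act)

lemma CC_KK: "CC N * KK N = idn (Qpow N)"
  unfolding CC_lay KK_lay lay_mult[OF tp_gens(4) tp_gens(5), symmetric] by (simp add: circle_eq)

lemma pd_tra: "pd (Suc (Suc M)) (tra M (Suc M)) = lay (Qpow M) XQQ []"
  using pd_word[of "[M]" "Suc (Suc M)"]
  by (simp add: wperm_simps word_dgm_simps sigma_lay Qpow_simps(1) idn_right[OF tp_lay[OF tp_XQQ], of "Qpow M" "[]", simplified]
      Qpow_simps(2))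

text \<open>The closed strand is a curl on the last remaining downward strand.\<close>

lemma CC_sigma_KK: "CC (Suc M) * aP (Suc (Suc M)) (gb (tra M (Suc M))) * KK (Suc M) = 0"
proof -
  have 1: "CC (Suc M) = lay (Qpow M) (lay [Dn] capQP []) []" "KK (Suc M) = lay (Qpow M) (lay [Dn] cupQP []) []"
    by (simp_all add: CC_lay KK_lay Qpow_simps)
  have 2: "aP (Suc (Suc M)) (gb (tra M (Suc M))) = lay (Qpow M) (lay [] XQQ [Up]) []"
    by (simp add: aP_lay Act_gb symg_tra pd_tra)
  have t: "tp (lay [Dn] (cupQP :: 'a hmor) []) [Dn] [Dn, Dn, Up]" "tp (lay [] (XQQ :: 'a hmor) [Up]) [Dn, Dn, Up] [Dn, Dn, Up]"
    "tp (lay [Dn] (capQP :: 'a hmor) []) [Dn, Dn, Up] [Dn]"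
    using tp_lay[OF tp_gens(4), of "[Dn]" "[]"] tp_lay[OF tp_XQQ, of "[]" "[Up]"] tp_lay[OF tp_gens(5), of "[Dn]" "[]"]
    by simp_all
  have "lay (Qpow M) (lay [Dn] capQP [] * lay [] XQQ [Up] * lay [Dn] cupQP []) [] = (0 :: 'a hmor)"
    by (simp only: curl_QQ lay_zero)
  then show ?thesis
    unfolding 1 2 by (simp only: lay_mult[OF t(1) tp_mult[OF t(2,3) refl]] lay_mult[OF t(2,3)])
qed

text \<open>Closing the last strand by a cap and a cup is the projection of the group algebra of
  \<open>N + 1\<close> onto that of \<open>N\<close>: a strand returning to itself is a counterclockwise circle, any other
  permutation produces a curl.\<close>

lemma CC_aP_KK:
  assumes "x \<in> GA (Suc N)"
  shows "CC N * aP (Suc N) x * KK N = Act N (Er N x :: 'k::field_char_0 ga)"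
proof -
  have gb: "CC N * aP (Suc N) (gb g) * KK N = Act N (Er N (gb g :: 'k ga))" if g: "g \<in> symg (Suc N)" for g
  proof (cases "g \<in> symg N")
    case True
    then have y: "gb g \<in> (GA N :: 'k ga set)" by blast
    then show ?thesis
      by (simp add: CC_nat Er_id mult.assoc CC_KK idn_right[OF tp_Act])
  next
    case False
    define i where "i = ap g N"
    have "i \<noteq> N" using False g by (simp add: symg_pred i_def)
    then have "i < N" using symg_lt[OF g, of N] by (simp add: i_def)
    then obtain M where M: "N = Suc M" by (cases N) auto
    \<comment> \<open>The permutations moving \<open>N\<close> form a single double coset of
      \<open>S_N\<close>, that of \<open>tra M N\<close>. The outer factors \<open>a\<close> and
      \<open>b\<close> leave through \<open>CC_nat\<close> and \<open>KK_nat\<close>.\<close>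
    define a b where "a = tra i M" and "b = tra M N + (a + g)"
    have a: "a \<in> symg N" using \<open>i < N\<close> M by (auto simp: a_def)
    have "ap g N = i" by (simp add: i_def)
    then have "ap b N = N" by (simp add: b_def a_def)
    moreover have "b \<in> symg (Suc N)" using M g symg_mono[OF _ a, of "Suc N"]
      by (auto simp: b_def intro!: symg_plus symg_tra)
    ultimately have b: "b \<in> symg N" by (simp add: symg_pred)
    have g_eq: "g = a + (tra M N + b)"
      by (rule fperm_eqI) (simp add: b_def a_def)
    have S: "gb (tra M N) \<in> (GA (Suc N) :: 'k ga set)" by (auto simp: M intro!: GA_gb symg_tra)
    have ab: "gb a \<in> (GA N :: 'k ga set)" "gb b \<in> (GA N :: 'k ga set)" using a b by auto
    then have ab': "gb a \<in> (GA (Suc N) :: 'k ga set)" "gb b \<in> (GA (Suc N) :: 'k ga set)"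
      using GA_mono[of N "Suc N"] by auto
    have "aP (Suc N) (gb g) = aP (Suc N) (gb a) * (aP (Suc N) (gb (tra M N)) * (aP (Suc N) (gb b) :: 'k hmor))"
      by (simp add: g_eq gb_plus aP_mult S ab' GA_mult)
    then have "CC N * aP (Suc N) (gb g) * KK N
        = CC N * aP (Suc N) (gb a) * aP (Suc N) (gb (tra M N)) * (aP (Suc N) (gb b) * (KK N :: 'k hmor))"
      by (simp add: mult.assoc)
    also have "\<dots> = Act N (gb a) * (CC N * aP (Suc N) (gb (tra M N)) * KK N) * Act N (gb b)"
      by (simp only: CC_nat[OF ab(1)] KK_nat[OF ab(2)] mult.assoc)
    also have "\<dots> = 0" by (simp add: M CC_sigma_KK)
    finally show ?thesis using False by (simp add: Er_gb)
  qed
  have "CC N * aP (Suc N) x * KK N = (\<Sum>g\<in>symg (Suc N). scal (coef x g) (CC N * aP (Suc N) (gb g) * KK N))"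
    by (subst (1) GA_expand[OF assms]) (simp add: aP_linear sum_distrib_left sum_distrib_right)
  also have "\<dots> = Act N (Er N x)"
  proof -
    have "Er N x = (\<Sum>g\<in>symg (Suc N). sm (coef x g) (Er N (gb g)))"
      by (subst (1) GA_expand[OF assms]) (simp add: Er_sum)
    then show ?thesis by (simp add: gb Act_sum Act_sm)
  qed
  finally show ?thesis .
qed

section \<open>An upward strand crossing all downward strands\<close>

lemma cross_left_Suc: "cross_left (Suc n) = lay [] (cross_left n) [Dn] * lay (Qpow n) XQP []"
  by (simp add: lay_def)

lemma tp_cross_left: "tp (cross_left n) (Qpow n @ [Up]) (Up # Qpow n)"
proof (induction n)
  case (Suc n)
  from tp_mult[OF tp_lay[OF tp_XQP, of "Qpow n" "[]"] tp_lay[OF Suc, of "[]" "[Dn]"]]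
  show ?case unfolding cross_left_Suc by (simp add: Qpow_simps)
qed (simp add: Qpow_simps tp_gens)

lemma flip_cross_left [simp]: "flip (cross_left n) = cross_right n"
  by (induction n) simp_all

lemma tp_cross_right: "tp (cross_right n) (Up # Qpow n) (Qpow n @ [Up])"
  using tp_flip[OF tp_cross_left[of n]] by simp

lemma sigma_Suc: "i < n - 1 \<Longrightarrow> sigma (Suc n) i = lay [] (sigma n i) [Dn]"
proof -
  assume "i < n - 1"
  then have "Suc n - 2 - i = Suc (n - 2 - i)" by simp
  then show ?thesis by (simp add: sigma_lay Qpow_simps(2))
qed

lemma cross_left_sigma:
  "i < n - 1 \<Longrightarrow> cross_left n * lay [] (sigma n i) [Up] = lay [Up] (sigma n i) [] * cross_left n"
proof (induction n)
  case (Suc n)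
  show ?case
  proof (cases "i < n - 1")
    case True
    note ts = tp_sigma[OF True]
    have 1: "lay (Qpow n) XQP [] * lay [] (sigma n i) [Dn, Up] = lay [] (sigma n i) [Up, Dn] * (lay (Qpow n) XQP [] :: 'a hmor)"
      by (rule lay_exchange[OF ts tp_XQP, of "[]" "[]" "[]", simplified, symmetric])
    have 2: "lay [] (cross_left n) [Dn] * lay [] (sigma n i) [Up, Dn] = lay [Up] (sigma n i) [Dn] * (lay [] (cross_left n) [Dn] :: 'a hmor)"
    proof -
      have t: "tp (lay [] (sigma n i) [Up]) (Qpow n @ [Up]) (Qpow n @ [Up])"
        "tp (lay [Up] (sigma n i) []) (Up # Qpow n) (Up # Qpow n)"
        using tp_lay[OF ts, of "[]" "[Up]"] tp_lay[OF ts, of "[Up]" "[]"] by simp_all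
      have "lay [] (cross_left n * lay [] (sigma n i) [Up]) [Dn] = lay [] (lay [Up] (sigma n i) [] * (cross_left n :: 'a hmor)) [Dn]"
        by (simp only: Suc.IH[OF True])
      then show ?thesis
        unfolding lay_mult[OF t(1) tp_cross_left] lay_mult[OF tp_cross_left t(2)] by simp
    qed
    show ?thesis
      unfolding cross_left_Suc sigma_Suc[OF True] by (simp add: mult.assoc 1 pull[OF 2])
  next
    \<comment> \<open>The generator involves the new strand and passes the two rightmost crossings
      by \<open>braid_QQP\<close>; the remaining crossings are disjoint from it.\<close>
    case False
    with Suc.prems obtain m where m: "n = Suc m" "i = m" by (cases n) auto
    have s: "sigma (Suc n) i = lay (Qpow m) XQQ []"
      using m by (simp add: sigma_lay Qpow_simps)
    have x: "(cross_left (Suc n) :: 'a hmor) = lay [] (cross_left m) [Dn, Dn] *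
        (lay (Qpow m) (lay [] XQP [Dn]) [] * lay (Qpow m) (lay [Dn] XQP []) [])"
    proof -
      have "tp (lay (Qpow m) (XQP :: 'a hmor) []) (Qpow m @ [Dn, Up]) (Qpow m @ [Up, Dn])"
        using tp_lay[OF tp_XQP, of "Qpow m" "[]"] by simp
      moreover have "tp (lay [] (cross_left m :: 'a hmor) [Dn]) (Qpow m @ [Up, Dn]) (Up # Qpow m @ [Dn])"
        using tp_lay[OF tp_cross_left, of "[]" m "[Dn]"] by simp
      ultimately show ?thesis
        unfolding cross_left_Suc m(1) by (simp add: lay_mult mult.assoc Qpow_simps)
    qed
    have t: "tp (lay [] XQQ [Up]) [Dn, Dn, Up] [Dn, Dn, Up]" "tp (lay [Dn] XQP []) [Dn, Dn, Up] [Dn, Up, Dn]"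
      "tp (lay [] XQP [Dn]) [Dn, Up, Dn] [Up, Dn, Dn]" "tp (lay [Up] XQQ []) [Up, Dn, Dn] [Up, Dn, Dn]"
      using tp_lay[OF tp_XQQ, of "[]" "[Up]"] tp_lay[OF tp_XQQ, of "[Up]" "[]"]
        tp_lay[OF tp_XQP, of "[Dn]" "[]"] tp_lay[OF tp_XQP, of "[]" "[Dn]"] by simp_all
    have "lay (Qpow m) (lay [] XQP [Dn] * lay [Dn] XQP [] * lay [] XQQ [Up]) []
        = lay (Qpow m) (lay [Up] XQQ [] * (lay [] XQP [Dn] * lay [Dn] (XQP :: 'a hmor) [])) []"
      by (simp only: braid_QQP)
    note 1 = this[unfolded lay_mult[OF t(1) tp_mult[OF t(2,3) refl]] lay_mult[OF t(2,3)]
          lay_mult[OF tp_mult[OF t(2,3) refl] t(4)], unfolded mult.assoc]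
    have 2: "lay [] (cross_left m) [Dn, Dn] * lay (Qpow m) (lay [Up] XQQ []) []
        = lay [Up] (lay (Qpow m) XQQ []) [] * lay [] (cross_left m) [Dn, Dn]"
      using lay_exchange[OF tp_cross_left tp_XQQ, of "[]" m "[]" "[]"] by simp
    have 3: "lay [] (lay (Qpow m) XQQ []) [Up] = lay (Qpow m) (lay [] XQQ [Up]) []" by simp
    show ?thesis
      unfolding s x 3 mult.assoc 1 by (simp only: pull[OF 2] mult.assoc)
  qed
qed simp

lemma cross_left_Act: "cross_left n * aP n x = (idn [Up] \<boxtimes> Act n x) * cross_left n"
proof -
  have w: "cross_left n * lay [] (word_dgm n w) [Up] = lay [Up] (word_dgm n w) [] * (cross_left n :: 'a hmor)"
    if "set w \<subseteq> {..<n - 1}" for w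
    using that
  proof (induction w)
    case Nil
    then show ?case
      by (simp add: word_dgm_simps idn_left[OF tp_cross_left] idn_right[OF tp_cross_left])
  next
    case (Cons i w)
    then have i: "i < n - 1" and w: "set w \<subseteq> {..<n - 1}" by auto
    show ?case
      unfolding word_dgm_simps lay_mult[OF tp_word_dgm[OF w] tp_sigma[OF i]]
        mult.assoc[symmetric] cross_left_sigma[OF i]
      unfolding mult.assoc Cons.IH[OF w] ..
  qed
  have "cross_left n * lay [] (pd n g) [Up] = lay [Up] (pd n g) [] * (cross_left n :: 'a hmor)" if "g \<in> symg n" for g
    using ex_word[OF that] w by (metis pd_word)
  then have "(\<Sum>g\<in>symg n. scal (coef x g) (cross_left n * (pd n g \<boxtimes> idn [Up])))
      = (\<Sum>g\<in>symg n. scal (coef x g) ((idn [Up] \<boxtimes> pd n g) * cross_left n))"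
    by (simp add: lay_def)
  then show ?thesis
    by (simp add: aP_def Act_def tens_sum sum_distrib_left sum_distrib_right)
qed

lemma cross_right_Act: "aP n x * cross_right n = cross_right n * (idn [Up] \<boxtimes> Act n x)"
  using arg_cong[OF cross_left_Act[of n "star x"], of flip] by (simp add: flip_Act)

lemma cross_left_KK: "cross_left (Suc N) * KK N = 0"
proof -
  have "lay (Qpow N) XQP [] * lay (Qpow N) cupQP [] = (lay (Qpow N) (XQP * cupQP) [] :: 'a hmor)"
    by (rule lay_mult[OF tp_gens(4) tp_XQP, symmetric])
  then show ?thesis unfolding cross_left_Suc KK_lay by (simp add: mult.assoc XQP_cup)
qed

lemma CC_cross_right: "CC N * cross_right (Suc N) = 0"
  using arg_cong[OF cross_left_KK[of N], of flip] by (simp del: cross_left.simps cross_right.simps)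

lemma cross_right_Suc: "cross_right (Suc n) = lay (Qpow n) XPQ [] * lay [] (cross_right n) [Dn]"
  by (simp add: lay_def)

lemma cross_left_cross_right: "cross_left n * cross_right n = idn (Up # Qpow n)"
proof (induction n)
  case 0
  then show ?case by (simp add: idn_left[OF tp_gens(1)] Qpow_simps)
next
  case (Suc n)
  have 1: "lay (Qpow n) XQP [] * lay (Qpow n) XPQ [] = (idn (Qpow n @ [Up, Dn]) :: 'a hmor)"
    using lay_mult[OF tp_XPQ tp_XQP, of "Qpow n" "[]", symmetric] by (simp add: XQP_XPQ)
  have t: "tp (lay [] (cross_right n) [Dn]) (Up # Qpow n @ [Dn]) (Qpow n @ [Up, Dn])"
    using tp_lay[OF tp_cross_right, of "[]" n "[Dn]"] by simp
  have "cross_left (Suc n) * cross_right (Suc n)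
      = lay [] (cross_left n) [Dn] * (lay (Qpow n) XQP [] * lay (Qpow n) XPQ []) * (lay [] (cross_right n) [Dn] :: 'a hmor)"
    unfolding cross_left_Suc cross_right_Suc by (simp only: mult.assoc)
  also have "\<dots> = lay [] (cross_left n * cross_right n) [Dn]"
    unfolding 1 by (simp add: mult.assoc idn_left[OF t] lay_mult[OF tp_cross_right tp_cross_left])
  also have "\<dots> = idn (Up # Qpow (Suc n))" by (simp add: Suc Qpow_simps)
  finally show ?case .
qed

section \<open>Resolution of the double crossing\<close>

definition mv :: "nat \<Rightarrow> nat \<Rightarrow> fperm" where
  "mv n j = wperm [j..<n - 1]"

lemma mv_symg: "mv n j \<in> symg n"
  unfolding mv_def by (rule wperm_symg) auto

lemma ap_mv: "j \<le> N \<Longrightarrow> ap (mv (Suc N) j) N = j"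
  using wperm_run[of j N] wperm_rev[of "[j..<N]"] ap_minus_ap(2)[of "mv (Suc N) j" j]
  by (simp add: mv_def)

text \<open>A cup whose downward end is carried to position \<open>j\<close>. The cycles
  \<open>mv (Suc N) j\<close> represent the left cosets of \<open>S_N\<close> in
  \<open>S_{N+1}\<close>.\<close>

definition mid :: "nat \<Rightarrow> nat \<Rightarrow> 'k::field_char_0 hmor" where
  "mid N j = aP (Suc N) (gb (mv (Suc N) j)) * KK N"

lemma flip_mid: "flip (mid N j) = CC N * aP (Suc N) (gb (- mv (Suc N) j))"
  by (simp add: mid_def)

text \<open>By \<open>XQQ_cup\<close>, pulling the upward end across a new strand on the right
  amounts to one more crossing of downward strands, which lengthens the cycle.\<close>

lemma mid_Suc:
  assumes "j \<le> N"
  shows "lay (Qpow (Suc N)) XPQ [] * lay [] (mid N j) [Dn] = mid (Suc N) j"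
proof -
  let ?y = "gb (mv (Suc N) j) :: 'a ga"
  have y: "?y \<in> GA (Suc N)" using mv_symg by blast
  have l: "lay [] (mid N j) [Dn] = lay [] (Act (Suc N) ?y) [Up, Dn] * lay (Qpow N) cupQP [Dn]"
    unfolding mid_def lay_mult[OF tp_KK tp_aP] unfolding aP_lay KK_lay by simp
  have 1: "lay (Qpow (Suc N)) XPQ [] * lay [] (Act (Suc N) ?y) [Up, Dn]
      = lay [] (Act (Suc N) ?y) [Dn, Up] * lay (Qpow (Suc N)) XPQ []"
    using lay_exchange[OF tp_Act tp_XPQ, of "[]" "Suc N" ?y "[]" "[]"] by simp
  have t: "tp (lay [] cupQP [Dn]) [Dn] [Dn, Up, Dn]" "tp (lay [Dn] XPQ []) [Dn, Up, Dn] [Dn, Dn, Up]"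
    "tp (lay [Dn] cupQP []) [Dn] [Dn, Dn, Up]" "tp (lay [] XQQ [Up]) [Dn, Dn, Up] [Dn, Dn, Up]"
    using tp_lay[OF tp_gens(4), of "[]" "[Dn]"] tp_lay[OF tp_XPQ, of "[Dn]" "[]"]
      tp_lay[OF tp_gens(4), of "[Dn]" "[]"] tp_lay[OF tp_XQQ, of "[]" "[Up]"] by simp_all
  have "lay (Qpow N) (lay [Dn] XPQ [] * lay [] cupQP [Dn]) [] = lay (Qpow N) (lay [] XQQ [Up] * lay [Dn] cupQP []) []"
    by (simp only: XQQ_cup)
  then have 2: "lay (Qpow (Suc N)) XPQ [] * lay (Qpow N) cupQP [Dn]
      = lay (Qpow N) XQQ [Up] * lay (Qpow (Suc N)) cupQP []"
    unfolding lay_mult[OF t(1,2)] lay_mult[OF t(3,4)] by (simp add: Qpow_simps)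
  have 3: "lay (Qpow N) XQQ [Up] = aP (Suc (Suc N)) (gb (tra N (Suc N)))"
    by (simp add: aP_lay Act_gb symg_tra pd_tra)
  have mv: "mv (Suc (Suc N)) j = mv (Suc N) j + tra N (Suc N)"
    using assms by (simp add: mv_def wperm_append wperm_simps)
  have "lay (Qpow (Suc N)) XPQ [] * lay [] (mid N j) [Dn]
      = aP (Suc (Suc N)) ?y * (aP (Suc (Suc N)) (gb (tra N (Suc N))) * KK (Suc N))"
    unfolding l by (simp only: pull[OF 1] mult.assoc 2 3) (simp add: aP_Suc[OF y] KK_lay)
  also have "\<dots> = aP (Suc (Suc N)) (?y * gb (tra N (Suc N))) * KK (Suc N)"
    unfolding mult.assoc[symmetric]
    by (subst aP_mult[OF GA_mono[OF _ y] GA_gb[OF symg_tra]]) auto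
  also have "\<dots> = mid (Suc N) j" by (simp add: mid_def mv gb_plus)
  finally show ?thesis .
qed

lemma tp_mid: "tp (mid N j) (Qpow N) (Qpow (Suc N) @ [Up])"
  unfolding mid_def by (rule tp_mult[OF tp_KK tp_aP refl])

text \<open>The double crossing with the last downward strand, once freed from the inner ones, is
  resolved by \<open>XPQ_XQP\<close>; its cup and cap give the new summand. The summands of the
  induction hypothesis are carried along by \<open>mid_Suc\<close> and its reflection.\<close>

lemma cross_right_cross_left:
  "cross_right (Suc N) * cross_left (Suc N)
    = idn (Qpow (Suc N) @ [Up]) - (\<Sum>j\<le>N. mid N j * flip (mid N j) :: 'k::field_char_0 hmor)"
proof (induction N)
  case 0
  have "mid 0 0 = (cupQP :: 'k hmor)"
    by (simp add: mid_def mv_def wperm_simps aP_def Act_one KK_def Qpow_simps tens_idn idn_left[OF tp_gens(4)])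
  moreover have "idn [Dn] \<boxtimes> idn [Up] = (idn [Dn, Up] :: 'k hmor)" by (simp add: tens_idn)
  ultimately show ?case
    by (simp add: Qpow_simps tens_idn idn_left[OF tp_XQP] idn_right[OF tp_XPQ] XPQ_XQP mid_def)
next
  case (Suc N)
  let ?n = "Suc N"
  let ?L = "lay (Qpow ?n) XQP [] :: 'k hmor" and ?R = "lay (Qpow ?n) XPQ [] :: 'k hmor"
  have tpl: "tp ?L (Qpow ?n @ [Dn, Up]) (Qpow ?n @ [Up, Dn])" using tp_lay[OF tp_XQP, of "Qpow ?n" "[]"] by simp
  have RL: "?R * ?L = idn (Qpow (Suc ?n) @ [Up]) - mid ?n ?n * flip (mid ?n ?n)"
  proof -
    have "?R * ?L = lay (Qpow ?n) (idn [Dn, Up] - cupQP * capQP) []"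
      by (simp only: lay_mult[OF tp_XQP tp_XPQ, symmetric] XPQ_XQP)
    also have "\<dots> = idn (Qpow ?n @ [Dn, Up]) - lay (Qpow ?n) (cupQP * capQP) []"
      by (simp add: lay_def tens_diff tens_idn)
    also have "lay (Qpow ?n) (cupQP * capQP) [] = KK ?n * (CC ?n :: 'k hmor)"
      unfolding KK_lay CC_lay by (rule lay_mult[OF tp_gens(5,4)])
    moreover have "mid ?n ?n = (KK ?n :: 'k hmor)"
      by (simp add: mid_def mv_def wperm_simps aP_def Act_one tens_idn idn_left[OF tp_KK])
    ultimately show ?thesis by (simp add: Qpow_simps)
  qed
  have mids: "?R * lay [] (mid N j * flip (mid N j)) [Dn] * ?L = mid ?n j * flip (mid ?n j)" if "j \<le> N" for j
  proof -
    have "flip (?R * lay [] (mid N j) [Dn]) = flip (mid ?n j)" by (simp only: mid_Suc[OF that])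
    then have 2: "lay [] (flip (mid N j)) [Dn] * ?L = flip (mid ?n j)" by simp
    have "?R * lay [] (mid N j * flip (mid N j)) [Dn] * ?L
        = ?R * lay [] (mid N j) [Dn] * (lay [] (flip (mid N j)) [Dn] * ?L)"
      by (simp only: lay_mult[OF tp_flip[OF tp_mid] tp_mid] mult.assoc)
    then show ?thesis by (simp only: 2 mid_Suc[OF that])
  qed
  have "cross_right (Suc ?n) * cross_left (Suc ?n)
      = ?R * lay [] (cross_right ?n * cross_left ?n) [Dn] * ?L"
    unfolding cross_left_Suc[of ?n] cross_right_Suc[of ?n] lay_mult[OF tp_cross_left tp_cross_right]
    by (simp only: mult.assoc)
  also have "lay [] (cross_right ?n * cross_left ?n) [Dn]
      = idn (Qpow ?n @ [Up, Dn]) - (\<Sum>j\<le>N. lay [] (mid N j * flip (mid N j) :: 'k hmor) [Dn])"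
    unfolding Suc by (simp add: lay_def tens_diff tens_sum tens_idn)
  also have "?R * \<dots> * ?L = ?R * ?L - (\<Sum>j\<le>N. ?R * lay [] (mid N j * flip (mid N j)) [Dn] * ?L)"
    by (simp add: left_diff_distrib right_diff_distrib sum_distrib_left sum_distrib_right mult.assoc idn_left[OF tpl])
  also have "\<dots> = ?R * ?L - (\<Sum>j\<le>N. mid ?n j * flip (mid ?n j))"
    using mids by simp
  finally show ?case by (simp add: RL)
qed

text \<open>As a left \<open>k[S_N]\<close>-module the larger group algebra is free on the elements
  \<open>gb (- mv (Suc N) j)\<close>, and the projections are the coordinates.\<close>

lemma coset_sum:
  assumes "y \<in> GA (Suc N)"
  shows "(\<Sum>j\<le>N. Er N (y * gb (mv (Suc N) j)) * gb (- mv (Suc N) j)) = y"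
proof -
  let ?m = "mv (Suc N)"
  have "(\<Sum>j\<le>N. Er N (gb g * gb (?m j)) * gb (- ?m j)) = (gb g :: 'a ga)" if g: "g \<in> symg (Suc N)" for g
  proof -
    define i where "i = ap (- g) N"
    have i: "i \<le> N" using symg_lt[of "- g" "Suc N" N] g by (simp add: i_def)
    have "Er N (gb g * gb (?m j)) * gb (- ?m j) = (if j = i then gb g else (0 :: 'a ga))" if j: "j \<le> N" for j
    proof -
      have "g + ?m j \<in> symg N \<longleftrightarrow> ap g j = N"
        using symg_pred[of "g + ?m j" N] g mv_symg[of "Suc N" j] ap_mv[OF j] by auto
      also have "\<dots> \<longleftrightarrow> j = i" unfolding i_def by (metis ap_minus_ap)
      finally have "Er N (gb g * gb (?m j)) = (if j = i then gb (g + ?m j) else (0 :: 'a ga))"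
        by (simp add: Er_gb flip: gb_plus)
      then show ?thesis by (simp flip: gb_plus)
    qed
    then have "(\<Sum>j\<le>N. Er N (gb g * gb (?m j)) * gb (- ?m j)) = (\<Sum>j\<le>N. if j = i then gb g else (0 :: 'a ga))"
      by (intro sum.cong) auto
    then show ?thesis using i by simp
  qed
  note 1 = this
  have "(\<Sum>j\<le>N. Er N (y * gb (?m j)) * gb (- ?m j))
      = (\<Sum>j\<le>N. \<Sum>g\<in>symg (Suc N). sm (coef y g) (Er N (gb g * gb (?m j)) * gb (- ?m j)))"
    by (subst (1) GA_expand[OF assms]) (simp add: sum_distrib_right Er_sum)
  also have "\<dots> = (\<Sum>g\<in>symg (Suc N). sm (coef y g) (\<Sum>j\<le>N. Er N (gb g * gb (?m j)) * gb (- ?m j)))"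
    by (subst sum.swap) (simp add: sm_sum)
  also have "\<dots> = y" using GA_expand[OF assms] 1 by simp
  finally show ?thesis .
qed

section \<open>The decomposition as an identity of diagrams\<close>

context corner_tableau
begin

text \<open>The unscaled \<open>iota\<close> after its row symmetrizer has been absorbed, see
  \<open>iota_eq\<close>; \<open>GG'\<close> is the counterpart for \<open>rho\<close>.\<close>

definition GG :: "nat \<Rightarrow> 'k::field_char_0 hmor" where
  "GG p = aP n (g p) * KK N"

definition GG' :: "nat \<Rightarrow> 'k::field_char_0 hmor" where
  "GG' p = CC N * aP n (g' p)"

lemma CC_aP_KK_n: "x \<in> GA n \<Longrightarrow> CC N * aP n x * KK N = Act N (Er N x)"
  using CC_aP_KK n_Suc by simp

lemma CC_nat_n: "y \<in> GA N \<Longrightarrow> CC N * aP n y = Act N y * CC N"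
  using CC_nat n_Suc by simp

lemma KK_nat_n: "y \<in> GA N \<Longrightarrow> aP n y * KK N = KK N * Act N y"
  using KK_nat n_Suc by simp

lemma GG'_GG:
  assumes "corner p" "corner q"
  shows "GG' p * GG q = (if p = q then scal (inverse (nf p)) (Act N (f p)) else 0)"
proof -
  have "GG' p * GG q = CC N * (aP n (g' p) * aP n (g q)) * KK N"
    by (simp add: GG_def GG'_def mult.assoc)
  also have "\<dots> = Act N (Er N (g' p * g q))"
    unfolding aP_mult[OF g_GA(2)[OF assms(1)] g_GA(1)[OF assms(2)]]
    by (intro CC_aP_KK_n GA_mult g_GA assms)
  finally show ?thesis using assms by (cases "p = q") (simp_all add: Er_g'_g Act_sm)
qed

lemma cross_left_GG: "cross_left n * aP n x * GG p = 0" if "x \<in> GA n" "corner p"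
proof -
  have "cross_left n * aP n x * GG p = cross_left n * aP n (x * g p) * KK N"
    by (simp add: GG_def mult.assoc aP_mult[OF that(1) g_GA(1)[OF that(2)], symmetric])
  also have "\<dots> = (idn [Up] \<boxtimes> Act n (x * g p)) * (cross_left n * KK N)"
    by (simp only: cross_left_Act mult.assoc)
  also have "cross_left n * KK N = 0" unfolding n_Suc by (rule cross_left_KK)
  finally show ?thesis by simp
qed

lemma GG'_cross_right: "GG' p * (cross_right n * y) = 0"
proof -
  have "GG' p * (cross_right n * y) = CC N * (aP n (g' p) * cross_right n) * y"
    by (simp add: GG'_def mult.assoc)
  also have "\<dots> = CC N * cross_right n * (idn [Up] \<boxtimes> Act n (g' p)) * y"
    by (simp only: cross_right_Act mult.assoc)
  also have "CC N * cross_right n = 0" unfolding n_Suc by (rule CC_cross_right)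
  finally show ?thesis by simp
qed

text \<open>The identity between two copies of \<open>yng\<close> is resolved into crossings and
  turn-backs. \<open>branching\<close> splits the left half of each turn-back over the corners, and
  for each corner \<open>coset_sum\<close> reassembles the right halves into
  \<open>GG' p\<close>.\<close>

lemma decomposition:
  "aP n yng = cross_right n * (idn [Up] \<boxtimes> Act n yng) * (cross_left n * aP n yng)
    + (\<Sum>p | corner p. scal (nf p) (GG p * GG' p :: 'k::field_char_0 hmor))"
proof -
  let ?e = "yng :: 'k ga" and ?m = "mv n"
  have e: "?e \<in> GA n" by simp
  have ab: "aP n x * (aP n y * z) = aP n (x * y) * z" if "x \<in> GA n" "y \<in> GA n" for x y :: "'k ga" and z
    using that by (simp add: aP_mult flip: mult.assoc)
  have mgb: "gb (?m j) \<in> (GA n :: 'k ga set)" "gb (- ?m j) \<in> (GA n :: 'k ga set)" for j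
    using mv_symg[of n j] by auto
  have ErN: "Er N x \<in> GA n" for x :: "'k ga" by (rule GA_N) simp
  have left: "aP n ?e * mid N j = (\<Sum>p | corner p. scal (nf p) (GG p * Act N (Er N (g' p * gb (?m j)))))" for j
  proof -
    have "aP n ?e * mid N j = aP n (?e * gb (?m j)) * KK N"
      using mgb by (simp add: mid_def n_Suc[symmetric] ab)
    also have "\<dots> = (\<Sum>p | corner p. scal (nf p) (aP n (g p * Er N (g' p * gb (?m j))) * KK N))"
      unfolding branching[OF mgb(1)] by (simp add: aP_linear sum_distrib_right)
    also have "\<dots> = (\<Sum>p | corner p. scal (nf p) (GG p * Act N (Er N (g' p * gb (?m j)))))"
    proof (intro sum.cong arg_cong[where f = "scal _"] refl)
      fix p assume "p \<in> {p. corner p}"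
      then have p: "corner p" by simp
      have "aP n (g p * Er N (g' p * gb (?m j))) = aP n (g p) * (aP n (Er N (g' p * gb (?m j))) :: 'k hmor)"
        by (rule aP_mult[OF g_GA(1)[OF p] ErN, symmetric])
      then show "aP n (g p * Er N (g' p * gb (?m j))) * KK N = GG p * (Act N (Er N (g' p * gb (?m j))) :: 'k hmor)"
        by (simp add: GG_def mult.assoc KK_nat_n)
    qed
    finally show ?thesis .
  qed
  have right: "flip (mid N j) * aP n ?e = CC N * aP n (gb (- ?m j) * ?e)" for j
    using mgb by (simp add: flip_mid n_Suc[symmetric] mult.assoc aP_mult)
  have sum: "(\<Sum>j\<le>N. Act N (Er N (g' p * gb (?m j))) * (CC N * aP n (gb (- ?m j) * ?e))) = GG' p"
    if p: "corner p" for p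
  proof -
    have "Act N (Er N (g' p * gb (?m j))) * (CC N * aP n (gb (- ?m j) * ?e))
        = CC N * aP n (Er N (g' p * gb (?m j)) * gb (- ?m j) * ?e)" for j
    proof -
      have "Act N (Er N (g' p * gb (?m j))) * CC N = CC N * (aP n (Er N (g' p * gb (?m j))) :: 'k hmor)"
        by (simp add: CC_nat_n)
      from pull[OF this] show ?thesis using mgb ErN by (simp add: aP_mult mult.assoc GA_mult)
    qed
    then have "(\<Sum>j\<le>N. Act N (Er N (g' p * gb (?m j))) * (CC N * aP n (gb (- ?m j) * ?e)))
        = CC N * aP n ((\<Sum>j\<le>N. Er N (g' p * gb (?m j)) * gb (- ?m j)) * ?e)"
      by (simp add: aP_linear sum_distrib_left sum_distrib_right)
    also have "(\<Sum>j\<le>N. Er N (g' p * gb (?m j)) * gb (- ?m j)) = (g' p :: 'k ga)"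
      using coset_sum[of "g' p" N] g_GA(2)[OF p] n_Suc by simp
    also have "g' p * ?e = g' p" by (simp add: g'_def mult.assoc)
    finally show ?thesis by (simp add: GG'_def)
  qed
  have idn: "idn (Qpow n @ [Up]) = cross_right n * cross_left n + (\<Sum>j\<le>N. mid N j * flip (mid N j) :: 'k hmor)"
    unfolding n_Suc cross_right_cross_left by simp
  have "aP n ?e = aP n ?e * idn (Qpow n @ [Up]) * aP n ?e"
    using e by (simp add: idn_right[OF tp_aP] aP_mult)
  also have "\<dots> = aP n ?e * cross_right n * (cross_left n * aP n ?e)
      + (\<Sum>j\<le>N. (aP n ?e * mid N j) * (flip (mid N j) * aP n ?e))"
    unfolding idn by (simp add: distrib_left distrib_right sum_distrib_left sum_distrib_right mult.assoc)
  also have "aP n ?e * cross_right n = cross_right n * (idn [Up] \<boxtimes> Act n ?e)"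
    by (rule cross_right_Act)
  also have "(\<Sum>j\<le>N. (aP n ?e * mid N j) * (flip (mid N j) * aP n ?e))
      = (\<Sum>j\<le>N. \<Sum>p | corner p. scal (nf p) (GG p *
          (Act N (Er N (g' p * gb (?m j))) * (CC N * aP n (gb (- ?m j) * ?e)))))"
    unfolding left right by (simp add: sum_distrib_right mult.assoc)
  also have "\<dots> = (\<Sum>p | corner p. scal (nf p) (GG p *
          (\<Sum>j\<le>N. Act N (Er N (g' p * gb (?m j))) * (CC N * aP n (gb (- ?m j) * ?e)))))"
    by (subst sum.swap) (simp add: scal_sum sum_distrib_left)
  also have "\<dots> = (\<Sum>p | corner p. scal (nf p) (GG p * GG' p))"
    using sum by simp
  finally show ?thesis .
qed

end

section \<open>Partitions\<close>

definition toGA :: "nat \<Rightarrow> 'k::field_char_0 galg \<Rightarrow> 'k ga" where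
  "toGA r x = (\<Sum>g\<in>symg r. sm (x (ap g)) (gb g))"

lemma coef_toGA: "coef (toGA r x) g = (if g \<in> symg r then x (ap g) else 0)"
  by (simp add: toGA_def lookup_sum coef_gb if_distrib cong: if_cong)

lemma toGA_GA: "toGA r x \<in> GA r"
  by (simp add: GA_def coef_toGA)

lemma act_toGA: "act r x = Act r (toGA r x)"
proof -
  have "act r x = (\<Sum>g\<in>symg r. scal (x (ap g)) (perm_dgm r (ap g)))"
    unfolding act_def by (rule sum.reindex_bij_betw[OF bij_betw_ap_symg, symmetric])
  then show ?thesis by (simp add: Act_def coef_toGA pd_def)
qed

lemma toGA_conv: "toGA r (conv r x y) = toGA r x * toGA r y"
proof (rule poly_mapping_eqI)
  fix g
  show "coef (toGA r (conv r x y)) g = coef (toGA r x * toGA r y) g"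
  proof (cases "g \<in> symg r")
    case True
    have "conv r x y (ap g) = (\<Sum>h\<in>symg r. x (ap h) * y (inv_into UNIV (ap h) \<circ> ap g))"
      unfolding conv_def by (rule sum.reindex_bij_betw[OF bij_betw_ap_symg, symmetric])
    also have "\<dots> = (\<Sum>h\<in>symg r. coef (toGA r x) h * coef (toGA r y) (- h + g))"
      using True by (intro sum.cong) (auto simp: coef_toGA ap_plus_fun ap_uminus_fun symg_plus)
    finally show ?thesis using True by (simp add: coef_toGA coef_mult[OF toGA_GA])
  next
    case False
    then show ?thesis using GA_mult[OF toGA_GA toGA_GA, of r x y] by (simp add: coef_toGA GA_def)
  qed
qed

lemma toGA_eqD:
  assumes "toGA r x = toGA r y" "\<And>p. \<not> p permutes {..<r} \<Longrightarrow> x p = y p"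
  shows "x = y"
proof
  fix p show "x p = y p"
  proof (cases "p permutes {..<r}")
    case True
    then show ?thesis using permutes_symg[OF True] coef_toGA[of r x "Fp p"] coef_toGA[of r y "Fp p"] assms(1)
      by simp
  qed (rule assms(2))
qed

lemma card_ap_set:
  assumes "G \<subseteq> {p. p permutes {..<r}}"
  shows "card {g \<in> symg r. ap g \<in> G} = card G"
proof -
  have "ap ` {g \<in> symg r. ap g \<in> G} = G"
  proof (intro Set.set_eqI iffI)
    fix p assume "p \<in> G"
    then show "p \<in> ap ` {g \<in> symg r. ap g \<in> G}"
      using assms permutes_symg[of p r] by (intro image_eqI[of _ _ "Fp p"]) auto
  qed auto
  moreover have "inj_on ap {g \<in> symg r. ap g \<in> G}" by (simp add: inj_on_def ap_inject)
  ultimately show ?thesis by (metis card_image)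
qed

lemma toGA_symmetrizer:
  assumes "G \<subseteq> {p. p permutes {..<r}}"
  shows "toGA r (symmetrizer G) = Sy False {g \<in> symg r. ap g \<in> G}"
    "toGA r (antisymmetrizer G) = Sy True {g \<in> symg r. ap g \<in> G}"
  by (rule poly_mapping_eqI, simp add: coef_toGA coef_Sy symmetrizer_def antisymmetrizer_def card_ap_set[OF assms] chi_def)+

lemma row_group_Grp: "{g \<in> symg (sum_list l). ap g \<in> row_group l} = Grp (sum_list l) (row_of l)"
  and col_group_Grp: "{g \<in> symg (sum_list l). ap g \<in> col_group l} = Grp (sum_list l) (col_of l)"
  by (auto simp: Grp_def row_group_def col_group_def symg_permutes)

lemma toGA_young_pre:
  "toGA (sum_list l) (young_pre l) = Sy False (Grp (sum_list l) (row_of l)) * Sy True (Grp (sum_list l) (col_of l))"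
proof -
  have "row_group l \<subseteq> {p. p permutes {..<sum_list l}}" "col_group l \<subseteq> {p. p permutes {..<sum_list l}}"
    by (auto simp: row_group_def col_group_def)
  then show ?thesis
    by (simp add: young_pre_def toGA_conv toGA_symmetrizer row_group_Grp col_group_Grp)
qed

lemma toGA_scale: "toGA r (\<lambda>p. c * x p) = sm c (toGA r x)"
  by (simp add: toGA_def sm_sum)

lemma conv_vanish:
  assumes "\<And>p. \<not> p permutes {..<r} \<Longrightarrow> y p = 0" "\<not> p permutes {..<r}"
  shows "conv r x y p = 0"
proof -
  have "y (inv_into UNIV q \<circ> p) = 0" if q: "q permutes {..<r}" for q
  proof (rule assms(1))
    show "\<not> inv_into UNIV q \<circ> p permutes {..<r}"
    proof
      assume "inv_into UNIV q \<circ> p permutes {..<r}"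
      from permutes_compose[OF this q] have "q \<circ> (inv_into UNIV q \<circ> p) permutes {..<r}" .
      moreover have "q \<circ> (inv_into UNIV q \<circ> p) = p"
        by (rule ext) (simp add: permutes_inverses[OF q])
      ultimately show False using assms(2) by simp
    qed
  qed
  then show ?thesis unfolding conv_def by (intro sum.neutral) auto
qed

text \<open>For the way back from the algebra to functions: \<open>toGA\<close> forgets values off
  the permutations of \<open>{..<r}\<close>.\<close>

lemma young_pre_vanish: "\<not> p permutes {..<sum_list l} \<Longrightarrow> young_pre l p = 0"
  unfolding young_pre_def by (rule conv_vanish) (auto simp: antisymmetrizer_def col_group_def)

lemma toGA_young:
  assumes "tableau (sum_list l) (row_of l) (col_of l)"
  shows "toGA (sum_list l) (young l) = (tableau.yng (sum_list l) (row_of l) (col_of l) :: 'k::field_char_0 ga)"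
proof -
  interpret tableau "sum_list l" "row_of l" "col_of l" by (rule assms)
  let ?n = "sum_list l"
  let ?P = "toGA ?n (young_pre l) :: 'k ga"
  have P: "?P = rsym * casym" by (rule toGA_young_pre)
  have nz: "tau ?P \<noteq> 0" unfolding P by (rule tau_rsym_casym_nz)
  \<comment> \<open>Idempotency is tested with \<open>tau\<close>, which does not vanish on
    \<open>?P\<close>. Together with \<open>c \<noteq> 0\<close> this singles out the inverse of
    \<open>yfac\<close>.\<close>
  have iff: "conv ?n (\<lambda>p. c * young_pre l p) (\<lambda>p. c * young_pre l p) = (\<lambda>p. c * young_pre l p)
      \<longleftrightarrow> c * c * yfac = c" for c :: 'k
  proof -
    have "conv ?n (\<lambda>p. c * young_pre l p) (\<lambda>p. c * young_pre l p) = (\<lambda>p. c * young_pre l p)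
        \<longleftrightarrow> sm c ?P * sm c ?P = sm c ?P"
    proof
      assume "sm c ?P * sm c ?P = sm c ?P"
      then have "toGA ?n (conv ?n (\<lambda>p. c * young_pre l p) (\<lambda>p. c * young_pre l p)) = toGA ?n (\<lambda>p. c * young_pre l p)"
        by (simp only: toGA_conv toGA_scale)
      then show "conv ?n (\<lambda>p. c * young_pre l p) (\<lambda>p. c * young_pre l p) = (\<lambda>p. c * young_pre l p)"
        by (rule toGA_eqD) (simp add: conv_vanish young_pre_vanish)
    qed (metis toGA_conv toGA_scale)
    also have "sm c ?P * sm c ?P = sm (c * c * yfac) ?P"
      by (simp only: P sm_mult_left sm_mult_right yfac(1), simp only: sm_sm mult.assoc)
    also have "sm (c * c * yfac) ?P = sm c ?P \<longleftrightarrow> c * c * yfac = c"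
    proof
      assume "sm (c * c * yfac) ?P = sm c ?P"
      then have "tau (sm (c * c * yfac) ?P) = tau (sm c ?P)" by simp
      then show "c * c * yfac = c" using nz by simp
    qed (simp only:)
    finally show ?thesis .
  qed
  have "young_scalar l = (inverse yfac :: 'k)"
    unfolding young_scalar_def
  proof (rule the_equality)
    show "inverse yfac \<noteq> (0 :: 'k) \<and> conv ?n (\<lambda>p. inverse yfac * young_pre l p) (\<lambda>p. inverse yfac * young_pre l p)
        = (\<lambda>p. inverse yfac * young_pre l p :: 'k)"
      unfolding iff using yfac(3)[where 'k = 'k] by simp
    fix c :: 'k
    assume "c \<noteq> 0 \<and> conv ?n (\<lambda>p. c * young_pre l p) (\<lambda>p. c * young_pre l p) = (\<lambda>p. c * young_pre l p)"
    then have "c \<noteq> 0" "c * (c * yfac) = c * 1" unfolding iff by (auto simp: mult.assoc)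
    then have "c * yfac = 1" by auto
    then show "c = inverse yfac" using inverse_unique[of yfac c] by (simp add: mult.commute)
  qed
  then show ?thesis unfolding young_def toGA_scale P yng_def by simp
qed

section \<open>Rows and columns of the strands\<close>

lemma row_col_of:
  "x < sum_list l \<Longrightarrow> row_of l x < length l \<and> col_of l x < l ! row_of l x \<and>
    x = sum_list (take (row_of l x) l) + col_of l x"
proof (induction l arbitrary: x)
  case (Cons a l)
  show ?case
  proof (cases "x < a")
    case False
    then have "x - a < sum_list l" using Cons.prems by simp
    from Cons.IH[OF this] False show ?thesis by (simp, elim conjE, linarith)
  qed simp
qed simp

lemma box_position:
  "i < length l \<Longrightarrow> j < l ! i \<Longrightarrow> sum_list (take i l) + j < sum_list l \<and>
    row_of l (sum_list (take i l) + j) = i \<and> col_of l (sum_list (take i l) + j) = j"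
proof (induction l arbitrary: i)
  case (Cons a l)
  show ?case
  proof (cases i)
    case (Suc i')
    with Cons.IH[of i'] Cons.prems show ?thesis by (auto simp: add.assoc)
  qed (use Cons.prems in auto)
qed simp

text \<open>Strands from \<open>p\<close> on take over the boxes of their right neighbours. The last
  alternative sets aside indices outside the shortened tableau, where \<open>row_of\<close> and
  \<open>col_of\<close> return default values.\<close>

lemma row_of_remove:
  assumes "r < length l" "0 < l ! r" "p = sum_list (take (Suc r) l) - 1"
  shows "row_of (l[r := l ! r - 1]) x = row_of l (if x < p then x else Suc x) \<and>
    col_of (l[r := l ! r - 1]) x = col_of l (if x < p then x else Suc x) \<or> sum_list l \<le> Suc x"
  using assms
proof (induction l arbitrary: r p x)
  case (Cons a l)
  show ?case
  proof (cases r)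
    case 0
    with Cons.prems show ?thesis by (auto simp: Suc_diff_le)
  next
    case (Suc r')
    then have r': "r' < length l" "0 < l ! r'" using Cons.prems by auto
    define p' where "p' = sum_list (take (Suc r') l) - 1"
    have "take (Suc r') l = take r' l @ [l ! r']" using r' by (simp add: take_Suc_conv_app_nth)
    then have pp: "p = a + p'" using Cons.prems(3) r' by (simp add: p'_def Suc)
    from Cons.IH[OF r' p'_def, of "x - a"] show ?thesis
      by (auto simp: Suc pp not_less Suc_diff_le)
  qed
qed simp

lemma row_col_append_zero: "x < sum_list xs \<Longrightarrow> row_of (xs @ [0]) x = row_of xs x \<and> col_of (xs @ [0]) x = col_of xs x"
proof (induction xs arbitrary: x)
  case (Cons a xs)
  from Cons.IH[of "x - a"] Cons.prems show ?case by auto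
qed simp

lemma ap_run: "j \<le> k \<Longrightarrow> ap (wperm [j..<k]) x = (if x < j \<or> k < x then x else if x = k then j else Suc x)"
proof (induction k arbitrary: x)
  case (Suc k)
  show ?case
  proof (cases "j = Suc k")
    case False
    with Suc.prems have "j \<le> k" by simp
    with Suc.IH show ?thesis by (auto simp: wperm_append wperm_simps)
  qed (auto simp: wperm_simps)
qed (auto simp: wperm_simps)

section \<open>Removable boxes and corners of a partition\<close>

locale partition =
  fixes \<mu> :: "nat list" and n :: nat
  assumes partition: "is_partition \<mu> n"
begin

lemma n_sum: "sum_list \<mu> = n"
  and pos: "i < length \<mu> \<Longrightarrow> 0 < \<mu> ! i"
  and decreasing: "i \<le> j \<Longrightarrow> j < length \<mu> \<Longrightarrow> \<mu> ! j \<le> \<mu> ! i"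
  using partition by (auto simp: is_partition_def sorted_wrt_iff_nth_less le_less)

sublocale tableau n "row_of \<mu>" "col_of \<mu>"
proof
  fix x y assume "x < n" "y < n" "row_of \<mu> x = row_of \<mu> y" "col_of \<mu> x = col_of \<mu> y"
  then show "x = y" using row_col_of[of x \<mu>] row_col_of[of y \<mu>] n_sum by simp
next
  fix x i j assume x: "x < n" "i \<le> row_of \<mu> x" "j \<le> col_of \<mu> x"
  then have "row_of \<mu> x < length \<mu>" "col_of \<mu> x < \<mu> ! row_of \<mu> x"
    using row_col_of[of x \<mu>] n_sum by simp_all
  then have "i < length \<mu>" "j < \<mu> ! i" using x decreasing[of i "row_of \<mu> x"] by auto
  from box_position[OF this] show "\<exists>y<n. row_of \<mu> y = i \<and> col_of \<mu> y = j"
    using n_sum by blast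
qed

lemma toGA_young_mu: "toGA n (young \<mu>) = yng"
  using toGA_young[of \<mu>] tableau_axioms by (simp add: n_sum)

lemma e_mor_mu: "e_mor \<mu> = Act n yng"
  by (simp add: e_mor_def n_sum act_toGA toGA_young_mu)

lemma young_id: "young \<mu> id = tau yng"
  by (simp add: tau_def coef_toGA ap_zero_fun flip: toGA_young_mu)

lemma row_end_box:
  assumes "r < length \<mu>"
  shows "row_end \<mu> (Suc r) < n" "row_of \<mu> (row_end \<mu> (Suc r)) = r"
    "col_of \<mu> (row_end \<mu> (Suc r)) = \<mu> ! r - 1"
proof -
  have "take (Suc r) \<mu> = take r \<mu> @ [\<mu> ! r]" using assms by (simp add: take_Suc_conv_app_nth)
  then have "row_end \<mu> (Suc r) = sum_list (take r \<mu>) + (\<mu> ! r - 1)"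
    using pos[OF assms] by (simp add: row_end_def)
  then show "row_end \<mu> (Suc r) < n" "row_of \<mu> (row_end \<mu> (Suc r)) = r"
    "col_of \<mu> (row_end \<mu> (Suc r)) = \<mu> ! r - 1"
    using box_position[OF assms, of "\<mu> ! r - 1"] pos[OF assms] n_sum by auto
qed

lemma removable_iff: "removable \<mu> (Suc r) \<longleftrightarrow> r < length \<mu> \<and> (Suc r < length \<mu> \<longrightarrow> \<mu> ! Suc r < \<mu> ! r)"
proof
  assume "removable \<mu> (Suc r)"
  then have r: "r < length \<mu>" and s: "sorted_wrt (\<ge>) (\<mu>[r := \<mu> ! r - 1])" by (auto simp: removable_def)
  have "\<mu> ! Suc r < \<mu> ! r" if "Suc r < length \<mu>"
  proof -
    have "\<mu>[r := \<mu> ! r - 1] ! r \<ge> \<mu>[r := \<mu> ! r - 1] ! Suc r"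
      using s that by (simp only: sorted_wrt_iff_nth_less length_list_update)
    then show ?thesis using that r pos[OF r] by simp
  qed
  with r show "r < length \<mu> \<and> (Suc r < length \<mu> \<longrightarrow> \<mu> ! Suc r < \<mu> ! r)" by blast
next
  assume r: "r < length \<mu> \<and> (Suc r < length \<mu> \<longrightarrow> \<mu> ! Suc r < \<mu> ! r)"
  have "sorted_wrt (\<ge>) (\<mu>[r := \<mu> ! r - 1])"
    unfolding sorted_wrt_iff_nth_less length_list_update
  proof (intro allI impI)
    fix i j assume ij: "i < j" "j < length \<mu>"
    have 1: "\<mu> ! j \<le> \<mu> ! i" using decreasing[of i j] ij by simp
    have 2: "\<mu> ! j < \<mu> ! r" if "r < j"
    proof -
      have "\<mu> ! j \<le> \<mu> ! Suc r" using decreasing[of "Suc r" j] that ij by simp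
      also have "\<dots> < \<mu> ! r" using r that ij by simp
      finally show ?thesis .
    qed
    show "\<mu>[r := \<mu> ! r - 1] ! j \<le> \<mu>[r := \<mu> ! r - 1] ! i"
      using 1 2 ij r by (auto simp: nth_list_update)
  qed
  with r show "removable \<mu> (Suc r)" by (simp add: removable_def)
qed

lemma removable_corner: "removable \<mu> s \<Longrightarrow> corner (row_end \<mu> s)"
proof -
  assume s: "removable \<mu> s"
  then obtain r where sr: "s = Suc r" by (cases s) (auto simp: removable_def)
  then have r: "r < length \<mu>" "Suc r < length \<mu> \<Longrightarrow> \<mu> ! Suc r < \<mu> ! r"
    using s removable_iff by blast+
  note b = row_end_box[OF r(1)]
  show ?thesis
    unfolding corner_def sr b
  proof (intro conjI allI impI b)
    fix x assume "x < n" "row_of \<mu> x = r"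
    then show "col_of \<mu> x \<le> \<mu> ! r - 1" using row_col_of[of x \<mu>] n_sum by auto
  next
    fix x assume x: "x < n" "col_of \<mu> x = \<mu> ! r - 1"
    show "row_of \<mu> x \<le> r"
    proof (rule ccontr)
      assume "\<not> row_of \<mu> x \<le> r"
      moreover have "row_of \<mu> x < length \<mu>" "col_of \<mu> x < \<mu> ! row_of \<mu> x"
        using row_col_of[of x \<mu>] x n_sum by auto
      ultimately show False using r(2) decreasing[of "Suc r" "row_of \<mu> x"] x by simp
    qed
  qed
qed

lemma corner_removable:
  assumes p: "corner p"
  shows "removable \<mu> (Suc (row_of \<mu> p))" "row_end \<mu> (Suc (row_of \<mu> p)) = p"
proof -
  let ?r = "row_of \<mu> p"
  have pn: "p < n" using p by (simp add: corner_def)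
  then have r: "?r < length \<mu>" "col_of \<mu> p < \<mu> ! ?r" using row_col_of[of p \<mu>] n_sum by auto
  note b = row_end_box[OF r(1)]
  have "col_of \<mu> (row_end \<mu> (Suc ?r)) \<le> col_of \<mu> p" using p b by (auto simp: corner_def)
  then have c: "col_of \<mu> p = \<mu> ! ?r - 1" using b(3) r(2) by simp
  then show "row_end \<mu> (Suc ?r) = p" using inj[OF b(1) pn] b by simp
  have "\<mu> ! Suc ?r < \<mu> ! ?r" if "Suc ?r < length \<mu>"
  proof (rule ccontr)
    assume "\<not> \<mu> ! Suc ?r < \<mu> ! ?r"
    then have "col_of \<mu> p < \<mu> ! Suc ?r" using r(2) by simp
    from box_position[OF that this] obtain y where "y < n" "row_of \<mu> y = Suc ?r" "col_of \<mu> y = col_of \<mu> p"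
      using n_sum by blast
    then show False using p by (fastforce simp: corner_def)
  qed
  then show "removable \<mu> (Suc ?r)" using r(1) removable_iff by blast
qed

lemma bij_corners: "bij_betw (row_end \<mu>) {s. removable \<mu> s} {p. corner p}"
proof (rule bij_betwI[where g = "\<lambda>p. Suc (row_of \<mu> p)"])
  fix s assume "s \<in> {s. removable \<mu> s}"
  moreover then obtain r where "s = Suc r" by (cases s) (auto simp: removable_def)
  ultimately show "Suc (row_of \<mu> (row_end \<mu> s)) = s" using row_end_box(2)[of r] removable_iff by auto
qed (auto simp: removable_corner corner_removable)

end

lemma Grp_cong: "(\<And>x. x < N \<Longrightarrow> h x = h' x) \<Longrightarrow> Grp N h = Grp N h'"
  unfolding Grp_def by (auto simp: symg_lt)

text \<open>\<open>N\<close> numbers the last strand; the empty partition is treated in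
  \<open>decomposition_data\<close>.\<close>

locale nonempty_partition = partition +
  fixes N :: nat
  assumes n_Suc': "n = Suc N"
begin

sublocale corner_tableau n "row_of \<mu>" "col_of \<mu>" N "mv n"
proof
  fix p assume "corner p"
  then have "p < n" by (simp add: corner_def)
  then have "p \<le> N" using n_Suc' by simp
  then show "ap (mv n p) N = p" using ap_mv n_Suc' by simp
qed (use n_Suc' mv_symg in auto)

text \<open>The cycle \<open>mv n p\<close> skips \<open>p\<close> and preserves the order of the
  other strands, so the transported tableau is again the row-ordered one.\<close>

lemma remove_box_tableau:
  assumes s: "removable \<mu> s"
  defines "p \<equiv> row_end \<mu> s" and "l \<equiv> remove_box \<mu> s"
  shows "sum_list l = N" "x < N \<Longrightarrow> row_of l x = srow p x" "x < N \<Longrightarrow> col_of l x = scol p x"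
proof -
  obtain r where sr: "s = Suc r" using s by (cases s) (auto simp: removable_def)
  then have r: "r < length \<mu>" "Suc r < length \<mu> \<Longrightarrow> \<mu> ! Suc r < \<mu> ! r"
    using s removable_iff by blast+
  let ?l = "\<mu>[r := \<mu> ! r - 1]"
  have sl: "sum_list ?l = N"
    using sum_list_update[OF r(1), of "\<mu> ! r - 1"] pos[OF r(1)] n_sum n_Suc member_le_sum_list[of "\<mu> ! r" \<mu>] r(1)
    by simp
  have p: "p = sum_list (take (Suc r) \<mu>) - 1" by (simp add: p_def sr row_end_def)
  have pN: "p \<le> N" using row_end_box(1)[OF r(1)] n_Suc by (simp add: p_def sr)
  have rc: "row_of ?l x = srow p x \<and> col_of ?l x = scol p x" if "x < N" for x
  proof -
    have "ap (mv n p) x = (if x < p then x else Suc x)"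
      using that ap_run[OF pN, of x] n_Suc by (simp add: mv_def)
    then show ?thesis
      using row_of_remove[OF r(1) pos[OF r(1)] p, of x] that n_sum n_Suc by simp
  qed
  have l: "l = filter (\<lambda>x. 0 < x) ?l" by (simp add: l_def remove_box_def sr)
  \<comment> \<open>A zero row arises only from a row of length one, which is the last row because
    its box is removable.\<close>
  have "l = ?l \<or> ?l = l @ [0]"
  proof (cases "1 < \<mu> ! r")
    case True
    have "\<forall>x\<in>set ?l. 0 < x"
      using True pos r(1) by (auto simp: in_set_conv_nth nth_list_update)
    then show ?thesis unfolding l by (simp add: filter_id_conv)
  next
    case False
    then have m1: "\<mu> ! r = 1" using pos[OF r(1)] by simp
    have "Suc r = length \<mu>" using r m1 pos[of "Suc r"] by fastforce
    then have d: "drop (Suc r) \<mu> = []" by simp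
    have u: "?l = take r \<mu> @ [0]" using r(1) m1 d by (simp add: upd_conv_take_nth_drop)
    have "\<forall>x\<in>set (take r \<mu>). 0 < x" using partition by (auto simp: is_partition_def dest: in_set_takeD)
    then have "l = take r \<mu>" unfolding l u by simp
    with u show ?thesis by simp
  qed
  then consider "l = ?l" | "?l = l @ [0]" by blast
  then have 1: "sum_list l = N \<and> (x < N \<longrightarrow> row_of l x = srow p x \<and> col_of l x = scol p x)" for x
  proof cases
    case 2
    then show ?thesis using sl rc[of x] row_col_append_zero[of x l] by auto
  qed (use sl rc in simp)
  then show "sum_list l = N" "x < N \<Longrightarrow> row_of l x = srow p x" "x < N \<Longrightarrow> col_of l x = scol p x"
    by blast+
qed

lemma remove_box_young:
  assumes s: "removable \<mu> s"
  shows "toGA N (young (remove_box \<mu> s)) = f (row_end \<mu> s)"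
proof -
  let ?l = "remove_box \<mu> s" and ?p = "row_end \<mu> s"
  note rb = remove_box_tableau[OF s]
  interpret sub: tableau N "srow ?p" "scol ?p" by (rule sub_tableau[OF removable_corner[OF s]])
  interpret t: tableau N "row_of ?l" "col_of ?l"
  proof
    fix x y assume "x < N" "y < N" "row_of ?l x = row_of ?l y" "col_of ?l x = col_of ?l y"
    then show "x = y" using sub.inj[of x y] rb by simp
  next
    fix x i j assume "x < N" "i \<le> row_of ?l x" "j \<le> col_of ?l x"
    then obtain y where "y < N" "srow ?p y = i" "scol ?p y = j" using sub.closed[of x i j] rb by auto
    then show "\<exists>y<N. row_of ?l y = i \<and> col_of ?l y = j" using rb by (intro exI[of _ y]) simp
  qed
  have "Grp N (row_of ?l) = Grp N (srow ?p)" "Grp N (col_of ?l) = Grp N (scol ?p)"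
    using rb(2,3) by (auto intro!: Grp_cong)
  then show ?thesis
    unfolding f_def toGA_young[of ?l, unfolded rb(1), OF t.tableau_axioms]
    by (simp add: t.yng_def sub.yng_def t.yfac_def sub.yfac_def)
qed

lemma remove_box_e_mor: "removable \<mu> s \<Longrightarrow> e_mor (remove_box \<mu> s) = Act N (f (row_end \<mu> s))"
  by (simp add: e_mor_def remove_box_tableau act_toGA remove_box_young)

lemma norm_factor_eq: "removable \<mu> s \<Longrightarrow> norm_factor \<mu> s = nf (row_end \<mu> s)"
proof -
  assume s: "removable \<mu> s"
  then have "s \<noteq> 0" by (simp add: removable_def)
  moreover have "young (remove_box \<mu> s) id = (tau (f (row_end \<mu> s)) :: 'a)"
    by (simp add: tau_def coef_toGA ap_zero_fun flip: remove_box_young[OF s])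
  ultimately show ?thesis by (simp add: norm_factor_def nf_def young_id)
qed

lemma row_sym_eq: "row_sym l s = Act (sum_list l) (Sy False (Pg {i. i < sum_list l \<and> row_of l i = s - 1}))"
proof -
  let ?X = "{i. i < sum_list l \<and> row_of l i = s - 1}"
  have sub: "p permutes {..<sum_list l}" if "p permutes ?X" for p
    by (rule permutes_subset[OF that]) auto
  have 1: "{g \<in> symg (sum_list l). ap g \<in> {p. p permutes ?X}} = Pg ?X"
    using sub permutes_symg by (auto simp: Pg_def) (metis ap_inverse)
  have 2: "{p. p permutes ?X} \<subseteq> {p. p permutes {..<sum_list l}}" using sub by auto
  show ?thesis unfolding row_sym_def act_toGA toGA_symmetrizer(1)[OF 2] 1 ..
qed

lemma Pg_row_subset: "Pg {i. i < M \<and> h i = k} \<subseteq> Grp M h"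
proof
  fix g assume "g \<in> Pg {i. i < M \<and> h i = k}"
  then have g: "ap g permutes {i. i < M \<and> h i = k}" by (simp add: Pg_def)
  have "g \<in> symg M" using permutes_not_in[OF g] by (auto simp: symg_def)
  moreover have "h (ap g i) = h i" for i
    using permutes_in_image[OF g, of i] permutes_not_in[OF g, of i] by (cases "i < M \<and> h i = k") auto
  ultimately show "g \<in> Grp M h" by (simp add: Grp_def)
qed

lemma row_sym_absorb: "Sy False (Pg {i. i < M \<and> h i = k}) * (Sy False (Grp M h) * x) = Sy False (Grp M h) * x"
  by (intro Sy_absorb' is_grp_Grp is_grp_Pg Pg_row_subset) simp

text \<open>The symmetrizer of row \<open>s\<close> disappears into the full row symmetrizer of
  \<open>yng\<close>, and the smaller idempotent slides below the cap by
  \<open>CC_nat_n\<close>.\<close>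

lemma rho_eq:
  assumes s: "removable \<mu> s"
  shows "rho \<mu> s = emb (GG' (row_end \<mu> s))"
proof -
  let ?p = "row_end \<mu> s"
  have p: "corner ?p" by (rule removable_corner[OF s])
  have s0: "s \<noteq> 0" using s by (simp add: removable_def)
  let ?S = "Sy False (Pg {i. i < n \<and> row_of \<mu> i = s - 1}) :: 'a ga"
  have S: "?S \<in> GA n" using Pg_row_subset[of n "row_of \<mu>" "s - 1"] Grp_subset by (intro Sy_GA) blast
  have "move_out \<mu> s = word_dgm n (rev [?p..<n - 1])" by (simp add: move_out_def n_sum)
  also have "\<dots> = pd n (wperm (rev [?p..<n - 1]))" by (rule pd_word[symmetric]) auto
  also have "\<dots> = Act n (gb (- mv n ?p))" using mv_symg[of n ?p] by (simp add: wperm_rev mv_def Act_gb)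
  finally have mo: "move_out \<mu> s = Act n (gb (- mv n ?p))" .
  have g: "gb (- mv n ?p) \<in> (GA n :: 'a ga set)" using mv_symg[of n ?p] by auto
  have Sy: "?S * yng = yng" unfolding yng_def by (simp add: row_sym_absorb)
  have "move_out \<mu> s * row_sym \<mu> s * e_mor \<mu> = (Act n (gb (- mv n ?p) * ?S * yng) :: 'a hmor)"
    using g S by (simp add: mo row_sym_eq n_sum e_mor_mu Act_mult GA_mult)
  also have "\<dots> = Act n (gb (- mv n ?p) * yng)" by (simp only: mult.assoc Sy)
  finally have 1: "(move_out \<mu> s * row_sym \<mu> s * e_mor \<mu>) \<boxtimes> idn [Up] = (aP n (gb (- mv n ?p) * yng) :: 'a hmor)"
    by (simp add: aP_def)
  have "e_mor (remove_box \<mu> s) * CC N * aP n (gb (- mv n ?p) * yng)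
      = CC N * (aP n (f ?p) * aP n (gb (- mv n ?p) * yng) :: 'a hmor)"
    unfolding remove_box_e_mor[OF s] CC_nat_n[OF f_simps(7)[OF p], symmetric] by (simp only: mult.assoc)
  also have "\<dots> = GG' ?p"
    unfolding aP_mult[OF f_GA_Suc[OF p] GA_mult[OF g yng_GA]] by (simp add: GG'_def g'_def)
  finally show ?thesis
    using s0 1 by (simp add: rho_def n_sum n_Suc CC_def)
qed

lemma iota_eq:
  assumes s: "removable \<mu> s"
  shows "iota \<mu> s = emb (GG (row_end \<mu> s))"
proof -
  let ?p = "row_end \<mu> s" and ?l = "remove_box \<mu> s"
  have p: "corner ?p" by (rule removable_corner[OF s])
  have s0: "s \<noteq> 0" using s by (simp add: removable_def)
  note rb = remove_box_tableau[OF s]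
  let ?S = "Sy False (Pg {i. i < N \<and> row_of ?l i = s - 1}) :: 'a ga"
  have S: "?S \<in> GA N" using Pg_row_subset[of N "row_of ?l" "s - 1"] Grp_subset by (intro Sy_GA) blast
  have "move_in \<mu> s = word_dgm n [?p..<n - 1]" by (simp add: move_in_def n_sum)
  also have "\<dots> = pd n (wperm [?p..<n - 1])" by (rule pd_word[symmetric]) auto
  also have "\<dots> = Act n (gb (mv n ?p))" using mv_symg[of n ?p] by (simp add: mv_def Act_gb)
  finally have mi: "move_in \<mu> s = Act n (gb (mv n ?p))" .
  have g: "gb (mv n ?p) \<in> (GA n :: 'a ga set)" using mv_symg[of n ?p] by auto
  have Grp: "Grp N (srow ?p) = Grp N (row_of ?l)" using rb(2) by (intro Grp_cong) auto
  have "?S * (R ?p * C ?p) = R ?p * C ?p" unfolding Grp by (rule row_sym_absorb)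
  then have Sf: "?S * f ?p = f ?p" by (simp only: f_eq[OF p] sm_mult_right)
  have 1: "(e_mor \<mu> * move_in \<mu> s) \<boxtimes> idn [Up] = (aP n (yng * gb (mv n ?p)) :: 'a hmor)"
    using g by (simp add: aP_def e_mor_mu mi Act_mult)
  have 2: "row_sym ?l s * e_mor ?l = (Act N (f ?p) :: 'a hmor)"
    unfolding row_sym_eq rb(1) remove_box_e_mor[OF s] Act_mult[OF S f_simps(7)[OF p], symmetric] Sf ..
  have "aP n (yng * gb (mv n ?p)) * KK N * row_sym ?l s * e_mor ?l
      = aP n (yng * gb (mv n ?p)) * (KK N * Act N (f ?p) :: 'a hmor)"
    by (simp only: mult.assoc 2)
  also have "\<dots> = aP n (yng * gb (mv n ?p)) * aP n (f ?p) * KK N"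
    unfolding KK_nat_n[OF f_simps(7)[OF p], symmetric] by (simp only: mult.assoc)
  also have "\<dots> = GG ?p"
    unfolding aP_mult[OF GA_mult[OF yng_GA g] f_GA_Suc[OF p]] by (simp add: GG_def g_def)
  finally show ?thesis
    using s0 1 by (simp add: iota_def n_sum n_Suc KK_def)
qed

end

section \<open>The Karoubi envelope\<close>

context nonempty_partition
begin

lemma GG_props:
  assumes p: "corner p"
  shows "tp (GG p) (Qpow N) (Qpow n @ [Up])" "tp (GG' p) (Qpow n @ [Up]) (Qpow N)"
    "aP n yng * GG p = GG p" "GG p * Act N (f p) = GG p"
    "GG' p * aP n yng = GG' p" "Act N (f p) * GG' p = GG' p"
proof -
  have gs: "yng * g p = g p" "g p * f p = g p" "g' p * yng = g' p" "f p * g' p = g' p"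
    by (simp_all add: g_def g'_def mult.assoc f_simps[OF p])
  show "tp (GG p) (Qpow N) (Qpow n @ [Up])" "tp (GG' p) (Qpow n @ [Up]) (Qpow N)"
    unfolding GG_def GG'_def by (rule tp_mult[OF tp_KK tp_aP] tp_mult[OF tp_aP tp_CC]; simp add: n_Suc)+
  show "aP n yng * GG p = GG p"
    unfolding GG_def mult.assoc[symmetric] aP_mult[OF yng_GA g_GA(1)[OF p]] gs ..
  show "GG' p * aP n yng = GG' p"
    unfolding GG'_def mult.assoc aP_mult[OF g_GA(2)[OF p] yng_GA] gs ..
  have "GG p * Act N (f p) = aP n (g p) * (KK N * Act N (f p))" by (simp only: GG_def mult.assoc)
  also have "\<dots> = aP n (g p) * aP n (f p) * KK N"
    by (simp only: KK_nat_n[OF f_simps(7)[OF p], symmetric] mult.assoc)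
  also have "\<dots> = GG p" by (simp only: aP_mult[OF g_GA(1)[OF p] f_GA_Suc[OF p]] gs GG_def)
  finally show "GG p * Act N (f p) = GG p" .
  have "Act N (f p) * GG' p = Act N (f p) * CC N * aP n (g' p)" by (simp only: GG'_def mult.assoc)
  also have "\<dots> = CC N * (aP n (f p) * aP n (g' p))"
    by (simp only: CC_nat_n[OF f_simps(7)[OF p], symmetric] mult.assoc)
  also have "\<dots> = GG' p" by (simp only: aP_mult[OF f_GA_Suc[OF p] g_GA(2)[OF p]] gs GG'_def)
  finally show "Act N (f p) * GG' p = GG' p" .
qed

end

lemma emb_mult: "emb f * emb g = emb (f * g)"
  by (rule eq_matI) (simp_all add: emb_def scalar_prod_def)

lemma H_scal_emb: "H_scal c (emb f) = emb (scal c f)"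
  by (rule eq_matI) (simp_all add: H_scal_def emb_def)

lemma kron_emb: "kron (emb f) (emb g) = emb (f \<boxtimes> g)"
  by (rule eq_matI) (simp_all add: kron_def emb_def)

lemma emb_carrier [simp]: "emb f \<in> carrier_mat 1 1" "dim_row (emb f) = 1" "dim_col (emb f) = 1"
  "emb f $$ (0, 0) = f"
  by (simp_all add: emb_def)

lemma tp_hom: "tp f a b \<Longrightarrow> f \<in> hom a b"
  by (simp add: hom_def idn_left idn_right)

lemma emb_H_hom: "tp f a b \<Longrightarrow> y * f = f \<Longrightarrow> f * x = f \<Longrightarrow> emb f \<in> H_hom ([a], emb x) ([b], emb y)"
  by (auto simp: H_hom_def add_hom_def emb_mult tp_hom)

lemma diag_block_emb:
  "diag_block_mat (map emb ds) = mat (length ds) (length ds) (\<lambda>(i, j). if i = j then ds ! i else 0)"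
proof (induction ds)
  case (Cons d ds)
  show ?case
    unfolding list.map diag_block_mat.simps Cons
    by (rule eq_matI) (auto simp: Let_def emb_def nth_Cons' four_block_mat_def split: if_splits)
qed (simp, rule eq_matI, auto)

text \<open>The maps form a column \<open>M\<close> and a row \<open>T\<close> with
  \<open>T * M = emb e\<close> and \<open>M * T = D\<close>. Since \<open>M\<close> and
  \<open>T\<close> absorb \<open>emb e\<close>, the absorption of \<open>D\<close> and its
  idempotency are formal.\<close>

lemma H_iso_dsum:
  fixes e :: "'k::field_char_0 hmor"
  assumes e: "tp e a a" "e * e = e"
    and r: "\<And>i. i < k \<Longrightarrow> tp (r i) a (w i)" "\<And>i. i < k \<Longrightarrow> r i * e = r i"
    and t: "\<And>i. i < k \<Longrightarrow> tp (t i) (w i) a" "\<And>i. i < k \<Longrightarrow> e * t i = t i"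
    and d: "\<And>i. i < k \<Longrightarrow> tp (d i) (w i) (w i)"
    and rt: "\<And>i j. i < k \<Longrightarrow> j < k \<Longrightarrow> r i * t j = (if i = j then d i else 0)"
    and tr: "(\<Sum>i<k. t i * r i) = e"
  shows "H_iso ([a], emb e) (map w [0..<k], mat k k (\<lambda>(i, j). if i = j then d i else 0))"
proof -
  define M where "M = mat k 1 (\<lambda>(i, j). r i)"
  define T where "T = mat 1 k (\<lambda>(i, j). t j)"
  define D where "D = mat k k (\<lambda>(i, j). if i = j then d i else 0)"
  have c: "M \<in> carrier_mat k 1" "T \<in> carrier_mat 1 k" "D \<in> carrier_mat k k" "emb e \<in> carrier_mat 1 1"
    by (simp_all add: M_def T_def D_def emb_def)
  have TM: "T * M = emb e"
    using tr by (intro eq_matI) (simp_all add: T_def M_def scalar_prod_def emb_def atLeast0LessThan)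
  have MT: "M * T = D"
    by (rule eq_matI) (simp_all add: T_def M_def D_def scalar_prod_def rt)
  have Me: "M * emb e = M" by (rule eq_matI) (simp_all add: M_def emb_def scalar_prod_def r)
  have eT: "emb e * T = T" by (rule eq_matI) (simp_all add: T_def emb_def scalar_prod_def t)
  have DM: "D * M = M"
    using assoc_mult_mat[OF c(1) c(2) c(1)] by (simp only: MT TM Me)
  have TD: "T * D = T"
    using assoc_mult_mat[OF c(2) c(1) c(2)] by (simp only: MT TM eT)
  have DD: "D * D = D"
    using assoc_mult_mat[OF c(1) c(2) c(3)] by (simp only: MT TD)
  let ?X = "([a], emb e)" and ?Y = "(map w [0..<k], D)"
  have X: "?X \<in> H_obj" using e by (auto simp: H_obj_def add_hom_def emb_mult tp_hom)
  have Y: "?Y \<in> H_obj"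
    using d DD by (auto simp: H_obj_def add_hom_def tp_hom D_def tp_gens)
  have MH: "M \<in> H_hom ?X ?Y"
    using r c by (auto simp: H_hom_def add_hom_def tp_hom M_def[symmetric] DM Me) (simp add: M_def tp_hom)
  have TH: "T \<in> H_hom ?Y ?X"
    using t c by (auto simp: H_hom_def add_hom_def tp_hom T_def[symmetric] eT TD) (simp add: T_def tp_hom)
  show ?thesis
    using X Y MH TH TM MT unfolding H_iso_def H_id_def D_def by auto
qed

lemma H_iso_H_dsum:
  fixes e :: "'k::field_char_0 hmor"
  assumes "distinct ss"
    and e: "tp e a a" "e * e = e"
    and r: "\<And>s. s \<in> set ss \<Longrightarrow> tp (r s) a (w s) \<and> r s * e = r s"
    and t: "\<And>s. s \<in> set ss \<Longrightarrow> tp (t s) (w s) a \<and> e * t s = t s"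
    and d: "\<And>s. s \<in> set ss \<Longrightarrow> tp (d s) (w s) (w s)"
    and rt: "\<And>s s'. s \<in> set ss \<Longrightarrow> s' \<in> set ss \<Longrightarrow> r s * t s' = (if s = s' then d s else 0)"
    and tr: "(\<Sum>s\<in>set ss. t s * r s) = e"
  shows "H_iso ([a], emb e) (H_dsum (map (\<lambda>s. ([w s], emb (d s))) ss))"
proof -
  let ?k = "length ss"
  have "H_dsum (map (\<lambda>s. ([w s], emb (d s))) ss) = (map w ss, diag_block_mat (map emb (map d ss)))"
    by (simp add: H_dsum_def comp_def)
  also have "map w ss = map (\<lambda>i. w (ss ! i)) [0..<?k]"
    by (rule nth_equalityI) simp_all
  also have "diag_block_mat (map emb (map d ss)) = mat ?k ?k (\<lambda>(i, j). if i = j then d (ss ! i) else 0)"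
    unfolding diag_block_emb by (rule eq_matI) auto
  finally have eq: "H_dsum (map (\<lambda>s. ([w s], emb (d s))) ss)
    = (map (\<lambda>i. w (ss ! i)) [0..<?k], mat ?k ?k (\<lambda>(i, j). if i = j then d (ss ! i) else 0))" .
  have "(\<Sum>i<?k. t (ss ! i) * r (ss ! i)) = (\<Sum>s\<in>set ss. t s * r s)"
    by (rule sum.reindex_bij_betw[OF bij_betw_nth[OF assms(1) refl refl]])
  then show ?thesis
    unfolding eq
    by (intro H_iso_dsum[where r = "\<lambda>i. r (ss ! i)" and t = "\<lambda>i. t (ss ! i)"])
      (use e r t d rt tr assms(1) in \<open>auto simp: nth_eq_iff_index_eq\<close>)
qed

context partition
begin

text \<open>All diagrammatic facts in one existence statement, so that the empty partition, which
  has no last strand, enters the theorem like any other.\<close>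

lemma decomposition_data:
  defines "a \<equiv> Qpow n @ [Up]" and "I \<equiv> insert 0 {s. removable \<mu> s}"
    and "e \<equiv> aP n yng :: 'k::field_char_0 hmor"
    and "w \<equiv> \<lambda>s. if s = 0 then Up # Qpow n else Qpow (sum_list (remove_box \<mu> s))"
    and "d \<equiv> \<lambda>s. if s = 0 then idn [Up] \<boxtimes> Act n yng else e_mor (remove_box \<mu> s) :: 'k hmor"
  shows "\<exists>r t. (\<forall>s\<in>I. rho \<mu> s = emb (r s) \<and> H_scal (norm_factor \<mu> s) (iota \<mu> s) = emb (t s) \<and>
      tp (r s) a (w s) \<and> tp (t s) (w s) a \<and> d s * r s = r s \<and> r s * e = r s \<and> e * t s = t s \<and>
      t s * d s = t s \<and> tp (d s) (w s) (w s)) \<and>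
    (\<forall>s\<in>I. \<forall>s'\<in>I. r s * t s' = (if s = s' then d s else 0)) \<and> (\<Sum>s\<in>I. t s * r s) = e"
proof -
  let ?y = "yng :: 'k ga"
  define e' where "e' = idn [Up] \<boxtimes> Act n ?y"
  define r0 where "r0 = cross_left n * e"
  define t0 where "t0 = cross_right n * e'"
  have e: "tp e a a" "e * e = e" unfolding e_def a_def by (simp_all add: tp_aP aP_mult)
  have tp_e': "tp e' (Up # Qpow n) (Up # Qpow n)"
    unfolding e'_def by (rule tp_conv[OF tp_tens[OF tp_gens(1) tp_Act]]) simp_all
  have e': "e' * e' = e'"
    by (simp add: e'_def tens_mult[OF tp_gens(1) tp_gens(1) tp_Act tp_Act] idn_left[OF tp_gens(1)] flip: Act_mult)
  have XL: "cross_left n * e = e' * cross_left n" unfolding e_def e'_def by (rule cross_left_Act)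
  have XR: "e * cross_right n = cross_right n * e'" unfolding e_def e'_def by (rule cross_right_Act)
  have zero: "rho \<mu> 0 = emb r0" "H_scal (norm_factor \<mu> 0) (iota \<mu> 0) = emb t0"
    by (simp_all add: rho_def iota_def r0_def t0_def e_def e'_def aP_def n_sum e_mor_mu norm_factor_def H_scal_emb)
  have tp0: "tp r0 a (Up # Qpow n)" "tp t0 (Up # Qpow n) a"
    unfolding r0_def t0_def a_def
    using tp_mult[OF e(1) tp_cross_left[of n]] tp_mult[OF tp_e' tp_cross_right[of n]] by (simp_all add: a_def)
  have r0': "r0 = e' * cross_left n" and t0': "t0 = e * cross_right n"
    by (simp_all only: r0_def t0_def XL XR)
  have r0: "e' * r0 = r0" "r0 * e = r0"
    by (simp_all only: r0' mult.assoc[symmetric] e', simp_all only: r0'[symmetric] r0_def mult.assoc e(2))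
  have t0: "e * t0 = t0" "t0 * e' = t0"
    by (simp_all only: t0' mult.assoc[symmetric] e(2), simp_all only: t0'[symmetric] t0_def mult.assoc e')
  have r0t0: "r0 * t0 = e'"
  proof -
    have "r0 * t0 = e' * (cross_left n * cross_right n) * e'" by (simp only: r0_def t0_def XL mult.assoc)
    then show ?thesis by (simp only: cross_left_cross_right idn_right[OF tp_e'] e')
  qed
  show ?thesis
  proof (cases n)
    \<comment> \<open>Without downward strands both crossings are \<open>idn [Up]\<close>, and 0 is
      the only index.\<close>
    case 0
    then have "\<mu> = []" using pos[of 0] n_sum by (cases \<mu>) auto
    then have I: "I = {0}" by (auto simp: I_def removable_def)
    have "cross_right n * cross_left n = (idn a :: 'k hmor)"
      using 0 by (simp add: a_def Qpow_simps idn_left[OF tp_gens(1)])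
    moreover have "t0 * r0 = e * (cross_right n * cross_left n) * e"
      by (simp only: t0' r0_def mult.assoc)
    ultimately have "t0 * r0 = e" by (simp only: idn_right[OF e(1)] e(2))
    then show ?thesis
      using zero tp0 r0 t0 r0t0 tp_e' unfolding I
      by (intro exI[of _ "\<lambda>_. r0"] exI[of _ "\<lambda>_. t0"]) (simp add: w_def d_def e'_def)
  next
    case (Suc N)
    interpret nonempty_partition \<mu> n N by unfold_locales (rule Suc)
    let ?p = "row_end \<mu>"
    define r where "r s = (if s = 0 then r0 else GG' (?p s))" for s
    \<comment> \<open>The scalar sits on the side of \<open>iota\<close> and cancels the
      \<open>inverse (nf p)\<close> of \<open>GG'_GG\<close>.\<close>
    define t where "t s = (if s = 0 then t0 else scal (nf (?p s)) (GG (?p s)))" for s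
    have pos: "s \<noteq> 0" "corner (?p s)" if "removable \<mu> s" for s
      using that removable_corner by (auto simp: removable_def)
    have nf: "nf p \<noteq> (0 :: 'k)" if "corner p" for p
    proof -
      have "tau (f p) \<noteq> (0 :: 'k)" by (rule f_simps(8)[OF that])
      then show ?thesis using tau_yng_nz[where 'k = 'k] by (simp add: nf_def)
    qed
    have r0GG: "r0 * GG p = 0" if "corner p" for p
      unfolding r0_def e_def using cross_left_GG[OF yng_GA that] by simp
    have GGt0: "GG' p * t0 = 0" for p
      unfolding t0_def by (rule GG'_cross_right)
    have I: "finite {s. removable \<mu> s}" "0 \<notin> {s. removable \<mu> s}"
      using bij_betw_finite[OF bij_corners] finite_corners by (auto simp: removable_def)
    have "(\<Sum>s\<in>I. t s * r s) = t0 * r0 + (\<Sum>s\<in>{s. removable \<mu> s}. t s * r s)"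
      using I by (simp add: I_def r_def t_def)
    also have "(\<Sum>s\<in>{s. removable \<mu> s}. t s * r s)
        = (\<Sum>s\<in>{s. removable \<mu> s}. scal (nf (?p s)) (GG (?p s) * GG' (?p s)))"
      by (intro sum.cong) (auto simp: r_def t_def removable_def)
    also have "\<dots> = (\<Sum>p | corner p. scal (nf p) (GG p * GG' p))"
      by (rule sum.reindex_bij_betw[OF bij_corners])
    also have "t0 * r0 + \<dots> = e"
      using decomposition[where 'k = 'k] by (simp add: e_def t0_def r0_def e'_def)
    finally have sum: "(\<Sum>s\<in>I. t s * r s) = e" .
    have rt: "r s * t s' = (if s = s' then d s else 0)" if ss: "s \<in> I" "s' \<in> I" for s s'
    proof -
      consider "s = 0" "s' = 0" | "s = 0" "removable \<mu> s'" | "removable \<mu> s" "s' = 0"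
        | "removable \<mu> s" "removable \<mu> s'" using ss unfolding I_def by blast
      then show ?thesis
      proof cases
        case 4
        have "?p s = ?p s' \<longleftrightarrow> s = s'"
          using bij_corners 4 by (auto simp: bij_betw_def inj_on_def)
        moreover have "nf (?p s) * inverse (nf (?p s)) = (1 :: 'k)"
          using nf[OF pos(2)[OF 4(1)]] by simp
        ultimately show ?thesis
          using pos[OF 4(1)] pos[OF 4(2)] 4
          by (auto simp: r_def t_def d_def GG'_GG remove_box_e_mor)
      qed (use r0t0 r0GG GGt0 pos in \<open>auto simp: r_def t_def d_def e'_def\<close>)
    qed
    have each: "rho \<mu> s = emb (r s) \<and> H_scal (norm_factor \<mu> s) (iota \<mu> s) = emb (t s) \<and>
      tp (r s) a (w s) \<and> tp (t s) (w s) a \<and> d s * r s = r s \<and> r s * e = r s \<and> e * t s = t s \<and>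
      t s * d s = t s \<and> tp (d s) (w s) (w s)" if "s \<in> I" for s
    proof (cases "s = 0")
      case True
      then show ?thesis using zero tp0 r0 t0 tp_e' by (simp add: r_def t_def w_def d_def e'_def)
    next
      case False
      then have s: "removable \<mu> s" using that by (simp add: I_def)
      note G = GG_props[OF pos(2)[OF s]]
      show ?thesis
        using False
        by (simp add: G tp_Act r_def t_def w_def d_def rho_eq[OF s] iota_eq[OF s] norm_factor_eq[OF s] H_scal_emb
            remove_box_tableau(1)[OF s] remove_box_e_mor[OF s] a_def e_def tp_scal)
    qed
    show ?thesis using each rt sum by blast
  qed
qed

end

theorem proposition4p9:
  fixes \<mu> :: "nat list" and n :: nat
  defines "QP \<equiv> H_tens (Q_obj \<mu>) (P_obj :: 'k::field_char_0 hobj)"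
    and "I \<equiv> insert 0 {s. removable \<mu> s}"
    and "\<rho> \<equiv> \<lambda>s. rho \<mu> s :: 'k hmor mat"
    and "\<iota> \<equiv> \<lambda>s. H_scal (norm_factor \<mu> s) (iota \<mu> s :: 'k hmor mat)"
  assumes "is_partition \<mu> n"
  shows "(\<forall>s\<in>I. \<rho> s \<in> H_hom QP (summand \<mu> s) \<and> \<iota> s \<in> H_hom (summand \<mu> s) QP) \<and>
    (\<forall>s\<in>I. \<forall>r\<in>I. \<rho> s * \<iota> r =
       (if s = r then H_id (summand \<mu> s) else H_zero (summand \<mu> r) (summand \<mu> s))) \<and>
    H_id QP = H_sum QP QP (\<lambda>s. \<iota> s * \<rho> s) I \<and>
    H_iso QP (H_dsum (H_tens P_obj (Q_obj \<mu>) #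
       map (\<lambda>s. Q_obj (remove_box \<mu> s)) (filter (removable \<mu>) [1..<length \<mu> + 1])))"
proof -
  interpret partition \<mu> n by unfold_locales (rule assms)
  define a where "a = Qpow n @ [Up]"
  define e where "e = (aP n yng :: 'k hmor)"
  define w where "w s = (if s = 0 then Up # Qpow n else Qpow (sum_list (remove_box \<mu> s)))" for s
  define d where "d s = (if s = 0 then idn [Up] \<boxtimes> Act n yng else e_mor (remove_box \<mu> s) :: 'k hmor)" for s
  obtain r t where each: "\<And>s. s \<in> I \<Longrightarrow> \<rho> s = emb (r s) \<and> \<iota> s = emb (t s) \<and>
      tp (r s) a (w s) \<and> tp (t s) (w s) a \<and> d s * r s = r s \<and> r s * e = r s \<and> e * t s = t s \<and>
      t s * d s = t s \<and> tp (d s) (w s) (w s)"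
    and rt: "\<And>s s'. s \<in> I \<Longrightarrow> s' \<in> I \<Longrightarrow> r s * t s' = (if s = s' then d s else 0)"
    and tr: "(\<Sum>s\<in>I. t s * r s) = e"
    using decomposition_data[where 'k = 'k]
    unfolding \<rho>_def \<iota>_def I_def a_def e_def w_def[abs_def] d_def[abs_def] by blast
  have e: "tp e a a" "e * e = e" unfolding e_def a_def by (simp_all add: tp_aP aP_mult)
  have QP: "QP = ([a], emb e)"
    by (simp add: QP_def H_tens_def Q_obj_def P_obj_def kron_emb n_sum a_def e_def aP_def e_mor_mu)
  have PQ: "H_tens P_obj (Q_obj \<mu>) = ([w 0], emb (d 0))"
    by (simp add: H_tens_def Q_obj_def P_obj_def kron_emb n_sum e_mor_mu w_def d_def)
  have Q: "Q_obj (remove_box \<mu> s) = ([w s], emb (d s))" if "s \<noteq> 0" for s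
    using that by (simp add: Q_obj_def w_def d_def)
  have sm: "summand \<mu> s = ([w s], emb (d s))" for s
    by (cases "s = 0") (simp_all add: summand_def PQ Q)
  have 1: "\<rho> s \<in> H_hom QP (summand \<mu> s) \<and> \<iota> s \<in> H_hom (summand \<mu> s) QP" if "s \<in> I" for s
    using each[OF that] by (simp add: QP sm emb_H_hom)
  have 2: "\<rho> s * \<iota> s' = (if s = s' then H_id (summand \<mu> s) else H_zero (summand \<mu> s') (summand \<mu> s))"
    if "s \<in> I" "s' \<in> I" for s s'
  proof -
    have "emb 0 = (0\<^sub>m 1 1 :: 'k hmor mat)" by (rule eq_matI) (simp_all add: emb_def)
    then show ?thesis
      using each[OF that(1)] each[OF that(2)] rt[OF that]
      by (simp add: emb_mult sm H_id_def H_zero_def)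
  qed
  \<comment> \<open>Source and target are single words, so only one matrix entry has to be
    compared.\<close>
  have "(\<Sum>s\<in>I. (\<iota> s * \<rho> s) $$ (0, 0)) = (\<Sum>s\<in>I. t s * r s)"
    using each by (intro sum.cong) (simp_all add: emb_mult)
  then have 3: "H_id QP = H_sum QP QP (\<lambda>s. \<iota> s * \<rho> s) I"
    by (intro eq_matI) (simp_all add: H_id_def H_sum_def QP tr)
  \<comment> \<open>This list enumerates \<open>I\<close> without repetition, in the order of the
    summands of the direct sum.\<close>
  let ?ss = "0 # filter (removable \<mu>) [1..<length \<mu> + 1]"
  have I: "I = set ?ss" by (auto simp: I_def removable_def)
  have "H_tens P_obj (Q_obj \<mu>) # map (\<lambda>s. Q_obj (remove_box \<mu> s)) (filter (removable \<mu>) [1..<length \<mu> + 1])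
      = map (\<lambda>s. ([w s], emb (d s))) ?ss"
    by (simp add: PQ Q del: upt_Suc)
  moreover have "H_iso ([a], emb e) (H_dsum (map (\<lambda>s. ([w s], emb (d s))) ?ss))"
  proof (rule H_iso_H_dsum[where r = r and t = t])
    show "distinct ?ss" by simp
    show "tp (r s) a (w s) \<and> r s * e = r s" if "s \<in> set ?ss" for s
      using each[OF that[folded I]] by blast
    show "tp (t s) (w s) a \<and> e * t s = t s" if "s \<in> set ?ss" for s
      using each[OF that[folded I]] by blast
    show "tp (d s) (w s) (w s)" if "s \<in> set ?ss" for s
      using each[OF that[folded I]] by blast
    show "r s * t s' = (if s = s' then d s else 0)" if "s \<in> set ?ss" "s' \<in> set ?ss" for s s'
      by (rule rt[OF that(1)[folded I] that(2)[folded I]])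
    show "(\<Sum>s\<in>set ?ss. t s * r s) = e" by (rule tr[unfolded I])
  qed (fact e)+
  ultimately have 4: "H_iso QP (H_dsum (H_tens P_obj (Q_obj \<mu>) #
       map (\<lambda>s. Q_obj (remove_box \<mu> s)) (filter (removable \<mu>) [1..<length \<mu> + 1])))"
    by (simp only: QP)
  show ?thesis
    by (intro conjI ballI 1[THEN conjunct1] 1[THEN conjunct2] 2 3 4)
qed

end
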